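(* Let $\mathcal R$ be an i-minimal expansion of the ordered field of real numbers, and let $C \subseteq \mathbb{R}^n$ be definable and nonempty. Then $C$ is Lebesgue measurable, $C$ is definably almost open, and $\dim_{\mathcal H}(C) = \dim(C)$.
   Context: "Definable" means definable in $\mathcal R$ with parameters. $\mathcal R$ is i-minimal if every definable subset of $\mathbb{R}$ either has nonempty interior or is nowhere dense. $\dim_{\mathcal H}$ denotes Hausdorff dimension. For $X\subseteq\mathbb{R}^n$, $\dim(X)$ is the maximum $e$ such that there is a coordinate subspace $L\subseteq\mathbb{R}^n$ of linear dimension $e$ for which the orthogonal projection of $X$ onto $L$ has nonempty interior in $L$. A definable $X\subseteq \mathbb{R}^n$ is definably meager if there is a definable increasing family $(X_t: t\in\mathbb{R})$ of closed nowhere dense subsets of $\mathbb{R}^n$ with $X\subseteq\bigcup_t X_t$. A definable set $X$ is definably almost open if $X = U \,\Delta\, F$ for some definable open set $U$ and some definably meager set $F$ ($\Delta$ = symmetric difference). *)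

theory Defs
  imports "HOL-Analysis.Analysis"
begin

section \<open>Expansions of the real ordered field\<close>

text \<open>
  An expansion of the real ordered field is given by arbitrary further function symbols
  \<open>'f\<close> and relation symbols \<open>'r\<close>, with arities and interpretations; the symbols of the
  language of ordered fields are built into the syntax with their standard meaning.
  Interpretations are only ever applied to lists whose length is the arity.
\<close>

record ('f, 'r) field_expansion =
  fun_arity :: "'f \<Rightarrow> nat"
  fun_interp :: "'f \<Rightarrow> real list \<Rightarrow> real"
  rel_arity :: "'r \<Rightarrow> nat"
  rel_interp :: "'r \<Rightarrow> real list \<Rightarrow> bool"

text \<open>\<open>Param a\<close> is a constant naming the real \<open>a\<close>: formulas carry their parameters.\<close>

datatype 'f tm =
    Var nat
  | Param real
  | ZeroT
  | OneT
  | AddT "'f tm" "'f tm"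
  | NegT "'f tm"
  | MulT "'f tm" "'f tm"
  | FunT 'f "'f tm list"

datatype ('f, 'r) fm =
    EqF "'f tm" "'f tm"
  | LessF "'f tm" "'f tm"
  | RelF 'r "'f tm list"
  | NotF "('f, 'r) fm"
  | AndF "('f, 'r) fm" "('f, 'r) fm"
  | ExF nat "('f, 'r) fm"

fun wf_tm :: "('f, 'r) field_expansion \<Rightarrow> 'f tm \<Rightarrow> bool" where
  "wf_tm M (Var i) = True"
| "wf_tm M (Param a) = True"
| "wf_tm M ZeroT = True"
| "wf_tm M OneT = True"
| "wf_tm M (AddT s t) = (wf_tm M s \<and> wf_tm M t)"
| "wf_tm M (NegT t) = wf_tm M t"
| "wf_tm M (MulT s t) = (wf_tm M s \<and> wf_tm M t)"
| "wf_tm M (FunT f ts) = (length ts = fun_arity M f \<and> (\<forall>t\<in>set ts. wf_tm M t))"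

fun wf_fm :: "('f, 'r) field_expansion \<Rightarrow> ('f, 'r) fm \<Rightarrow> bool" where
  "wf_fm M (EqF s t) = (wf_tm M s \<and> wf_tm M t)"
| "wf_fm M (LessF s t) = (wf_tm M s \<and> wf_tm M t)"
| "wf_fm M (RelF r ts) = (length ts = rel_arity M r \<and> (\<forall>t\<in>set ts. wf_tm M t))"
| "wf_fm M (NotF p) = wf_fm M p"
| "wf_fm M (AndF p q) = (wf_fm M p \<and> wf_fm M q)"
| "wf_fm M (ExF i p) = wf_fm M p"

fun vars_tm :: "'f tm \<Rightarrow> nat set" where
  "vars_tm (Var i) = {i}"
| "vars_tm (Param a) = {}"
| "vars_tm ZeroT = {}"
| "vars_tm OneT = {}"
| "vars_tm (AddT s t) = vars_tm s \<union> vars_tm t"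
| "vars_tm (NegT t) = vars_tm t"
| "vars_tm (MulT s t) = vars_tm s \<union> vars_tm t"
| "vars_tm (FunT f ts) = (\<Union>t\<in>set ts. vars_tm t)"

fun free_vars :: "('f, 'r) fm \<Rightarrow> nat set" where
  "free_vars (EqF s t) = vars_tm s \<union> vars_tm t"
| "free_vars (LessF s t) = vars_tm s \<union> vars_tm t"
| "free_vars (RelF r ts) = (\<Union>t\<in>set ts. vars_tm t)"
| "free_vars (NotF p) = free_vars p"
| "free_vars (AndF p q) = free_vars p \<union> free_vars q"
| "free_vars (ExF i p) = free_vars p - {i}"

fun eval_tm :: "('f, 'r) field_expansion \<Rightarrow> (nat \<Rightarrow> real) \<Rightarrow> 'f tm \<Rightarrow> real" where
  "eval_tm M v (Var i) = v i"
| "eval_tm M v (Param a) = a"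
| "eval_tm M v ZeroT = 0"
| "eval_tm M v OneT = 1"
| "eval_tm M v (AddT s t) = eval_tm M v s + eval_tm M v t"
| "eval_tm M v (NegT t) = - eval_tm M v t"
| "eval_tm M v (MulT s t) = eval_tm M v s * eval_tm M v t"
| "eval_tm M v (FunT f ts) = fun_interp M f (map (eval_tm M v) ts)"

fun sat :: "('f, 'r) field_expansion \<Rightarrow> (nat \<Rightarrow> real) \<Rightarrow> ('f, 'r) fm \<Rightarrow> bool" where
  "sat M v (EqF s t) = (eval_tm M v s = eval_tm M v t)"
| "sat M v (LessF s t) = (eval_tm M v s < eval_tm M v t)"
| "sat M v (RelF r ts) = rel_interp M r (map (eval_tm M v) ts)"
| "sat M v (NotF p) = (\<not> sat M v p)"
| "sat M v (AndF p q) = (sat M v p \<and> sat M v q)"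
| "sat M v (ExF i p) = (\<exists>a. sat M (v(i := a)) p)"

section \<open>Definable sets\<close>

text \<open>
  Definability is stated once for all Euclidean spaces, so that it covers \<open>real\<close>,
  \<open>real ^ 'n\<close> and \<open>real \<times> real ^ 'n\<close>. Here \<open>e\<close> enumerates the standard basis and the
  variable \<open>i\<close> denotes the coordinate along \<open>e i\<close>. The choice of \<open>e\<close> is immaterial,
  since variables of a formula can be renamed.
\<close>

definition definable :: "('f, 'r) field_expansion \<Rightarrow> 'a::euclidean_space set \<Rightarrow> bool" where
  "definable M X \<longleftrightarrow>
     (\<exists>e p. bij_betw e {..<DIM('a)} (Basis :: 'a set) \<and> wf_fm M p \<and>
            free_vars p \<subseteq> {..<DIM('a)} \<and> X = {x. sat M (\<lambda>i. x \<bullet> e i) p})"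

definition nowhere_dense :: "'a::topological_space set \<Rightarrow> bool" where
  "nowhere_dense X \<longleftrightarrow> interior (closure X) = {}"

definition i_minimal :: "('f, 'r) field_expansion \<Rightarrow> bool" where
  "i_minimal M \<longleftrightarrow>
     (\<forall>X :: real set. definable M X \<longrightarrow> interior X \<noteq> {} \<or> nowhere_dense X)"

definition definable_family ::
  "('f, 'r) field_expansion \<Rightarrow> (real \<Rightarrow> 'a::euclidean_space set) \<Rightarrow> bool" where
  "definable_family M F \<longleftrightarrow> definable M {(t, x). x \<in> F t}"

definition definably_meager ::
  "('f, 'r) field_expansion \<Rightarrow> 'a::euclidean_space set \<Rightarrow> bool" where
  "definably_meager M X \<longleftrightarrow> definable M X \<and>
     (\<exists>F. definable_family M F \<and> mono F \<and> (\<forall>t. closed (F t) \<and> nowhere_dense (F t)) \<and>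
          X \<subseteq> (\<Union>t. F t))"

definition definably_almost_open ::
  "('f, 'r) field_expansion \<Rightarrow> 'a::euclidean_space set \<Rightarrow> bool" where
  "definably_almost_open M X \<longleftrightarrow> definable M X \<and>
     (\<exists>U F. definable M U \<and> open U \<and> definably_meager M F \<and> X = sym_diff U F)"

section \<open>Dimensions\<close>

definition coord_proj :: "'a::euclidean_space set \<Rightarrow> 'a \<Rightarrow> 'a" where
  "coord_proj B x = (\<Sum>b\<in>B. (x \<bullet> b) *\<^sub>R b)"

text \<open>
  The coordinate subspaces are the spans of the sets \<open>B\<close> of standard basis vectors, and
  \<open>coord_proj B\<close> is the orthogonal projection onto \<open>span B\<close>. The maximum is over a finite
  set, which contains 0 (take \<open>B = {}\<close>) whenever \<open>X\<close> is nonempty.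
\<close>

definition coord_dim :: "'a::euclidean_space set \<Rightarrow> nat" where
  "coord_dim X = Max {dim (span B) | B. B \<subseteq> Basis \<and>
     (top_of_set (span B)) interior_of (coord_proj B ` X) \<noteq> {}}"

text \<open>
  The convention is \<open>0 ^ 0 = 1\<close> for nonempty sets, whereas \<open>0 powr 0 = 0\<close>. The library's
  \<open>diameter\<close> is meaningful on bounded sets only, hence the boundedness condition on covers.
\<close>

definition diam_pow :: "real \<Rightarrow> 'a::metric_space set \<Rightarrow> real" where
  "diam_pow s U = (if U = {} then 0 else if s = 0 then 1 else diameter U powr s)"

definition hausdorff_content :: "real \<Rightarrow> real \<Rightarrow> 'a::metric_space set \<Rightarrow> ennreal" where
  "hausdorff_content s \<delta> X =
     (INF U \<in> {U :: nat \<Rightarrow> 'a set. X \<subseteq> (\<Union>i. U i) \<and>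
                  (\<forall>i. bounded (U i) \<and> diameter (U i) \<le> \<delta>)}.
        (\<Sum>i. ennreal (diam_pow s (U i))))"

definition hausdorff_measure :: "real \<Rightarrow> 'a::metric_space set \<Rightarrow> ennreal" where
  "hausdorff_measure s X = (SUP \<delta> \<in> {0<..}. hausdorff_content s \<delta> X)"

definition hausdorff_dim :: "'a::metric_space set \<Rightarrow> ennreal" where
  "hausdorff_dim X = (INF s \<in> {s. 0 \<le> s \<and> hausdorff_measure s X = 0}. ennreal s)"

end

theory Submission
  imports Defs "HOL-Probability.Probability" "HOL-Real_Asymp.Real_Asymp"
begin

text \<open>
  Call a predicate on sequences of reals definable if a formula defines it. Baire category and
  i-minimality on fibres show that every nonempty open set contains a nonempty open set on which a
  definable predicate is constant. So definable sets without interior are nowhere dense, which gives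
  almost openness, and definable functions are continuous on some open set.

  In dimension one a compact definable set without interior is null: otherwise its difference set
  contains an interval by Steinhaus, in which the differences of the endpoints of its gaps form a
  countable dense definable set. By Fubini this passes to all dimensions.

  Let \<open>C\<close> be compact definable of dimension \<open>d\<close> in \<open>n\<close>-space, and suppose that for some \<open>s > d\<close> the
  number of boxes of side \<open>2\<^sup>-\<^sup>k\<close> meeting \<open>C\<close> is not \<open>O(2\<^sup>k\<^sup>s)\<close>. Zooming into the most
  concentrated cube makes \<open>C\<close> satisfy a Frostman condition at the scales considered, and a discrete
  form of Marstrand's projection theorem shows that, for large \<open>m\<close> and \<open>N = m d + n + 2\<close>, some linear
  image in \<open>N\<close>-space of \<open>m\<close>-th powers of the sets \<open>(C - b) / r\<close> has closure of positive measure. It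
  is therefore a definable set with interior, although it is the image of a set of dimension at most
  \<open>m d + n + 1\<close>. This is impossible, since a compact definable set that some definable map
  sends onto an open set of \<open>N\<close>-space has a projection to \<open>N\<close> coordinates with interior. Hence \<open>C\<close> has box dimension at most
  \<open>d\<close>, which yields measurability and the upper bound for the Hausdorff dimension.
\<close>

section \<open>Definable predicates on sequences\<close>

text \<open>The obstacle is that the cube into which one zooms depends on the scale. Along a
  subsequence the random matrices converge, but the rescaled sets \<open>(C - b) / r\<close> need
  not converge to anything definable. Hence \<open>lin_image\<close> fixes only the limit matrix and
  quantifies over the corner \<open>b\<close> and the side \<open>r\<close>. This adds
  \<open>n + 1\<close> degrees of freedom, and \<open>N = m * d + n + 2\<close> is the first value
  at which an interior becomes impossible. The m-th power pays for the loss: growth of exponent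
  \<open>s\<close> for \<open>C\<close> is growth of exponent \<open>m * s\<close> for its power,
  and \<open>m * s \<ge> N + 1\<close> as soon as \<open>m * (s - d) \<ge> n + 3\<close>. The
  exponent exceeds \<open>N\<close> by one so that the expected collisions, summed over dyadic
  distances, form a geometric series governed by the largest distance. All of this takes place in
  the space of real sequences, which is completely metrizable and carries a product probability
  measure. One Baire argument and one Fubini argument then serve every dimension, which is merely
  the number of coordinates on which a predicate depends.\<close>

definition dpred :: "('f, 'r) field_expansion \<Rightarrow> ((nat \<Rightarrow> real) \<Rightarrow> bool) \<Rightarrow> bool" where
  "dpred M P \<longleftrightarrow> (\<exists>p. wf_fm M p \<and> (\<forall>v. sat M v p = P v))"

definition dterm :: "('f, 'r) field_expansion \<Rightarrow> ((nat \<Rightarrow> real) \<Rightarrow> real) \<Rightarrow> bool" where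
  "dterm M f \<longleftrightarrow> (\<exists>t. wf_tm M t \<and> (\<forall>v. eval_tm M v t = f v))"

text \<open>Semantic counterpart of a bound on the free variables, so that most arguments can ignore
  formulas.\<close>

definition depends_on :: "nat set \<Rightarrow> ((nat \<Rightarrow> real) \<Rightarrow> 'b) \<Rightarrow> bool" where
  "depends_on I f \<longleftrightarrow> (\<forall>v w. (\<forall>i\<in>I. v i = w i) \<longrightarrow> f v = f w)"

lemma depends_onD: "depends_on I f \<Longrightarrow> (\<And>i. i \<in> I \<Longrightarrow> v i = w i) \<Longrightarrow> f v = f w"
  unfolding depends_on_def by blast

lemma finite_vars_tm: "finite (vars_tm t)"
  by (induction t) auto

lemma finite_free_vars: "finite (free_vars p)"
  by (induction p) (auto simp: finite_vars_tm)

lemma eval_tm_cong: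
  assumes "\<And>i. i \<in> vars_tm t \<Longrightarrow> v i = w i"
  shows "eval_tm M v t = eval_tm M w t"
  using assms
proof (induction t)
  case (FunT f ts)
  then have "map (eval_tm M v) ts = map (eval_tm M w) ts" by auto
  then show ?case by (simp only: eval_tm.simps)
qed auto

lemma sat_cong: "(\<And>i. i \<in> free_vars p \<Longrightarrow> v i = w i) \<Longrightarrow> sat M v p = sat M w p"
proof (induction p arbitrary: v w)
  case (EqF s t)
  then show ?case using eval_tm_cong[of s v w M] eval_tm_cong[of t v w M] by auto
next
  case (LessF s t)
  then show ?case using eval_tm_cong[of s v w M] eval_tm_cong[of t v w M] by auto
next
  case (RelF r ts)
  then have "map (eval_tm M v) ts = map (eval_tm M w) ts" by (auto intro!: eval_tm_cong)
  then show ?case by (simp only: sat.simps)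
next
  case (AndF p q)
  have "sat M v p = sat M w p" by (rule AndF.IH) (use AndF.prems in auto)
  moreover have "sat M v q = sat M w q" by (rule AndF.IH) (use AndF.prems in auto)
  ultimately show ?case by simp
next
  case (ExF i p)
  have "sat M (v(i := a)) p = sat M (w(i := a)) p" for a
    by (rule ExF.IH) (use ExF.prems in auto)
  then show ?case by simp
next
  case (NotF p)
  have "sat M v p = sat M w p" by (rule NotF.IH) (use NotF.prems in auto)
  then show ?case by simp
qed

lemma dpred_depends_on:
  assumes "dpred M P"
  shows "\<exists>I. finite I \<and> depends_on I P"
proof -
  obtain p where p: "\<And>v. sat M v p = P v" using assms by (auto simp: dpred_def)
  have "depends_on (free_vars p) P"
    unfolding depends_on_def p[symmetric] using sat_cong by blast
  then show ?thesis using finite_free_vars by blast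
qed

lemma dterm_depends_on:
  assumes "dterm M f"
  shows "\<exists>I. finite I \<and> depends_on I f"
proof -
  obtain t where t: "\<And>v. eval_tm M v t = f v" using assms by (auto simp: dterm_def)
  have "depends_on (vars_tm t) f"
    unfolding depends_on_def t[symmetric] by (auto intro: eval_tm_cong)
  then show ?thesis using finite_vars_tm by blast
qed

lemma dterm_var: "dterm M (\<lambda>v. v i)"
  unfolding dterm_def by (intro exI[of _ "Var i"]) auto

lemma dterm_const: "dterm M (\<lambda>v. c)"
  unfolding dterm_def by (intro exI[of _ "Param c"]) auto

lemma dterm_add: "dterm M f \<Longrightarrow> dterm M g \<Longrightarrow> dterm M (\<lambda>v. f v + g v)"
  unfolding dterm_def by (metis eval_tm.simps(5) wf_tm.simps(5))

lemma dterm_mult: "dterm M f \<Longrightarrow> dterm M g \<Longrightarrow> dterm M (\<lambda>v. f v * g v)"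
  unfolding dterm_def by (metis eval_tm.simps(7) wf_tm.simps(7))

lemma dterm_minus: "dterm M f \<Longrightarrow> dterm M (\<lambda>v. - f v)"
  unfolding dterm_def by (metis eval_tm.simps(6) wf_tm.simps(6))

lemma dterm_diff: "dterm M f \<Longrightarrow> dterm M g \<Longrightarrow> dterm M (\<lambda>v. f v - g v)"
  unfolding diff_conv_add_uminus by (intro dterm_add dterm_minus)

lemma dterm_sum: "(\<And>i. i \<in> A \<Longrightarrow> dterm M (f i)) \<Longrightarrow> dterm M (\<lambda>v. \<Sum>i\<in>A. f i v)"
  by (induction A rule: infinite_finite_induct) (auto intro: dterm_const dterm_add)

lemma dterm_upd:
  assumes "\<And>k. dterm M (\<lambda>v. g v k)" "dterm M f"
  shows "dterm M (\<lambda>v. ((g v)(i := f v)) k)"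
  using assms by (cases "k = i") auto

lemmas dterm_intros = dterm_var dterm_const dterm_add dterm_mult dterm_minus dterm_diff
  dterm_sum dterm_upd

lemma dpred_const: "dpred M (\<lambda>v. b)"
  unfolding dpred_def
  by (intro exI[of _ "if b then EqF ZeroT ZeroT else NotF (EqF ZeroT ZeroT)"]) auto

lemma dpred_less: "dterm M f \<Longrightarrow> dterm M g \<Longrightarrow> dpred M (\<lambda>v. f v < g v)"
  unfolding dpred_def dterm_def by (metis sat.simps(2) wf_fm.simps(2))

lemma dpred_eq: "dterm M f \<Longrightarrow> dterm M g \<Longrightarrow> dpred M (\<lambda>v. f v = g v)"
  unfolding dpred_def dterm_def by (metis sat.simps(1) wf_fm.simps(1))

lemma dpred_not: "dpred M P \<Longrightarrow> dpred M (\<lambda>v. \<not> P v)"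
  unfolding dpred_def by (metis sat.simps(4) wf_fm.simps(4))

lemma dpred_conj: "dpred M P \<Longrightarrow> dpred M Q \<Longrightarrow> dpred M (\<lambda>v. P v \<and> Q v)"
  unfolding dpred_def by (metis sat.simps(5) wf_fm.simps(5))

lemma dpred_disj: "dpred M P \<Longrightarrow> dpred M Q \<Longrightarrow> dpred M (\<lambda>v. P v \<or> Q v)"
  using dpred_not[OF dpred_conj[OF dpred_not[of M P] dpred_not[of M Q]]] by simp

lemma dpred_imp: "dpred M P \<Longrightarrow> dpred M Q \<Longrightarrow> dpred M (\<lambda>v. P v \<longrightarrow> Q v)"
  unfolding imp_conv_disj by (intro dpred_disj dpred_not)

lemma dpred_le: "dterm M f \<Longrightarrow> dterm M g \<Longrightarrow> dpred M (\<lambda>v. f v \<le> g v)"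
  unfolding not_less[symmetric] by (intro dpred_not dpred_less)

lemma dpred_abs_less: "dterm M f \<Longrightarrow> dterm M g \<Longrightarrow> dpred M (\<lambda>v. \<bar>f v\<bar> < g v)"
  unfolding abs_less_iff by (intro dpred_conj dpred_less dterm_intros)

lemma dpred_abs_le: "dterm M f \<Longrightarrow> dterm M g \<Longrightarrow> dpred M (\<lambda>v. \<bar>f v\<bar> \<le> g v)"
  unfolding abs_le_iff by (intro dpred_conj dpred_le dterm_intros)

lemma dpred_fin_all:
  "finite A \<Longrightarrow> (\<And>i. i \<in> A \<Longrightarrow> dpred M (P i)) \<Longrightarrow> dpred M (\<lambda>v. \<forall>i\<in>A. P i v)"
  by (induction A rule: finite_induct) (auto intro: dpred_const dpred_conj)

lemma dpred_all_less:
  "(\<And>i. i < n \<Longrightarrow> dpred M (P i)) \<Longrightarrow> dpred M (\<lambda>v. \<forall>i<n. P i v)" for n :: nat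
  using dpred_fin_all[of "{..<n}" M P] by (simp add: Ball_def)

lemma dpred_ex_upd: "dpred M P \<Longrightarrow> dpred M (\<lambda>v. \<exists>a. P (v(i := a)))"
  unfolding dpred_def by (metis sat.simps(6) wf_fm.simps(6))

lemma dterm_subst:
  assumes "dterm M f" and g: "\<And>i. dterm M (\<lambda>v. g v i)"
  shows "dterm M (\<lambda>v. f (g v))"
proof -
  have "dterm M (\<lambda>v. eval_tm M (g v) t)" if "wf_tm M t" for t
    using that
  proof (induction t)
    case (FunT f ts)
    then have "\<forall>t\<in>set ts. \<exists>t'. wf_tm M t' \<and> (\<forall>v. eval_tm M v t' = eval_tm M (g v) t)"
      by (auto simp: dterm_def)
    then obtain h where h: "\<And>t. t \<in> set ts \<Longrightarrow> wf_tm M (h t)"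
      "\<And>t v. t \<in> set ts \<Longrightarrow> eval_tm M v (h t) = eval_tm M (g v) t"
      by metis
    have "map (eval_tm M v) (map h ts) = map (eval_tm M (g v)) ts" for v
      using h by auto
    then have "eval_tm M v (FunT f (map h ts)) = eval_tm M (g v) (FunT f ts)" for v
      by (simp only: eval_tm.simps)
    moreover have "wf_tm M (FunT f (map h ts))" using h FunT.prems by auto
    ultimately show ?case unfolding dterm_def by blast
  qed (auto intro: dterm_intros g)
  moreover obtain t where "wf_tm M t" "\<And>v. eval_tm M v t = f v"
    using assms(1) by (auto simp: dterm_def)
  ultimately show ?thesis by force
qed

text \<open>Simultaneous substitution, which takes over every renaming or rearrangement of variables
  later on. The delicate case is \<open>ExF\<close>, where capture has to be avoided although
  \<open>g\<close> may involve infinitely many variables.\<close>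

lemma dpred_subst:
  assumes "dpred M P" and "\<And>i. dterm M (\<lambda>v. g v i)"
  shows "dpred M (\<lambda>v. P (g v))"
proof -
  have tm: "dterm M (\<lambda>v. eval_tm M (g v) t)" if "wf_tm M t" "\<And>i. dterm M (\<lambda>v. g v i)" for t g
    by (rule dterm_subst[OF _ that(2)]) (use that(1) in \<open>auto simp: dterm_def\<close>)
  have "dpred M (\<lambda>v. sat M (g v) p)" if "wf_fm M p" "\<And>i. dterm M (\<lambda>v. g v i)" for p g
    using that
  proof (induction p arbitrary: g)
    case (RelF r ts)
    then have "\<forall>t\<in>set ts. \<exists>t'. wf_tm M t' \<and> (\<forall>v. eval_tm M v t' = eval_tm M (g v) t)"
      using tm by (auto simp: dterm_def)
    then obtain h where h: "\<And>t. t \<in> set ts \<Longrightarrow> wf_tm M (h t)"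
      "\<And>t v. t \<in> set ts \<Longrightarrow> eval_tm M v (h t) = eval_tm M (g v) t"
      by metis
    have "map (eval_tm M v) (map h ts) = map (eval_tm M (g v)) ts" for v
      using h by auto
    then have "sat M v (RelF r (map h ts)) = sat M (g v) (RelF r ts)" for v
      by (simp only: sat.simps)
    moreover have "wf_fm M (RelF r (map h ts))" using h RelF.prems by auto
    ultimately show ?case unfolding dpred_def by blast
  next
    case (ExF i p)
    define F where "F = free_vars p"
    \<comment> \<open>Zero outside the finite set \<open>F\<close> leaves the truth of
      \<open>p\<close> unaffected, and the entries of \<open>g'\<close> together look at finitely
      many variables only, so that a fresh \<open>k\<close> exists.\<close>
    define g' where "g' v j = (if j \<in> F then g v j else 0)" for v j
    have g': "dterm M (\<lambda>v. g' v j)" for j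
      using ExF.prems(2) by (cases "j \<in> F") (auto simp: g'_def intro: dterm_const)
    obtain S where S: "\<And>j. finite (S j)" "\<And>j. depends_on (S j) (\<lambda>v. g v j)"
      using dterm_depends_on[OF ExF.prems(2)] by metis
    have "finite (\<Union>j\<in>F. S j)" using S finite_free_vars by (auto simp: F_def)
    then obtain k where k: "k \<notin> (\<Union>j\<in>F. S j)" using ex_new_if_finite infinite_UNIV_nat by blast
    have fresh: "g' (v(k := a)) = g' v" for v a
      unfolding g'_def using k by (intro ext) (auto intro!: depends_onD[OF S(2)])
    have "dpred M (\<lambda>v. sat M ((g' v)(i := v k)) p)"
      using ExF.prems g' by (intro ExF.IH dterm_intros) auto
    from dpred_ex_upd[OF this, of k]
    have "dpred M (\<lambda>v. \<exists>a. sat M ((g' v)(i := a)) p)" by (simp add: fresh)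
    moreover have "sat M ((g' v)(i := a)) p = sat M ((g v)(i := a)) p" for v a
      by (rule sat_cong) (auto simp: g'_def F_def)
    ultimately show ?case by simp
  qed (auto intro!: dpred_eq dpred_less dpred_not dpred_conj tm)
  moreover obtain p where "wf_fm M p" "\<And>v. sat M v p = P v"
    using assms(1) by (auto simp: dpred_def)
  ultimately show ?thesis using assms(2) by force
qed

text \<open>The bound variable has index 0 and all other indices are shifted, so that no freshness
  condition is needed.\<close>

lemma dpred_ex:
  assumes "dpred M (\<lambda>u. P (\<lambda>i. u (Suc i)) (u 0))"
  shows "dpred M (\<lambda>v. \<exists>a::real. P v a)"
proof -
  have "dpred M (\<lambda>v. \<exists>a. P (\<lambda>i. (v(0 := a)) (Suc i)) ((v(0 := a)) 0))"
    by (rule dpred_ex_upd[OF assms])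
  then have "dpred M (\<lambda>v. \<exists>a. P (\<lambda>i. v (Suc i)) a)" by simp
  from dpred_subst[OF this, of "\<lambda>v i. v (i - 1)"] show ?thesis
    by (simp add: dterm_var)
qed

lemma dpred_all:
  assumes "dpred M (\<lambda>u. P (\<lambda>i. u (Suc i)) (u 0))"
  shows "dpred M (\<lambda>v. \<forall>a::real. P v a)"
  using dpred_not[OF dpred_ex[of M "\<lambda>v a. \<not> P v a", OF dpred_not[OF assms]]] by simp

section \<open>Quantification over whole sequences\<close>

lemma formula_ex_override:
  assumes "wf_fm M p" "finite S"
  shows "\<exists>q. wf_fm M q \<and> free_vars q = free_vars p - S \<and>
           (\<forall>v. sat M v q = (\<exists>w. sat M (override_on v w S) p))"
  using assms(2)
proof (induction S rule: finite_induct)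
  case empty
  then show ?case using assms(1) by auto
next
  case (insert x S)
  then obtain q where q: "wf_fm M q" "free_vars q = free_vars p - S"
    "\<And>v. sat M v q = (\<exists>w. sat M (override_on v w S) p)" by blast
  have "(\<exists>a w. sat M (override_on (v(x := a)) w S) p) =
        (\<exists>w. sat M (override_on v w (insert x S)) p)" for v
  proof -
    have "override_on (v(x := a)) w S = override_on v (w(x := a)) (insert x S)" for a w
      using insert.hyps by (auto simp: override_on_def)
    moreover have "override_on v w (insert x S) = override_on (v(x := w x)) w S" for w
      using insert.hyps by (auto simp: override_on_def)
    ultimately show ?thesis by metis
  qed
  with q show ?case by (intro exI[of _ "ExF x q"]) auto
qed

lemma dpred_ex_override:
  assumes "dpred M P"
  shows "dpred M (\<lambda>v. \<exists>w. P (override_on v w S))"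
proof -
  obtain p where p: "wf_fm M p" "\<And>v. sat M v p = P v" using assms by (auto simp: dpred_def)
  \<comment> \<open>\<open>S\<close> may be infinite, but only its variables that are free in
    \<open>p\<close> need quantifiers.\<close>
  obtain q where q: "wf_fm M q" "\<And>v. sat M v q = (\<exists>w. sat M (override_on v w (S \<inter> free_vars p)) p)"
    using formula_ex_override[OF p(1), of "S \<inter> free_vars p"] finite_free_vars by blast
  have "sat M (override_on v w (S \<inter> free_vars p)) p = sat M (override_on v w S) p" for v w
    by (rule sat_cong) (auto simp: override_on_def)
  with p q show ?thesis unfolding dpred_def by auto
qed

definition evens :: "(nat \<Rightarrow> real) \<Rightarrow> nat \<Rightarrow> real" where
  "evens u = (\<lambda>i. u (2 * i))"

definition odds :: "(nat \<Rightarrow> real) \<Rightarrow> nat \<Rightarrow> real" where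
  "odds u = (\<lambda>i. u (2 * i + 1))"

text \<open>A binary predicate on sequences counts as definable if it is so after interleaving its
  arguments. Quantification over all sequences is harmless, since a formula sees only
  finitely many coordinates.\<close>

definition dpred2 ::
  "('f, 'r) field_expansion \<Rightarrow> ((nat \<Rightarrow> real) \<Rightarrow> (nat \<Rightarrow> real) \<Rightarrow> bool) \<Rightarrow> bool" where
  "dpred2 M P \<longleftrightarrow> dpred M (\<lambda>u. P (evens u) (odds u))"

lemma dpred_exs:
  assumes "dpred2 M P"
  shows "dpred M (\<lambda>v. \<exists>w. P v w)"
proof -
  have "dpred M (\<lambda>u. \<exists>w. P (evens (override_on u w {i. odd i})) (odds (override_on u w {i. odd i})))"
    by (rule dpred_ex_override[OF assms[unfolded dpred2_def]])
  moreover have "evens (override_on u w {i. odd i}) = evens u"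
    "odds (override_on u w {i. odd i}) = odds w" for u w
    by (auto simp: evens_def odds_def override_on_def)
  ultimately have "dpred M (\<lambda>u. \<exists>w. P (evens u) (odds w))" by simp
  \<comment> \<open>Each entry is doubled, so the even part of the substituted sequence is
    \<open>v\<close> itself.\<close>
  from dpred_subst[OF this, of "\<lambda>v i. v (i div 2)"]
  have "dpred M (\<lambda>v. \<exists>w. P v (odds w))" by (simp add: evens_def dterm_var)
  moreover have "(\<exists>w. P v (odds w)) = (\<exists>w. P v w)" for v
  proof -
    have "odds (\<lambda>i. w (i div 2)) = w" for w by (auto simp: odds_def)
    then show ?thesis by metis
  qed
  ultimately show ?thesis by simp
qed

lemma dpred_alls:
  assumes "dpred2 M P"
  shows "dpred M (\<lambda>v. \<forall>w. P v w)"
  using dpred_not[OF dpred_exs[of M "\<lambda>v w. \<not> P v w"]]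
    dpred_not[OF assms[unfolded dpred2_def]] by (simp add: dpred2_def)

lemma dpred2_subst:
  assumes "dpred2 M P" "\<And>i. dterm M (\<lambda>u. f u i)" "\<And>i. dterm M (\<lambda>u. g u i)"
  shows "dpred M (\<lambda>u. P (f u) (g u))"
proof -
  define h where "h u i = (if even i then f u (i div 2) else g u (i div 2))" for u i
  have "dterm M (\<lambda>u. h u i)" for i using assms by (cases "even i") (auto simp: h_def)
  then have "dpred M (\<lambda>u. P (evens (h u)) (odds (h u)))"
    by (rule dpred_subst[OF assms(1)[unfolded dpred2_def]])
  then show ?thesis by (simp add: h_def evens_def odds_def)
qed

lemma dterm_evens_odds: "dterm M (\<lambda>u. evens u i)" "dterm M (\<lambda>u. odds u i)"
  by (auto simp: evens_def odds_def intro: dterm_var)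

section \<open>Topology of the sequence space\<close>

lemma open_seq_coord: "open S \<Longrightarrow> open {v :: nat \<Rightarrow> real. v j \<in> S}"
  using open_vimage[of S "\<lambda>v :: nat \<Rightarrow> real. v j"] by (simp add: vimage_def)

lemma open_seq_box: "finite I \<Longrightarrow> open {w :: nat \<Rightarrow> real. \<forall>i\<in>I. \<bar>w i - c i\<bar> < e}"
  using product_topology_basis'[of I "\<lambda>i. ball (c i) e" id]
  by (simp add: dist_real_def abs_minus_commute)

lemma open_seq_contains_box:
  assumes "open U" "v \<in> U"
  obtains I e where "finite I" "e > 0"
    "\<And>w :: nat \<Rightarrow> real. (\<And>i. i \<in> I \<Longrightarrow> \<bar>w i - v i\<bar> < e) \<Longrightarrow> w \<in> U"
proof -
  have "openin (product_topology (\<lambda>i. euclidean) UNIV) U" using assms(1) open_fun_def by metis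
  then obtain X where X: "v \<in> Pi\<^sub>E UNIV X" "\<And>i. open (X i)" "finite {i. X i \<noteq> UNIV}"
    "Pi\<^sub>E UNIV X \<subseteq> U"
    using product_topology_open_contains_basis[of "\<lambda>i. euclidean" UNIV U v] assms(2) by auto
  define I where "I = {i. X i \<noteq> UNIV}"
  have "\<exists>e>0. ball (v i) e \<subseteq> X i" for i
    using X(1,2) open_contains_ball by (metis PiE_E UNIV_I)
  then obtain d where d: "\<And>i. d i > 0" "\<And>i. ball (v i) (d i) \<subseteq> X i" by metis
  define e where "e = Min (insert 1 (d ` I))"
  have "e > 0" using d X(3) by (auto simp: e_def I_def)
  moreover have "w \<in> U" if w: "\<And>i. i \<in> I \<Longrightarrow> \<bar>w i - v i\<bar> < e" for w
  proof -
    have "w i \<in> X i" for i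
    proof (cases "i \<in> I")
      case True
      then have "e \<le> d i" using X(3) by (auto simp: e_def I_def intro: Min_le)
      then have "w i \<in> ball (v i) (d i)" using w[OF True] by (simp add: dist_real_def abs_minus_commute)
      then show ?thesis using d by blast
    qed (auto simp: I_def)
    then show ?thesis using X(4) by (auto simp: PiE_iff)
  qed
  ultimately show ?thesis using that X(3) I_def by blast
qed

lemma continuous_on_seq_upd: "continuous_on A (\<lambda>v :: nat \<Rightarrow> real. v(j := c))"
proof (rule continuous_on_coordinatewise_then_product)
  show "continuous_on A (\<lambda>v. (v(j := c)) i)" for i
    by (cases "i = j") (auto intro: continuous_on_subset[OF continuous_on_product_coordinates])
qed

lemma continuous_on_seq_upd_value: "continuous_on A (\<lambda>t :: real. (v :: nat \<Rightarrow> real)(j := t))"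
proof (rule continuous_on_coordinatewise_then_product)
  show "continuous_on A (\<lambda>t. (v(j := t)) i)" for i
    by (cases "i = j") auto
qed

lemma open_seq_upd: "open U \<Longrightarrow> open {v :: nat \<Rightarrow> real. v(j := c) \<in> U}"
  using open_vimage[OF _ continuous_on_seq_upd, of U j c] by (simp add: vimage_def)

lemma Baire_countable_union:
  fixes T :: "'k \<Rightarrow> (nat \<Rightarrow> real) set"
  assumes "countable K" "open U" "U \<noteq> {}" "U \<subseteq> (\<Union>k\<in>K. T k)" "\<And>k. k \<in> K \<Longrightarrow> closed (T k)"
  obtains k where "k \<in> K" "interior (T k) \<noteq> {}"
proof -
  have "interior (\<Union>(T ` K)) = {}" if "\<And>k. k \<in> K \<Longrightarrow> interior (T k) = {}"
    using Baire_category_alt[of "euclidean :: (nat \<Rightarrow> real) topology" "T ` K"]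
      assms(1,5) that completely_metrizable_space_euclidean by auto
  moreover have "U \<subseteq> interior (\<Union>(T ` K))" using assms(2,4) by (simp add: interior_maximal)
  ultimately show ?thesis using assms(3) that by blast
qed

text \<open>Equivalently, the boundary of \<open>X\<close> has empty interior.\<close>

definition decides :: "(nat \<Rightarrow> real) set \<Rightarrow> bool" where
  "decides X \<longleftrightarrow> (\<forall>U. open U \<longrightarrow> U \<noteq> {} \<longrightarrow>
     (\<exists>U'\<subseteq>U. open U' \<and> U' \<noteq> {} \<and> (U' \<subseteq> X \<or> U' \<inter> X = {})))"

lemma decides_interior_closure:
  assumes "decides X" "interior (closure X) \<noteq> {}"
  shows "interior X \<noteq> {}"
proof -
  obtain U' where "U' \<subseteq> interior (closure X)" "open U'" "U' \<noteq> {}" "U' \<subseteq> X \<or> U' \<inter> X = {}"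
    using assms unfolding decides_def by (metis open_interior)
  moreover have "U' \<inter> X \<noteq> {}"
    using calculation(1-3) interior_subset open_Int_closure_eq_empty[of U' X] by blast
  ultimately show ?thesis using interior_maximal by blast
qed

text \<open>By Baire some \<open>X k\<close> is dense in a nonempty open part of \<open>U\<close>;
  since \<open>X k\<close> is decided, density improves to containment of a smaller open
  set.\<close>

lemma decides_countable_union:
  assumes "countable K" "open U" "U \<noteq> {}" "U \<subseteq> (\<Union>k\<in>K. X k)" "\<And>k. k \<in> K \<Longrightarrow> decides (X k)"
  obtains k Q where "k \<in> K" "Q \<subseteq> U" "open Q" "Q \<noteq> {}" "Q \<subseteq> X k"
proof -
  have "U \<subseteq> (\<Union>k\<in>K. closure (U \<inter> X k))"
  proof
    fix v assume "v \<in> U"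
    then obtain k where "k \<in> K" "v \<in> U \<inter> X k" using assms(4) by blast
    then show "v \<in> (\<Union>k\<in>K. closure (U \<inter> X k))" using closure_subset[of "U \<inter> X k"] by blast
  qed
  then obtain k where k: "k \<in> K" "interior (closure (U \<inter> X k)) \<noteq> {}"
    by (rule Baire_countable_union[OF assms(1-3)]) auto
  define Q where "Q = interior (closure (U \<inter> X k)) \<inter> U"
  have Q: "open Q" using assms(2) by (simp add: Q_def open_Int)
  have "interior (closure (U \<inter> X k)) \<inter> (U \<inter> X k) \<noteq> {}"
    using k(2) interior_subset open_Int_closure_eq_empty[of "interior (closure (U \<inter> X k))" "U \<inter> X k"]
    by auto
  then have "Q \<noteq> {}" by (auto simp: Q_def)
  then obtain U' where U': "U' \<subseteq> Q" "open U'" "U' \<noteq> {}" "U' \<subseteq> X k \<or> U' \<inter> X k = {}"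
    using assms(5)[OF k(1)] Q unfolding decides_def by metis
  have "U' \<inter> (U \<inter> X k) \<noteq> {}"
    using U'(1-3) interior_subset[of "closure (U \<inter> X k)"] open_Int_closure_eq_empty[of U' "U \<inter> X k"]
    unfolding Q_def by blast
  then show ?thesis using that[OF k(1), of U'] U' by (auto simp: Q_def)
qed

section \<open>Generic behaviour in i-minimal expansions\<close>

text \<open>\<open>dpred\<close> leaves the free variables of the formula open, whereas
  \<open>definable\<close> bounds them. Variables outside the dimension are quantified away, which
  does not change the truth value because \<open>P\<close> does not depend on them.\<close>

lemma dpred_definable:
  fixes e :: "nat \<Rightarrow> 'a::euclidean_space"
  assumes "dpred M P" "depends_on {..<DIM('a)} P" "bij_betw e {..<DIM('a)} (Basis :: 'a set)"
  shows "definable M {x. P (\<lambda>i. x \<bullet> e i)}"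
proof -
  obtain p where p: "wf_fm M p" "\<And>v. sat M v p = P v" using assms(1) by (auto simp: dpred_def)
  define S where "S = free_vars p - {..<DIM('a)}"
  obtain q where q: "wf_fm M q" "free_vars q = free_vars p - S"
    "\<And>v. sat M v q = (\<exists>w. sat M (override_on v w S) p)"
    using formula_ex_override[OF p(1), of S] finite_free_vars[of p] by (auto simp: S_def)
  have "P (override_on v w S) = P v" for v w
    by (rule depends_onD[OF assms(2)]) (auto simp: override_on_def S_def)
  then have "sat M v q = P v" for v using q(3) p(2) by auto
  moreover have "free_vars q \<subseteq> {..<DIM('a)}" using q(2) by (auto simp: S_def)
  ultimately show ?thesis unfolding definable_def using assms(3) q(1)
    by (intro exI[of _ e] exI[of _ q]) auto
qed

lemma dpred_definable_real:
  assumes "dpred M P"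
  shows "definable M {t::real. P (\<lambda>_. t)}"
proof -
  have "dpred M (\<lambda>v. P (\<lambda>_. v 0))" by (rule dpred_subst[OF assms]) (rule dterm_var)
  moreover have "depends_on {..<DIM(real)} (\<lambda>v. P (\<lambda>_. v 0))" by (auto simp: depends_on_def)
  moreover have "bij_betw (\<lambda>_. 1) {..<DIM(real)} (Basis :: real set)"
    by (auto simp: bij_betw_def inj_on_def)
  ultimately have "definable M {x :: real. P (\<lambda>_. x \<bullet> 1)}"
    using dpred_definable[of M "\<lambda>v. P (\<lambda>_. v 0)" "\<lambda>_. 1 :: real"] by auto
  then show ?thesis by simp
qed

text \<open>Rational endpoints keep the families of intervals in the Baire and measure arguments
  countable.\<close>

lemma open_real_rat_interval:
  assumes "open (S :: real set)" "S \<noteq> {}"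
  obtains q r where "q \<in> \<rat>" "r \<in> \<rat>" "q < r" "{q<..<r} \<subseteq> S"
proof -
  obtain x where "x \<in> S" using assms(2) by blast
  then obtain e where e: "e > 0" "ball x e \<subseteq> S" using assms(1) open_contains_ball by blast
  obtain q where "q \<in> \<rat>" "x - e < q" "q < x" using Rats_dense_in_real[of "x - e" x] e by auto
  moreover obtain r where "r \<in> \<rat>" "x < r" "r < x + e" using Rats_dense_in_real[of x "x + e"] e by auto
  moreover have "{q<..<r} \<subseteq> ball x e"
    using calculation by (auto simp: dist_real_def abs_if)
  ultimately show ?thesis using that[of q r] e(2) by auto
qed

locale i_minimal_expansion =
  fixes M :: "('f, 'r) field_expansion"
  assumes imin: "i_minimal M"
begin

text \<open>i-minimality on a line parallel to axis \<open>j\<close>: a trace with interior supplies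
  an interval of truth, and a nowhere dense trace leaves an interval outside its closure.\<close>

lemma fiber_dichotomy:
  assumes "dpred M P" "a < b"
  obtains q r where "q \<in> \<rat>" "r \<in> \<rat>" "a \<le> q" "q < r" "r \<le> b"
    "(\<forall>t\<in>{q<..<r}. P (v(j := t))) \<or> (\<forall>t\<in>{q<..<r}. \<not> P (v(j := t)))"
proof -
  define X where "X = {t. a < t \<and> t < b \<and> P (v(j := t))}"
  have "dpred M (\<lambda>u. a < u 0 \<and> u 0 < b \<and> P (v(j := u 0)))"
    by (intro dpred_conj dpred_less dpred_subst[OF assms(1)] dterm_intros)
  then have "definable M {t::real. a < t \<and> t < b \<and> P (v(j := t))}"
    by (rule dpred_definable_real)
  then have "definable M X" by (simp add: X_def)
  then consider "interior X \<noteq> {}" | "interior (closure X) = {}"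
    using imin by (auto simp: i_minimal_def nowhere_dense_def)
  then show ?thesis
  proof cases
    case 1
    then obtain q r where qr: "q \<in> \<rat>" "r \<in> \<rat>" "q < r" "{q<..<r} \<subseteq> interior X"
      using open_real_rat_interval[OF open_interior] by metis
    then have sub: "{q<..<r} \<subseteq> X" using interior_subset by blast
    then have "{q<..<r} \<subseteq> {a..b}" by (auto simp: X_def)
    then have "a \<le> q" "r \<le> b" using qr(3) by (auto simp: greaterThanLessThan_subseteq_atLeastAtMost_iff)
    then show ?thesis using that[of q r] qr sub by (auto simp: X_def)
  next
    case 2
    have "open ({a<..<b} - closure X)" by (auto intro: open_Diff)
    moreover have "{a<..<b} - closure X \<noteq> {}"
      using 2 assms(2) interior_maximal[of "{a<..<b}" "closure X"] by auto
    ultimately obtain q r where qr: "q \<in> \<rat>" "r \<in> \<rat>" "q < r" "{q<..<r} \<subseteq> {a<..<b} - closure X"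
      using open_real_rat_interval by metis
    then have "{q<..<r} \<subseteq> {a..b}" by auto
    then have "a \<le> q" "r \<le> b" using qr(3) by (auto simp: greaterThanLessThan_subseteq_atLeastAtMost_iff)
    moreover have "{q<..<r} \<inter> X = {}" using qr(4) closure_subset by blast
    moreover have "\<not> P (v(j := t))" if "t \<in> {q<..<r}" for t
    proof -
      have "t \<notin> X" "a < t" "t < b" using calculation(3) qr(4) that by auto
      then show ?thesis by (simp add: X_def)
    qed
    ultimately show ?thesis using that[of q r] qr(1-3) by blast
  qed
qed

text \<open>Induction on the relevant coordinates in the manner of Kuratowski and Ulam. Each fibre
  in direction \<open>j\<close> contains a rational interval on which \<open>P\<close> is constant.
  That a given interval and truth value work is a condition \<open>X (q, r, s)\<close> free of
  coordinate \<open>j\<close>, so the induction hypothesis decides it, and by Baire one choice works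
  on an open set.\<close>

lemma decides_aux:
  assumes "finite I"
  shows "dpred M P \<Longrightarrow> depends_on I P \<Longrightarrow> decides {v. P v}"
  using assms
proof (induction I arbitrary: P rule: finite_induct)
  case empty
  then have "P v = P w" for v w by (auto simp: depends_on_def)
  then have "(\<forall>v. P v) \<or> (\<forall>v. \<not> P v)" by blast
  then show ?case unfolding decides_def by blast
next
  case (insert j I)
  show ?case unfolding decides_def
  proof (intro allI impI)
    fix U :: "(nat \<Rightarrow> real) set" assume U: "open U" "U \<noteq> {}"
    then obtain u where "u \<in> U" by blast
    then obtain I1 e where I1: "finite I1" "e > 0"
      "\<And>w. (\<And>i. i \<in> I1 \<Longrightarrow> \<bar>w i - u i\<bar> < e) \<Longrightarrow> w \<in> U"
      using open_seq_contains_box U(1) by metis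
    \<comment> \<open>Coordinate \<open>j\<close> is left free here; its range in \<open>U\<close>
      reappears as the interval from \<open>a\<close> to \<open>b\<close>.\<close>
    define B where "B = {v. \<forall>i\<in>I1 - {j}. \<bar>v i - u i\<bar> < e}"
    define a b where "a = u j - e" and "b = u j + e"
    define K where "K = {(q, r, s). q \<in> \<rat> \<and> r \<in> \<rat> \<and> a \<le> q \<and> q < r \<and> r \<le> b \<and> s \<in> (UNIV :: bool set)}"
    define X where "X = (\<lambda>(q, r, s). {v. \<forall>t. q < t \<and> t < r \<longrightarrow> P (v(j := t)) = s})"
    have "K \<subseteq> \<rat> \<times> \<rat> \<times> UNIV" by (auto simp: K_def)
    then have "countable K"
      by (rule countable_subset) (intro countable_SIGMA countable_rat countableI_type)
    moreover have "open B" using open_seq_box[of "I1 - {j}" u e] I1(1) by (simp add: B_def)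
    moreover have "B \<noteq> {}" using I1(2) by (auto simp: B_def intro!: exI[of _ u])
    moreover have "B \<subseteq> (\<Union>k\<in>K. X k)"
    proof
      fix v assume "v \<in> B"
      have "a < b" using I1(2) by (simp add: a_def b_def)
      then obtain q r where qr: "q \<in> \<rat>" "r \<in> \<rat>" "a \<le> q" "q < r" "r \<le> b"
        "(\<forall>t\<in>{q<..<r}. P (v(j := t))) \<or> (\<forall>t\<in>{q<..<r}. \<not> P (v(j := t)))"
        by (rule fiber_dichotomy[OF insert.prems(1)])
      then have "v \<in> X (q, r, True) \<or> v \<in> X (q, r, False)" by (auto simp: X_def)
      then show "v \<in> (\<Union>k\<in>K. X k)" using qr(1-5) unfolding K_def by blast
    qed
    moreover have "decides (X k)" for k
    proof -
      obtain q r s where k: "k = (q, r, s)" by (cases k)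

      have "dpred M (\<lambda>v. \<forall>t. q < t \<and> t < r \<longrightarrow> P (v(j := t)) = s)"
      proof (rule dpred_all)
        have "dpred M (\<lambda>u. P ((\<lambda>i. u (Suc i))(j := u 0)))"
          by (intro dpred_subst[OF insert.prems(1)] dterm_intros)
        then have "dpred M (\<lambda>u. P ((\<lambda>i. u (Suc i))(j := u 0)) = s)"
          by (cases s) (auto intro: dpred_not)
        then show "dpred M (\<lambda>u. q < u 0 \<and> u 0 < r \<longrightarrow> P ((\<lambda>i. u (Suc i))(j := u 0)) = s)"
          by (intro dpred_imp dpred_conj dpred_less dterm_intros)
      qed
      moreover have "P (v(j := t)) = P (w(j := t))" if "\<forall>i\<in>I. v i = w i" for v w t
        by (rule depends_onD[OF insert.prems(2)]) (use that in auto)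
      then have "depends_on I (\<lambda>v. \<forall>t. q < t \<and> t < r \<longrightarrow> P (v(j := t)) = s)"
        unfolding depends_on_def by metis
      ultimately show ?thesis using insert.IH by (simp add: X_def k)
    qed
    ultimately obtain k Q where Q: "k \<in> K" "Q \<subseteq> B" "open Q" "Q \<noteq> {}" "Q \<subseteq> X k"
      by (rule decides_countable_union)
    obtain q r s where k: "k = (q, r, s)" by (cases k)
    obtain o' where o': "o' \<in> Q" using Q(4) by blast
    \<comment> \<open>Membership in \<open>X k\<close> ignores coordinate \<open>j\<close>, so that
      coordinate can be frozen at \<open>o' j\<close> in the condition \<open>Q\<close> and released
      into \<open>{q<..<r}\<close>.\<close>
    define U' where "U' = {v. v j \<in> {q<..<r}} \<inter> {v. v(j := o' j) \<in> Q}"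
    have "open U'" unfolding U'_def using Q(3) by (intro open_Int open_seq_coord open_seq_upd) auto
    moreover have "o'(j := (q + r) / 2) \<in> U'"
      using o' Q(1) by (auto simp: U'_def K_def k)
    moreover have "v \<in> U" "P v = s" if "v \<in> U'" for v
    proof -
      define w where "w = v(j := o' j)"
      have w: "w \<in> Q" "v = w(j := v j)" "q < v j" "v j < r" using that by (auto simp: U'_def w_def)
      then have "\<forall>t. q < t \<and> t < r \<longrightarrow> P (w(j := t)) = s" using Q(5) by (auto simp: X_def k)
      then show "P v = s" using w(2-4) by metis
      have "w \<in> B" using w Q by blast
      then have "\<bar>v i - u i\<bar> < e" if "i \<in> I1" for i
        using that w Q(1) by (cases "i = j") (auto simp: B_def w_def K_def k a_def b_def)
      then show "v \<in> U" using I1(3) by blast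
    qed
    ultimately show "\<exists>U'\<subseteq>U. open U' \<and> U' \<noteq> {} \<and> (U' \<subseteq> {v. P v} \<or> U' \<inter> {v. P v} = {})"
      by (intro exI[of _ U']) auto
  qed
qed

lemma dpred_decides: "dpred M P \<Longrightarrow> decides {v. P v}"
  using decides_aux dpred_depends_on by blast

lemma dpred_interior_closure:
  "dpred M P \<Longrightarrow> interior (closure {v. P v}) \<noteq> {} \<Longrightarrow> interior {v. P v} \<noteq> {}"
  using decides_interior_closure dpred_decides by blast

lemma dpred_countable_union:
  assumes "countable K" "open U" "U \<noteq> {}" "\<And>v. v \<in> U \<Longrightarrow> \<exists>k\<in>K. P k v" "\<And>k. k \<in> K \<Longrightarrow> dpred M (P k)"
  obtains k Q where "k \<in> K" "Q \<subseteq> U" "open Q" "Q \<noteq> {}" "\<forall>v\<in>Q. P k v"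
proof -
  have "U \<subseteq> (\<Union>k\<in>K. {v. P k v})" using assms(4) by blast
  then obtain k Q where "k \<in> K" "Q \<subseteq> U" "open Q" "Q \<noteq> {}" "Q \<subseteq> {v. P k v}"
    by (rule decides_countable_union[OF assms(1-3)]) (auto intro: dpred_decides assms(5))
  then show ?thesis using that by blast
qed

text \<open>Continuity at a point is a definable property, hence decided on some open
  \<open>W\<close>. For each bound, oscillation below it occurs on a dense open set, so Baire gives
  a point of continuity in \<open>W\<close>, and then all points of \<open>W\<close> are
  such.\<close>

lemma generically_continuous:
  fixes f :: "(nat \<Rightarrow> real) \<Rightarrow> real"
  assumes I: "finite I" "depends_on I f"
    and f: "dpred M (\<lambda>u. f (\<lambda>i. u (Suc i)) < u 0)"
    and U: "open U" "U \<noteq> {}"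
  obtains U' where "U' \<subseteq> U" "open U'" "U' \<noteq> {}" "continuous_on U' f"
proof -
  \<comment> \<open>Only comparisons of a value of \<open>f\<close> with a variable are assumed
    definable; substitution yields this general form.\<close>
  have less: "dpred M (\<lambda>u. f (g u) < h u)" if "\<And>i. dterm M (\<lambda>u. g u i)" "dterm M h" for g h
  proof -
    define k where "k u i = (case i of 0 \<Rightarrow> h u | Suc i \<Rightarrow> g u i)" for u i
    have "dterm M (\<lambda>u. k u i)" for i using that by (cases i) (auto simp: k_def)
    then have "dpred M (\<lambda>u. f (\<lambda>i. k u (Suc i)) < k u 0)" by (rule dpred_subst[OF f])
    then show ?thesis by (simp add: k_def)
  qed
  \<comment> \<open>The values of \<open>f\<close> are sorted into countably many intervals of
    length \<open>e\<close>; a single interval contains all values on some open set.\<close>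
  have osc: "\<exists>Q\<subseteq>W. open Q \<and> Q \<noteq> {} \<and> (\<forall>v\<in>Q. \<forall>w\<in>Q. \<bar>f v - f w\<bar> < e)"
    if W: "open W" "W \<noteq> {}" "e > 0" for W e
  proof -
    have "\<exists>k\<in>(UNIV :: int set). \<not> f v < of_int k * e \<and> f v < (of_int k + 1) * e" for v
      using floor_divide_lower[OF W(3), of "f v"] floor_divide_upper[OF W(3), of "f v"]
      by (intro bexI[of _ "\<lfloor>f v / e\<rfloor>"]) auto
    moreover have "dpred M (\<lambda>v. \<not> f v < of_int k * e \<and> f v < (of_int k + 1) * e)" for k :: int
      by (intro dpred_conj dpred_not less dterm_intros)
    ultimately obtain k :: int and Q where "k \<in> UNIV" and Q: "Q \<subseteq> W" "open Q" "Q \<noteq> {}"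
      "\<forall>v\<in>Q. \<not> f v < of_int k * e \<and> f v < (of_int k + 1) * e"
      by (rule dpred_countable_union[OF countableI_type W(1,2)])
    moreover have "\<bar>f v - f w\<bar> < e" if "v \<in> Q" "w \<in> Q" for v w
      using bspec[OF Q(4) that(1)] bspec[OF Q(4) that(2)] by (auto simp: algebra_simps)
    ultimately show ?thesis by blast
  qed
  \<comment> \<open>Nearby values fit into an interval of length \<open>e\<close> with free left end
    \<open>q\<close>. This phrasing avoids differences of values of \<open>f\<close>, for which no
    definability is at hand.\<close>
  define cont where "cont v \<longleftrightarrow> (\<forall>e. e > 0 \<longrightarrow> (\<exists>d. d > 0 \<and> (\<exists>q. \<forall>w. (\<forall>i\<in>I. \<bar>w i - v i\<bar> < d) \<longrightarrow>
      \<not> f w < q \<and> f w < q + e)))" for v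
  have "dpred M cont" unfolding cont_def
    by (intro dpred_all dpred_imp dpred_ex dpred_conj dpred_less dterm_intros dpred_alls
        dpred2_def[THEN iffD2] dpred_fin_all I dpred_abs_less dpred_not less dterm_evens_odds)
  then obtain W where W: "W \<subseteq> U" "open W" "W \<noteq> {}" "W \<subseteq> {v. cont v} \<or> W \<inter> {v. cont v} = {}"
    using dpred_decides U unfolding decides_def by metis
  define G where "G k = \<Union>{Q. open Q \<and> (\<forall>v\<in>Q. \<forall>w\<in>Q. \<bar>f v - f w\<bar> < inverse (real (Suc k)))}" for k
  have openG: "open (G k)" for k unfolding G_def by auto
  have "interior (- G k) = {}" for k
  proof (rule ccontr)
    assume "interior (- G k) \<noteq> {}"
    then obtain Q where "Q \<subseteq> interior (- G k)" "open Q" "Q \<noteq> {}"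
      "\<forall>v\<in>Q. \<forall>w\<in>Q. \<bar>f v - f w\<bar> < inverse (real (Suc k))"
      using osc[of "interior (- G k)" "inverse (real (Suc k))"] by auto
    moreover have "Q \<subseteq> G k" using calculation unfolding G_def by blast
    ultimately show False using interior_subset by blast
  qed
  then have "\<not> W \<subseteq> (\<Union>k\<in>UNIV. - G k)"
    using Baire_countable_union[of UNIV W "\<lambda>k. - G k"] W openG by (auto simp: closed_def)
  then obtain v where v: "v \<in> W" "\<And>k. v \<in> G k" by auto
  have "cont v" unfolding cont_def
  proof (intro allI impI)
    fix e :: real assume "e > 0"
    then obtain k where k: "inverse (real (Suc k)) < e / 2" using reals_Archimedean[of "e / 2"] by auto
    obtain Q where Q: "open Q" "v \<in> Q" "\<And>w. w \<in> Q \<Longrightarrow> \<bar>f v - f w\<bar> < inverse (real (Suc k))"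
      using v(2)[of k] by (auto simp: G_def)
    obtain I1 d where d: "finite I1" "d > 0" "\<And>w. (\<And>i. i \<in> I1 \<Longrightarrow> \<bar>w i - v i\<bar> < d) \<Longrightarrow> w \<in> Q"
      using open_seq_contains_box Q by metis
    have "\<not> f w < f v - e / 2 \<and> f w < f v - e / 2 + e" if "\<forall>i\<in>I. \<bar>w i - v i\<bar> < d" for w
    proof -
      have "override_on v w I \<in> Q" using that d(2) by (intro d(3)) (auto simp: override_on_def)
      then have "\<bar>f v - f (override_on v w I)\<bar> < e / 2" using Q(3) k by fastforce
      moreover have "f (override_on v w I) = f w"
        by (rule depends_onD[OF I(2)]) (auto simp: override_on_def)
      ultimately show ?thesis by (auto simp: abs_if split: if_splits)
    qed
    then show "\<exists>d>0. \<exists>q. \<forall>w. (\<forall>i\<in>I. \<bar>w i - v i\<bar> < d) \<longrightarrow> \<not> f w < q \<and> f w < q + e"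
      using d(2) by blast
  qed
  with W v have "W \<subseteq> {v. cont v}" by auto
  moreover have "isCont f v" if "cont v" for v
    unfolding isCont_def tendsto_iff
  proof (intro allI impI)
    fix e :: real assume "e > 0"
    with that obtain d q where d: "d > 0"
      "\<And>w. (\<forall>i\<in>I. \<bar>w i - v i\<bar> < d) \<Longrightarrow> \<not> f w < q \<and> f w < q + e"
      unfolding cont_def by meson
    have "\<forall>\<^sub>F w in nhds v. w \<in> {w. \<forall>i\<in>I. \<bar>w i - v i\<bar> < d}"
      by (rule eventually_nhds_in_open[OF open_seq_box[OF I(1)]]) (use d(1) in auto)
    then have "\<forall>\<^sub>F w in at v. w \<in> {w. \<forall>i\<in>I. \<bar>w i - v i\<bar> < d}"
      by (auto simp: eventually_at_filter elim: eventually_mono)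
    then show "\<forall>\<^sub>F w in at v. dist (f w) (f v) < e"
    proof eventually_elim
      case (elim w)
      have "\<not> f w < q \<and> f w < q + e" by (rule d(2)) (use elim in auto)
      moreover have "\<not> f v < q \<and> f v < q + e" by (rule d(2)) (use d(1) in auto)
      ultimately show ?case by (auto simp: dist_real_def)
    qed
  qed
  ultimately have "continuous_on W f" by (auto intro!: continuous_at_imp_continuous_on)
  then show ?thesis using that W by blast
qed

end

section \<open>Sections of definable relations\<close>

text \<open>Tychonoff, with an arbitrary index type because both sequences and matrices of
  coefficients are treated.\<close>

lemma compact_seq_box: "compact {y :: 'i \<Rightarrow> real. \<forall>j. \<bar>y j\<bar> \<le> B}"
proof -
  have "compactin (product_topology (\<lambda>_. euclidean) UNIV) (PiE (UNIV :: 'i set) (\<lambda>_. {-B..B}))"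
    by (auto simp: compactin_PiE)
  then have "compact (PiE (UNIV :: 'i set) (\<lambda>_. {-B..B}))"
    by (simp add: euclidean_product_topology)
  moreover have "PiE (UNIV :: 'i set) (\<lambda>_. {-B..B}) = {y. \<forall>j. \<bar>y j\<bar> \<le> B}"
  proof -
    have "a \<in> {-B..B} \<longleftrightarrow> \<bar>a\<bar> \<le> B" for a by auto
    then show ?thesis by (simp only: set_eq_iff PiE_UNIV_domain) auto
  qed
  ultimately show ?thesis by simp
qed

lemma closed_projection_compact:
  fixes Z :: "('a::metric_space \<times> 'b::metric_space) set"
  assumes "closed Z" "compact K"
  shows "closed {x. \<exists>y\<in>K. (x, y) \<in> Z}"
  unfolding closed_sequential_limits
proof (intro allI impI, elim conjE)
  fix x l assume x: "\<forall>n :: nat. x n \<in> {x. \<exists>y\<in>K. (x, y) \<in> Z}" "x \<longlonglongrightarrow> l"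
  then obtain y where y: "\<And>n. y n \<in> K" "\<And>n. (x n, y n) \<in> Z" by simp metis
  then obtain m r where r: "m \<in> K" "strict_mono r" "(y \<circ> r) \<longlonglongrightarrow> m"
    using assms(2) unfolding compact_def by meson
  have "(x \<circ> r) \<longlonglongrightarrow> l" using x(2) r(2) by (rule LIMSEQ_subseq_LIMSEQ)
  then have "(\<lambda>n. ((x \<circ> r) n, (y \<circ> r) n)) \<longlonglongrightarrow> (l, m)" using r(3) by (rule tendsto_Pair)
  moreover have "((x \<circ> r) n, (y \<circ> r) n) \<in> Z" for n using y(2) by simp
  ultimately have "(l, m) \<in> Z" by (rule closed_sequentially[OF assms(1), rotated])
  then show "l \<in> {x. \<exists>y\<in>K. (x, y) \<in> Z}" using r(1) by blast
qed

lemma continuous_on_seq_upd_joint: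
  assumes "continuous_on A g" "continuous_on A h"
  shows "continuous_on A (\<lambda>x. (g x :: nat \<Rightarrow> real)(j := h x))"
proof (rule continuous_on_coordinatewise_then_product)
  show "continuous_on A (\<lambda>x. ((g x)(j := h x)) i)" for i
    using assms by (cases "i = j") (auto intro: continuous_on_product_then_coordinatewise)
qed

context i_minimal_expansion
begin

text \<open>Induction on \<open>J\<close>, removing one coordinate \<open>i\<close> of the data
  \<open>y\<close>. Its least value \<open>f v\<close> over the fibre is continuous on some box. If
  it is constant there, fixing \<open>i\<close> loses nothing. Otherwise fixing it at a value
  \<open>c\<close> costs one coordinate \<open>k\<close> of \<open>v\<close>; this is possible for
  an interval of values \<open>c\<close>, and Baire makes the sets obtained from these slices
  uniform in \<open>c\<close>, so that \<open>i\<close> itself can be added to \<open>A\<close>. The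
  lemma replaces a dimension theory for definable maps: \<open>y\<close> determines
  \<open>v\<close>, hence has at least as many independent coordinates.\<close>

lemma section_dimension:
  assumes "finite J" "finite I" "dpred2 M Y" "closed {(v, y). Y v y}"
    and "\<And>v v' y y'. \<forall>i\<in>I. v i = v' i \<Longrightarrow> \<forall>j\<in>J. y j = y' j \<Longrightarrow> Y v y \<Longrightarrow> Y v' y'"
    and "\<And>v y j. Y v y \<Longrightarrow> j \<in> J \<Longrightarrow> \<bar>y j\<bar> \<le> B"
    and "\<And>v v' y i. Y v y \<Longrightarrow> Y v' y \<Longrightarrow> i \<in> I \<Longrightarrow> v i = v' i"
    and "open V" "V \<noteq> {}" "\<And>v. v \<in> V \<Longrightarrow> \<exists>y. Y v y"
  shows "\<exists>A\<subseteq>J. card A = card I \<and> interior {u. \<exists>v y. Y v y \<and> (\<forall>a\<in>A. y a = u a)} \<noteq> {}"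
  using assms
proof (induction J arbitrary: I Y V rule: finite_induct)
  case empty
  have "I = {}"
  proof (rule ccontr)
    assume "I \<noteq> {}"
    then obtain i where i: "i \<in> I" by blast
    obtain v where v: "v \<in> V" using empty.prems by blast
    then obtain K e where K: "finite K" "e > 0" "\<And>w. (\<And>i. i \<in> K \<Longrightarrow> \<bar>w i - v i\<bar> < e) \<Longrightarrow> w \<in> V"
      using open_seq_contains_box empty.prems(7) by metis
    \<comment> \<open>With \<open>J\<close> empty all \<open>y\<close> are interchangeable, so a
      small shift of \<open>v i\<close> inside \<open>V\<close> contradicts the fact that
      \<open>y\<close> determines \<open>v i\<close>.\<close>
    have "v(i := v i + e / 2) \<in> V" using K(2) by (intro K(3)) auto
    then obtain y y' where "Y v y" "Y (v(i := v i + e / 2)) y'" using empty.prems(9) v by blast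
    then have Y: "Y v y" "Y (v(i := v i + e / 2)) y" using empty.prems(4) by blast+
    have "v i = (v(i := v i + e / 2)) i" by (rule empty.prems(6)[OF Y i])
    then show False using K(2) by simp
  qed
  moreover obtain v y where "Y v y" using empty.prems by blast
  ultimately show ?case by auto
next
  case (insert i J)
  note dp = insert.prems(2) and cl = insert.prems(3) and dep = insert.prems(4)
    and bnd = insert.prems(5) and inj = insert.prems(6)
  \<comment> \<open>The minimum is attained by compactness of the fibre. It is a canonical
    substitute for a definable selection of \<open>y\<close>, with default 0 on empty
    fibres.\<close>
  define f where "f v = (if \<exists>y. Y v y then Inf {y i |y. Y v y} else 0)" for v
  have min: "(\<exists>y'. Y v y' \<and> y' i = f v) \<and> f v \<le> y i" if Yvy: "Y v y" for v y
  proof -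
    define K where "K = {y :: nat \<Rightarrow> real. \<forall>j. \<bar>y j\<bar> \<le> \<bar>B\<bar>}"
    have "closed {y. Y v y}"
      using closed_vimage[OF cl, of "\<lambda>y. (v, y)"] by (simp add: vimage_def continuous_on_Pair)
    then have "compact (K \<inter> {y. Y v y})"
      unfolding K_def by (intro compact_Int_closed compact_seq_box)
    then have "compact ((\<lambda>y. y i) ` (K \<inter> {y. Y v y}))"
      by (intro compact_continuous_image continuous_on_subset[OF continuous_on_product_coordinates]) auto
    moreover have eq: "(\<lambda>y. y i) ` (K \<inter> {y. Y v y}) = {y i |y. Y v y}"
    proof
      show "{y i |y. Y v y} \<subseteq> (\<lambda>y. y i) ` (K \<inter> {y. Y v y})"
      proof
        fix a assume "a \<in> {y i |y. Y v y}"
        then obtain y where y: "a = y i" "Y v y" by blast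
        define y' where "y' = override_on (\<lambda>_. 0) y (insert i J)"
        have "Y v y'" by (rule dep[OF _ _ y(2)]) (auto simp: y'_def override_on_def)
        moreover have "y' \<in> K" using bnd[OF y(2)] by (force simp: K_def y'_def override_on_def)
        moreover have "y' i = a" by (simp add: y'_def override_on_def y)
        ultimately show "a \<in> (\<lambda>y. y i) ` (K \<inter> {y. Y v y})" by blast
      qed
    qed auto
    ultimately obtain a where a: "a \<in> {y i |y. Y v y}" "\<And>b. b \<in> {y i |y. Y v y} \<Longrightarrow> a \<le> b"
      using compact_attains_inf[of "{y i |y. Y v y}"] Yvy by auto
    then have "Inf {y i |y. Y v y} = a" by (rule cInf_eq_minimum)
    then have fa: "f v = a" using that by (auto simp: f_def)
    have "\<exists>y'. Y v y' \<and> y' i = a" using a(1) by auto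
    moreover have "a \<le> y i" by (rule a(2)) (use that in auto)
    ultimately show ?thesis unfolding fa by (rule conjI)
  qed
  have Yext: "Y v = Y v'" if vv': "\<forall>i\<in>I. v i = v' i" for v v'
  proof (intro ext iffI)
    show "Y v' y" if "Y v y" for y by (rule dep[OF vv' _ that]) simp
    show "Y v y" if "Y v' y" for y by (rule dep[OF _ _ that]) (use vv' in auto)
  qed
  have fdep: "depends_on I f"
    unfolding depends_on_def f_def
  proof (intro allI impI)
    fix v w :: "nat \<Rightarrow> real" assume "\<forall>i\<in>I. v i = w i"
    then have "Y v = Y w" by (rule Yext)
    then show "(if \<exists>y. Y v y then Inf {y i |y. Y v y} else 0) =
        (if \<exists>y. Y w y then Inf {y i |y. Y w y} else 0)" by simp
  qed
  have fless: "f v < q \<longleftrightarrow> (\<exists>y. Y v y \<and> y i < q) \<or> (\<not> (\<exists>y. Y v y) \<and> 0 < q)" for v q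
  proof (cases "\<exists>y. Y v y")
    case True
    then obtain y where "Y v y" by blast
    with min obtain y' where y': "Y v y'" "y' i = f v" by blast
    show ?thesis
    proof
      assume "f v < q"
      then show "(\<exists>y. Y v y \<and> y i < q) \<or> (\<not> (\<exists>y. Y v y) \<and> 0 < q)" using y' by auto
    next
      assume "(\<exists>y. Y v y \<and> y i < q) \<or> (\<not> (\<exists>y. Y v y) \<and> 0 < q)"
      then obtain z where "Y v z" "z i < q" using True by blast
      then show "f v < q" using min[of v z] by auto
    qed
  qed (simp add: f_def)
  have "dpred M (\<lambda>u. \<exists>y. Y (\<lambda>i. u (Suc i)) y \<and> y i < u 0)"
    by (intro dpred_exs dpred2_def[THEN iffD2] dpred_conj dpred2_subst[OF dp] dpred_less dterm_evens_odds)
  moreover have "dpred M (\<lambda>u. \<exists>y. Y (\<lambda>i. u (Suc i)) y)"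
    by (intro dpred_exs dpred2_def[THEN iffD2] dpred2_subst[OF dp] dterm_evens_odds)
  ultimately have fdp: "dpred M (\<lambda>u. f (\<lambda>i. u (Suc i)) < u 0)"
    unfolding fless by (intro dpred_disj dpred_conj dpred_not dpred_less dterm_intros)
  obtain U where U: "U \<subseteq> V" "open U" "U \<noteq> {}" "continuous_on U f"
    by (rule generically_continuous[OF insert.prems(1) fdep fdp insert.prems(7,8)])
  obtain v0 where "v0 \<in> U" using U(3) by blast
  then obtain I1 e where I1: "finite I1" "e > 0"
    "\<And>w. (\<And>i. i \<in> I1 \<Longrightarrow> \<bar>w i - v0 i\<bar> < e) \<Longrightarrow> w \<in> U"
    using open_seq_contains_box U(2) by metis
  define D where "D = {w. \<forall>i\<in>I1. \<bar>w i - v0 i\<bar> < e}"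
  have D: "open D" "v0 \<in> D" "D \<subseteq> U"
    using I1 open_seq_box[of I1 v0 e] by (auto simp: D_def)
  have fD: "continuous_on D f" using U(4) D(3) by (rule continuous_on_subset)
  show ?case
  proof (cases "\<exists>a. \<forall>v\<in>D. f v = a")
    case True
    then obtain a where a: "\<And>v. v \<in> D \<Longrightarrow> f v = a" by blast
    \<comment> \<open>Over every point of \<open>D\<close> the minimum \<open>a\<close> is attained,
      so the slice at \<open>a\<close> still has nonempty fibres.\<close>
    define Y' where "Y' v y = Y v (y(i := a))" for v y
    have "\<exists>A\<subseteq>J. card A = card I \<and> interior {u. \<exists>v y. Y' v y \<and> (\<forall>a\<in>A. y a = u a)} \<noteq> {}"
    proof (rule insert.IH[where V = D])
      show "dpred2 M Y'" unfolding Y'_def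
        by (intro dpred2_def[THEN iffD2] dpred2_subst[OF dp] dterm_evens_odds dterm_intros)
      have "continuous_on UNIV (\<lambda>(v :: nat \<Rightarrow> real, y :: nat \<Rightarrow> real). (v, y(i := a)))"
        unfolding case_prod_unfold
        by (intro continuous_on_Pair continuous_on_seq_upd_joint continuous_on_fst continuous_on_snd
            continuous_on_id continuous_on_const)
      from closed_vimage[OF cl this] show "closed {(v, y). Y' v y}"
        by (simp add: vimage_def case_prod_unfold Y'_def)
      show "Y' v' y'" if "\<forall>i\<in>I. v i = v' i" "\<forall>j\<in>J. y j = y' j" "Y' v y" for v v' y y'
        unfolding Y'_def by (rule dep[OF _ _ that(3)[unfolded Y'_def]]) (use that in auto)
      show "\<bar>y j\<bar> \<le> B" if "Y' v y" "j \<in> J" for v y j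
        using bnd[OF that(1)[unfolded Y'_def], of j] that(2) insert.hyps by (auto split: if_splits)
      show "v i = v' i" if "Y' v y" "Y' v' y" "i \<in> I" for v v' y i
        using inj that unfolding Y'_def by blast
      show "\<exists>y. Y' v y" if vD: "v \<in> D" for v
      proof -
        obtain y where "Y v y" using insert.prems(9) vD D U by blast
        then obtain y' where "Y v y'" "y' i = a" using min a[OF vD] by metis
        then have "Y v (y'(i := a))" by (metis fun_upd_triv)
        then show ?thesis unfolding Y'_def by blast
      qed
    qed (use insert.prems D in auto)
    then obtain A where A: "A \<subseteq> J" "card A = card I"
      "interior {u. \<exists>v y. Y' v y \<and> (\<forall>a\<in>A. y a = u a)} \<noteq> {}" by blast
    have "{u. \<exists>v y. Y' v y \<and> (\<forall>a\<in>A. y a = u a)} \<subseteq> {u. \<exists>v y. Y v y \<and> (\<forall>a\<in>A. y a = u a)}"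
    proof
      fix u assume "u \<in> {u. \<exists>v y. Y' v y \<and> (\<forall>a\<in>A. y a = u a)}"
      then obtain v y where "Y v (y(i := a))" "\<forall>a\<in>A. y a = u a" by (auto simp: Y'_def)
      moreover have "i \<notin> A" using A(1) insert.hyps by blast
      ultimately have "Y v (y(i := a)) \<and> (\<forall>b\<in>A. (y(i := a)) b = u b)" by auto
      then show "u \<in> {u. \<exists>v y. Y v y \<and> (\<forall>a\<in>A. y a = u a)}" by blast
    qed
    from interior_mono[OF this] A show ?thesis by blast
  next
    case False
    \<comment> \<open>Two points of \<open>D\<close> are joined by changing the coordinates in
      \<open>I\<close> one at a time, and a nonconstant \<open>f\<close> must change in some such
      move.\<close>
    have "\<exists>v\<in>D. \<exists>k\<in>I. \<exists>t. v(k := t) \<in> D \<and> f (v(k := t)) \<noteq> f v"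
    proof (rule ccontr)
      assume "\<not> ?thesis"
      then have same: "\<And>v k t. v \<in> D \<Longrightarrow> k \<in> I \<Longrightarrow> v(k := t) \<in> D \<Longrightarrow> f (v(k := t)) = f v" by blast
      have "f w = f v0" if w: "w \<in> D" for w
      proof -
        have "f (override_on v0 w S) = f v0" if "finite S" "S \<subseteq> I" for S
          using that
        proof (induction S rule: finite_induct)
          case (insert k S)
          have eq: "override_on v0 w (insert k S) = (override_on v0 w S)(k := w k)"
            by (auto simp: override_on_def)
          have "override_on v0 w T \<in> D" for T using w D(2) by (auto simp: D_def override_on_def)
          then have "f ((override_on v0 w S)(k := w k)) = f (override_on v0 w S)"
            using insert.prems eq by (intro same) (auto simp: eq[symmetric])
          also have "\<dots> = f v0" using insert by blast
          finally show ?case unfolding eq .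
        qed auto
        from this[OF insert.prems(1) subset_refl] have "f (override_on v0 w I) = f v0" .
        moreover have "f (override_on v0 w I) = f w"
          by (rule depends_onD[OF fdep]) (auto simp: override_on_def)
        ultimately show ?thesis by simp
      qed
      then show False using False by blast
    qed
    then obtain v k t where vkt: "v \<in> D" "k \<in> I" "v(k := t) \<in> D" "f (v(k := t)) \<noteq> f v" by blast
    obtain s0 s1 where s: "v(k := s0) \<in> D" "v(k := s1) \<in> D" "f (v(k := s0)) < f (v(k := s1))"
    proof (cases "f (v(k := t)) < f v")
      case True
      then show ?thesis using that[of t "v k"] vkt by simp
    next
      case False
      then show ?thesis using that[of "v k" t] vkt by simp
    qed
    define f0 f1 where "f0 = f (v(k := s0))" and "f1 = f (v(k := s1))"
    \<comment> \<open>The middle third of the jump: base points near \<open>v\<close> still have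
      values below \<open>c0\<close> at \<open>s0\<close> and above \<open>c1\<close> at
      \<open>s1\<close>, so every \<open>c\<close> in between is attained on the segment.\<close>
    define c0 c1 where "c0 = (2 * f0 + f1) / 3" and "c1 = (f0 + 2 * f1) / 3"
    have c: "f0 < c0" "c0 < c1" "c1 < f1" using s(3) by (auto simp: c0_def c1_def f0_def f1_def)
    define W0 W1 where "W0 = D \<inter> f -` {..<c0}" and "W1 = D \<inter> f -` {c1<..}"
    have W: "open W0" "open W1"
      unfolding W0_def W1_def using fD D(1) by (auto intro: continuous_open_preimage)
    define Q where "Q = {x. x(k := s0) \<in> W0} \<inter> {x. x(k := s1) \<in> W1}"
    have Q: "open Q" "v \<in> Q"
    proof -
      show "open Q" unfolding Q_def by (intro open_Int open_seq_upd W)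
      show "v \<in> Q" using c s by (auto simp: Q_def W0_def W1_def f0_def f1_def)
    qed
    define L H where "L = min s0 s1" and "H = max s0 s1"
    have hit: "\<exists>t\<in>{L..H}. x(k := t) \<in> D \<and> f (x(k := t)) = c" if "x \<in> Q" "c0 < c" "c < c1" for x c
    proof -
      \<comment> \<open>\<open>D\<close> is a box, so it contains the segment between two of its
        points that differ in coordinate \<open>k\<close> only.\<close>
      have inD: "x(k := t) \<in> D" if "t \<in> {L..H}" for t
      proof -
        have "\<bar>(x(k := s0)) i - v0 i\<bar> < e" "\<bar>(x(k := s1)) i - v0 i\<bar> < e" if "i \<in> I1" for i
          using \<open>x \<in> Q\<close> that by (auto simp: Q_def W0_def W1_def D_def)
        then have "\<bar>(x(k := t)) i - v0 i\<bar> < e" if "i \<in> I1" for i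
          using that \<open>t \<in> {L..H}\<close> by (cases "i = k") (fastforce simp: L_def H_def abs_if split: if_splits)+
        then show ?thesis by (simp add: D_def)
      qed
      have "continuous_on {L..H} (\<lambda>t. f (x(k := t)))"
        by (rule continuous_on_compose2[OF fD continuous_on_seq_upd_value]) (use inD in auto)
      then have "connected ((\<lambda>t. f (x(k := t))) ` {L..H})"
        by (rule connected_continuous_image) auto
      moreover have "f (x(k := s0)) \<in> (\<lambda>t. f (x(k := t))) ` {L..H}"
        "f (x(k := s1)) \<in> (\<lambda>t. f (x(k := t))) ` {L..H}" by (auto simp: L_def H_def)
      moreover have "f (x(k := s0)) \<le> c" "c \<le> f (x(k := s1))"
        using that by (auto simp: Q_def W0_def W1_def)
      ultimately have "c \<in> (\<lambda>t. f (x(k := t))) ` {L..H}"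
        unfolding connected_iff_interval by blast
      then show ?thesis using inD by blast
    qed
    \<comment> \<open>Coordinate \<open>k\<close> is projected away. Keeping \<open>t\<close> in a
      compact interval makes the projection closed again.\<close>
    define Yc where "Yc c v y \<longleftrightarrow> (\<exists>t. L \<le> t \<and> t \<le> H \<and> Y (v(k := t)) (y(i := c)))" for c v y
    have slice: "\<exists>A\<subseteq>J. card A = card (I - {k}) \<and>
        interior {u. \<exists>v y. Yc c v y \<and> (\<forall>a\<in>A. y a = u a)} \<noteq> {}" if c: "c0 < c" "c < c1" for c
    proof (rule insert.IH[where V = Q])
      show "dpred2 M (Yc c)" unfolding Yc_def
        by (intro dpred2_def[THEN iffD2] dpred_ex dpred_conj dpred_le dpred2_subst[OF dp]
            dterm_evens_odds dterm_intros)
           (auto simp: evens_def odds_def intro: dterm_intros)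
      define Z where "Z = {x. case x of ((v, y), t) \<Rightarrow> Y (v(k := t)) (y(i := c))}"
      have "continuous_on UNIV (\<lambda>((v :: nat \<Rightarrow> real, y :: nat \<Rightarrow> real), t). (v(k := t), y(i := c)))"
        unfolding case_prod_unfold
        by (intro continuous_on_Pair continuous_on_seq_upd_joint continuous_on_fst continuous_on_snd
            continuous_on_id continuous_on_const)
      from closed_vimage[OF cl this] have "closed Z"
        by (simp add: vimage_def case_prod_unfold Z_def)
      from closed_projection_compact[OF this compact_Icc[of L H]]
      show "closed {(v, y). Yc c v y}" by (simp add: Z_def Yc_def case_prod_unfold Bex_def conj_assoc)
      show "Yc c v' y'" if "\<forall>i\<in>I - {k}. v i = v' i" "\<forall>j\<in>J. y j = y' j" and Ycv: "Yc c v y" for v v' y y'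
      proof -
        obtain t where t: "L \<le> t" "t \<le> H" "Y (v(k := t)) (y(i := c))"
          using Ycv by (auto simp: Yc_def)
        have "Y (v'(k := t)) (y'(i := c))" by (rule dep[OF _ _ t(3)]) (use that in auto)
        then show ?thesis using t unfolding Yc_def by blast
      qed
      show "\<bar>y j\<bar> \<le> B" if Ycv: "Yc c v y" and "j \<in> J" for v y j
      proof -
        obtain t where t: "Y (v(k := t)) (y(i := c))" using Ycv by (auto simp: Yc_def)
        show ?thesis using bnd[OF t, of j] \<open>j \<in> J\<close> insert.hyps by (auto split: if_splits)
      qed
      show "v l = v' l" if Ycv: "Yc c v y" "Yc c v' y" and l: "l \<in> I - {k}" for v v' y l
      proof -
        obtain t t' where t: "Y (v(k := t)) (y(i := c))" "Y (v'(k := t')) (y(i := c))"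
          using Ycv by (auto simp: Yc_def)
        have "(v(k := t)) l = (v'(k := t')) l" using inj[OF t, of l] l by blast
        then show ?thesis using l by simp
      qed
      show "\<exists>y. Yc c x y" if "x \<in> Q" for x
      proof -
        obtain t where t: "t \<in> {L..H}" "x(k := t) \<in> D" "f (x(k := t)) = c" using hit[OF \<open>x \<in> Q\<close> c] by blast
        then obtain y where "Y (x(k := t)) y" using insert.prems(9) D U by blast
        then obtain y' where "Y (x(k := t)) y'" "y' i = c" using min t(3) by metis
        then have "Y (x(k := t)) (y'(i := c))" by (metis fun_upd_triv)
        then show ?thesis unfolding Yc_def using t(1) by auto
      qed
    qed (use insert.prems Q in auto)
    define W where "W A u \<longleftrightarrow> (\<exists>v y. Y v y \<and> (\<forall>a\<in>insert i A. y a = u a))" for A u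
    have "i \<notin> J" by (rule insert.hyps)
    have finJ: "finite J" by (rule insert.hyps)
    have Wdp: "dpred M (W A)" if "A \<subseteq> J" for A
    proof -
      have "finite (insert i A)" using that finJ finite_subset by blast
      have "W A = (\<lambda>u. \<exists>w. Y (evens w) (odds w) \<and> (\<forall>a\<in>insert i A. odds w a = u a))"
      proof (intro ext iffI)
        fix u assume "W A u"
        then obtain v y where vy: "Y v y" "\<forall>a\<in>insert i A. y a = u a" by (auto simp: W_def)
        define w where "w n = (if even n then v (n div 2) else y (n div 2))" for n
        have "evens w = v" "odds w = y" by (auto simp: w_def evens_def odds_def)
        then show "\<exists>w. Y (evens w) (odds w) \<and> (\<forall>a\<in>insert i A. odds w a = u a)" using vy by blast
      qed (auto simp: W_def)
      moreover have "dpred M (\<lambda>u. \<exists>w. Y (evens w) (odds w) \<and> (\<forall>a\<in>insert i A. odds w a = u a))"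
        using \<open>finite (insert i A)\<close>
        by (intro dpred_exs dpred2_def[THEN iffD2] dpred_conj dpred2_subst[OF dp] dpred_fin_all dpred_eq
            dterm_evens_odds)
          (auto simp: evens_def odds_def intro: dterm_var)
      ultimately show ?thesis by simp
    qed
    \<comment> \<open>The interior of a slice contains a box; rational centres and radii leave
      countably many candidates, one of which serves an open set of values
      \<open>u i\<close>.\<close>
    define K where "K = {A. A \<subseteq> J \<and> card A = card (I - {k})} \<times> (PiE J (\<lambda>_. \<rat> :: real set)) \<times> (\<rat> \<inter> {0<..} :: real set)"
    define P where "P = (\<lambda>(A, p, d) u. \<forall>w. (\<forall>a\<in>J. \<bar>w a - p a\<bar> < d) \<longrightarrow> W A (w(i := u i)))"
    have "countable {A. A \<subseteq> J \<and> card A = card (I - {k})}"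
      using finJ by (auto intro: countable_finite)
    then have K: "countable K" unfolding K_def
      by (intro countable_SIGMA countable_PiE finJ countable_rat countable_Int1)
    have "open {u :: nat \<Rightarrow> real. u i \<in> {c0<..<c1}}" by (rule open_seq_coord) auto
    moreover have "{u :: nat \<Rightarrow> real. u i \<in> {c0<..<c1}} \<noteq> {}"
      using c(2) by (auto intro!: exI[of _ "\<lambda>_. (c0 + c1) / 2"])
    moreover have "\<exists>\<kappa>\<in>K. P \<kappa> u" if u: "u \<in> {u. u i \<in> {c0<..<c1}}" for u
    proof -
      obtain A where A: "A \<subseteq> J" "card A = card (I - {k})"
        "interior {w. \<exists>v y. Yc (u i) v y \<and> (\<forall>a\<in>A. y a = w a)} \<noteq> {}"
        using slice[of "u i"] u by auto
      define T where "T = {w. \<exists>v y. Yc (u i) v y \<and> (\<forall>a\<in>A. y a = w a)}"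
      obtain p where "p \<in> interior T" using A(3) by (auto simp: T_def)
      then obtain I2 d where d: "finite I2" "d > 0"
        "\<And>w. (\<And>i. i \<in> I2 \<Longrightarrow> \<bar>w i - p i\<bar> < d) \<Longrightarrow> w \<in> interior T"
        using open_seq_contains_box[OF open_interior] by metis
      have box: "w \<in> T" if "\<forall>a\<in>J. \<bar>w a - p a\<bar> < d" for w
      proof -
        have "override_on p w J \<in> interior T" using that d(2) by (intro d(3)) (auto simp: override_on_def)
        then have "override_on p w J \<in> T" using interior_subset by blast
        moreover have "override_on p w J a = w a" if "a \<in> A" for a using that A(1) by auto
        ultimately show ?thesis unfolding T_def by auto
      qed
      have "\<exists>q\<in>\<rat>. \<bar>q - p a\<bar> < d / 2" for a
      proof -
        obtain q where "q \<in> \<rat>" "p a - d / 2 < q" "q < p a + d / 2"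
          using Rats_dense_in_real[of "p a - d / 2" "p a + d / 2"] d(2) by auto
        then show ?thesis by (intro bexI[of _ q]) linarith+
      qed
      then obtain q where q: "\<And>a. q a \<in> \<rat>" "\<And>a. \<bar>q a - p a\<bar> < d / 2" by metis
      obtain d' where d': "d' \<in> \<rat>" "0 < d'" "d' < d / 2" using Rats_dense_in_real[of 0 "d / 2"] d(2) by auto
      have "(A, restrict q J, d') \<in> K" using A q d' by (auto simp: K_def)
      moreover have "P (A, restrict q J, d') u" unfolding P_def prod.case
      proof (intro allI impI)
        fix w assume w: "\<forall>a\<in>J. \<bar>w a - restrict q J a\<bar> < d'"
        have "\<bar>w a - p a\<bar> < d" if "a \<in> J" for a
        proof -
          have "\<bar>w a - q a\<bar> < d'" using bspec[OF w that] that by simp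
          then show ?thesis using q(2)[of a] d'(3) by linarith
        qed
        then have "w \<in> T" using box by blast
        then obtain v y t where vy: "Y (v(k := t)) (y(i := u i))" "\<forall>a\<in>A. y a = w a"
          unfolding T_def Yc_def by auto
        have "\<forall>a\<in>insert i A. (y(i := u i)) a = (w(i := u i)) a" using vy(2) by auto
        then show "W A (w(i := u i))" unfolding W_def using vy(1) by blast
      qed
      ultimately show ?thesis by blast
    qed
    moreover have "dpred M (P \<kappa>)" if "\<kappa> \<in> K" for \<kappa>
    proof -
      obtain A p d where \<kappa>: "\<kappa> = (A, p, d)" by (cases \<kappa>)
      have WA: "dpred M (W A)" using Wdp that by (auto simp: K_def \<kappa>)
      show ?thesis unfolding \<kappa> P_def prod.case
        by (intro dpred_alls dpred2_def[THEN iffD2] dpred_imp dpred_fin_all finJ dpred_abs_less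
            dpred_subst[OF WA] dterm_evens_odds dterm_intros)
    qed
    ultimately obtain \<kappa> G where G: "\<kappa> \<in> K" "G \<subseteq> {u. u i \<in> {c0<..<c1}}" "open G" "G \<noteq> {}" "\<forall>u\<in>G. P \<kappa> u"
      by (rule dpred_countable_union[OF K])
    obtain A p d where \<kappa>: "\<kappa> = (A, p, d)" by (cases \<kappa>)
    obtain g where g: "g \<in> G" using G(4) by blast
    \<comment> \<open>\<open>P \<kappa> u\<close> sees \<open>u\<close> only through
      \<open>u i\<close>, so the other coordinates may range over the common box.\<close>
    define G' where "G' = {u. \<forall>a\<in>J. \<bar>u a - p a\<bar> < d} \<inter> {u. g(i := u i) \<in> G}"
    have "open {u :: nat \<Rightarrow> real. g(i := u i) \<in> G}"
      using open_vimage[OF G(3) continuous_on_seq_upd_joint, of "\<lambda>_. g" "\<lambda>u. u i" i]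
      by (simp add: vimage_def)
    then have "open G'" unfolding G'_def by (intro open_Int open_seq_box finJ)
    moreover have "(\<lambda>a. if a \<in> J then p a else g a) \<in> G'"
      using g G(1) \<open>i \<notin> J\<close> by (auto simp: G'_def K_def \<kappa>)
    moreover have "G' \<subseteq> {u. W A u}"
    proof
      fix u assume u: "u \<in> G'"
      then have "P \<kappa> (g(i := u i))" using G(5) by (auto simp: G'_def)
      then have "W A (u(i := (g(i := u i)) i))" using u unfolding P_def \<kappa> G'_def by blast
      then show "u \<in> {u. W A u}" by simp
    qed
    ultimately have "interior {u. W A u} \<noteq> {}"
      using interior_maximal[of G' "{u. W A u}"] by blast
    moreover have A: "A \<subseteq> J" "card A = card (I - {k})" using G(1) by (auto simp: K_def \<kappa>)
    moreover have "card (insert i A) = card I"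
    proof -
      have "finite A" "i \<notin> A" using A(1) finJ \<open>i \<notin> J\<close> finite_subset by blast+
      then have "card (insert i A) = Suc (card (I - {k}))" using A(2) by simp
      also have "\<dots> = card I" by (rule card_Suc_Diff1[OF insert.prems(1) vkt(2)])
      finally show ?thesis .
    qed
    ultimately show ?thesis unfolding W_def by (intro exI[of _ "insert i A"]) auto
  qed
qed

end

section \<open>Closed definable sets without interior are null\<close>

text \<open>For small \<open>t\<close> both \<open>K\<close> and its translate lie in an open
  \<open>T\<close> of measure less than twice that of \<open>K\<close>, so they cannot be
  disjoint.\<close>

lemma Steinhaus_differences:
  fixes K :: "real set"
  assumes "compact K" "emeasure lborel K \<noteq> 0"
  obtains d where "d > 0" "\<And>t. \<bar>t\<bar> < d \<Longrightarrow> \<exists>x\<in>K. \<exists>y\<in>K. t = x - y"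
proof -
  have K: "K \<in> lmeasurable" using assms(1) by (rule lmeasurable_compact)
  have "emeasure lebesgue K \<noteq> 0" using assms by (simp add: borel_compact)
  moreover have "emeasure lebesgue K = ennreal (measure lebesgue K)"
    using K by (rule emeasure_eq_measure2)
  ultimately have pos: "measure lebesgue K > 0" by (simp add: zero_less_measure_iff)
  have "K \<in> sets lebesgue" using K by (rule fmeasurableD)
  then obtain T where T: "open T" "K \<subseteq> T" "T - K \<in> lmeasurable"
    "emeasure lebesgue (T - K) < ennreal (measure lebesgue K)"
    using pos by (rule sets_lebesgue_outer_open)
  have TmK: "measure lebesgue (T - K) < measure lebesgue K"
    using T(4) by (simp add: emeasure_eq_measure2[OF T(3)] ennreal_less_iff)
  have TK: "T \<in> lmeasurable" "measure lebesgue T = measure lebesgue K + measure lebesgue (T - K)"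
  proof -
    have eq: "T = K \<union> (T - K)" using T(2) by blast
    show "T \<in> lmeasurable" using fmeasurable.Un[OF K T(3)] eq by simp
    have "measure lebesgue (K \<union> (T - K)) = measure lebesgue K + measure lebesgue (T - K)"
      using measure_Un3[OF K T(3)] by simp
    then show "measure lebesgue T = measure lebesgue K + measure lebesgue (T - K)" using eq by simp
  qed
  have "closed (- T)" "K \<inter> - T = {}" using T(1,2) by auto
  from separate_compact_closed[OF assms(1) this]
  obtain d where d: "d > 0" "\<And>x y. x \<in> K \<Longrightarrow> y \<in> - T \<Longrightarrow> d \<le> dist x y" by blast
  have "\<exists>x\<in>K. \<exists>y\<in>K. t = x - y" if t: "\<bar>t\<bar> < d" for t
  proof (rule ccontr)
    assume neg: "\<not> ?thesis"
    have sub: "(+) t ` K \<subseteq> T"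
    proof
      fix z assume "z \<in> (+) t ` K"
      then obtain x where x: "x \<in> K" "z = t + x" by blast
      have "dist x z < d" using t x by (simp add: dist_real_def)
      then show "z \<in> T" using d(2)[OF x(1), of z] by fastforce
    qed
    have disj: "K \<inter> (+) t ` K = {}" using neg by force
    have tK: "(+) t ` K \<in> lmeasurable" using K by (simp add: measurable_translation)
    have "measure lebesgue K + measure lebesgue ((+) t ` K) = measure lebesgue (K \<union> (+) t ` K)"
      using measure_Un3[OF K tK] disj by simp
    also have "\<dots> \<le> measure lebesgue T"
      by (rule measure_mono_fmeasurable) (use sub T(2) TK K tK in auto)
    finally show False using TK(2) TmK by (simp add: measure_translation)
  qed
  then show ?thesis using that d(1) by blast
qed

text \<open>A rational chosen in the gap after each point is not beyond any later point of
  \<open>K\<close>, so different points receive different rationals.\<close>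

lemma countable_right_isolated:
  fixes K :: "real set"
  shows "countable {x \<in> K. \<exists>e>0. \<forall>y. x < y \<and> y < x + e \<longrightarrow> y \<notin> K}" (is "countable ?E")
proof -
  have "\<forall>x\<in>?E. \<exists>q\<in>\<rat>. x < q \<and> (\<forall>y\<in>K. x < y \<longrightarrow> q \<le> y)"
  proof
    fix x assume "x \<in> ?E"
    then obtain e where e: "e > 0" "\<And>y. x < y \<Longrightarrow> y < x + e \<Longrightarrow> y \<notin> K" by blast
    obtain q where "q \<in> \<rat>" "x < q" "q < x + e" using Rats_dense_in_real[of x "x + e"] e by auto
    moreover have "q \<le> y" if "y \<in> K" "x < y" for y
      using e(2)[of y] that calculation by force
    ultimately show "\<exists>q\<in>\<rat>. x < q \<and> (\<forall>y\<in>K. x < y \<longrightarrow> q \<le> y)" by blast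
  qed
  from bchoice[OF this[unfolded Bex_def]] obtain q where
    q': "\<forall>x\<in>?E. q x \<in> \<rat> \<and> x < q x \<and> (\<forall>y\<in>K. x < y \<longrightarrow> q x \<le> y)" ..
  have q: "\<And>x. x \<in> ?E \<Longrightarrow> q x \<in> \<rat>" "\<And>x. x \<in> ?E \<Longrightarrow> x < q x"
    "\<And>x y. x \<in> ?E \<Longrightarrow> y \<in> K \<Longrightarrow> x < y \<Longrightarrow> q x \<le> y"
    using bspec[OF q'] by simp_all
  have "inj_on q ?E"
  proof (rule linorder_inj_onI')
    fix x y assume xy: "x \<in> ?E" "y \<in> ?E" "x < y"
    then have "q x \<le> y" using q(3) by blast
    then show "q x \<noteq> q y" using q(2)[OF xy(2)] by simp
  qed
  moreover have "countable (q ` ?E)" by (rule countable_subset[OF _ countable_rat]) (use q(1) in blast)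
  ultimately show ?thesis by (rule countable_image_inj_on[rotated])
qed

lemma countable_left_isolated:
  fixes K :: "real set"
  shows "countable {x \<in> K. \<exists>e>0. \<forall>y. x - e < y \<and> y < x \<longrightarrow> y \<notin> K}"
proof -
  have "{x \<in> K. \<exists>e>0. \<forall>y. x - e < y \<and> y < x \<longrightarrow> y \<notin> K} \<subseteq>
    uminus ` {x \<in> uminus ` K. \<exists>e>0. \<forall>y. x < y \<and> y < x + e \<longrightarrow> y \<notin> uminus ` K}" (is "_ \<subseteq> _ ` ?E")
  proof
    fix x assume "x \<in> {x \<in> K. \<exists>e>0. \<forall>y. x - e < y \<and> y < x \<longrightarrow> y \<notin> K}"
    then obtain e where e: "x \<in> K" "e > 0" "\<And>y. x - e < y \<Longrightarrow> y < x \<Longrightarrow> y \<notin> K" by blast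
    have "y \<notin> uminus ` K" if "- x < y" "y < - x + e" for y
      using e(3)[of "- y"] that by force
    then have "- x \<in> ?E" using e(1,2) by blast
    then show "x \<in> uminus ` ?E" by force
  qed
  then show ?thesis by (rule countable_subset) (intro countable_image countable_right_isolated)
qed

definition gap_end :: "real set \<Rightarrow> real \<Rightarrow> bool" where
  "gap_end K x \<longleftrightarrow> x \<in> K \<and> (\<exists>e. e > 0 \<and>
     ((\<forall>y. x < y \<and> y < x + e \<longrightarrow> y \<notin> K) \<or> (\<forall>y. x - e < y \<and> y < x \<longrightarrow> y \<notin> K)))"

lemma countable_gap_end: "countable {x. gap_end K x}"
proof -
  have "{x. gap_end K x} \<subseteq> {x \<in> K. \<exists>e>0. \<forall>y. x < y \<and> y < x + e \<longrightarrow> y \<notin> K} \<union>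
      {x \<in> K. \<exists>e>0. \<forall>y. x - e < y \<and> y < x \<longrightarrow> y \<notin> K}"
    unfolding gap_end_def by blast
  then show ?thesis
    by (rule countable_subset) (intro countable_Un countable_right_isolated countable_left_isolated)
qed

text \<open>Near \<open>x\<close> there is a point outside \<open>K\<close>; the point of
  \<open>K\<close> closest to it on the side of \<open>x\<close> borders a gap.\<close>

lemma gap_end_dense:
  assumes "compact K" "interior K = {}" "x \<in> K" "d > 0"
  obtains z where "gap_end K z" "\<bar>z - x\<bar> < d"
proof -
  have "\<not> {x - d<..<x + d} \<subseteq> K"
    using assms(2,4) interior_maximal[of "{x - d<..<x + d}" K] by auto
  then obtain y where "y \<in> {x - d<..<x + d}" "y \<notin> K" by blast
  then have y: "y \<notin> K" "x - d < y" "y < x + d" by auto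
  then consider "x < y" | "y < x" using assms(3) by fastforce
  then show ?thesis
  proof cases
    case 1
    have "compact (K \<inter> {x..y})" using assms(1) by (intro compact_Int_closed) auto
    moreover have "K \<inter> {x..y} \<noteq> {}" using assms(3) 1 by auto
    ultimately obtain z where z: "z \<in> K \<inter> {x..y}" "\<forall>w\<in>K \<inter> {x..y}. w \<le> z"
      using compact_attains_sup by blast
    have zy: "z < y" using z(1) y(1) by (auto simp: less_le)
    have "w \<notin> K" if "z < w" "w < z + (y - z)" for w
    proof
      assume "w \<in> K"
      then have "w \<in> K \<inter> {x..y}" using that z(1) by auto
      then have "w \<le> z" using z(2) by blast
      then show False using that(1) by simp
    qed
    then have "gap_end K z" unfolding gap_end_def using z(1) zy by (intro conjI exI[of _ "y - z"]) auto
    then show ?thesis using that z(1) zy y by auto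
  next
    case 2
    have "compact (K \<inter> {y..x})" using assms(1) by (intro compact_Int_closed) auto
    moreover have "K \<inter> {y..x} \<noteq> {}" using assms(3) 2 by auto
    ultimately obtain z where z: "z \<in> K \<inter> {y..x}" "\<forall>w\<in>K \<inter> {y..x}. z \<le> w"
      using compact_attains_inf by blast
    have zy: "y < z" using z(1) y(1) by (auto simp: less_le)
    have "w \<notin> K" if "z - (z - y) < w" "w < z" for w
    proof
      assume "w \<in> K"
      then have "w \<in> K \<inter> {y..x}" using that z(1) by auto
      then have "z \<le> w" using z(2) by blast
      then show False using that(2) by simp
    qed
    then have "gap_end K z" unfolding gap_end_def using z(1) zy by (intro conjI exI[of _ "z - y"]) auto
    then show ?thesis using that z(1) zy y by auto
  qed
qed

section \<open>Product probability measure on the sequence space\<close>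

definition unif :: "real measure" where
  "unif = uniform_measure lborel {0..1}"

text \<open>Volume in the unit cube for predicates on finitely many coordinates, whatever their
  number.\<close>

definition seqm :: "(nat \<Rightarrow> real) measure" where
  "seqm = PiM UNIV (\<lambda>_. unif)"

lemma sets_unif [measurable_cong]: "sets unif = sets borel"
  by (simp add: unif_def)

lemma prob_space_unif: "prob_space unif"
  unfolding unif_def by (rule prob_space_uniform_measure) auto

lemma emeasure_unif: "A \<in> sets borel \<Longrightarrow> emeasure unif A = emeasure lborel ({0..1} \<inter> A)"
  unfolding unif_def by (simp add: divide_ennreal_def)

interpretation unif: prob_space unif by (rule prob_space_unif)
interpretation seqm: product_prob_space "\<lambda>_ :: nat. unif" UNIV
  by unfold_locales
interpretation seqm': prob_space seqm
  unfolding seqm_def by (rule prob_space_PiM) (rule prob_space_unif)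

lemma sets_seqm: "sets seqm = sets borel"
proof -
  have "sets seqm = sets (PiM UNIV (\<lambda>_ :: nat. borel :: real measure))"
    unfolding seqm_def by (rule sets_PiM_cong) (auto simp: sets_unif)
  then show ?thesis by (simp add: sets_PiM_equal_borel)
qed

text \<open>Fubini along coordinate \<open>j\<close>: replacing that coordinate by an independent
  uniform value preserves the product measure.\<close>

lemma emeasure_seqm_fiber:
  assumes X: "X \<in> sets seqm"
  shows "emeasure seqm X = (\<integral>\<^sup>+v. emeasure unif {t. v(j := t) \<in> X} \<partial>seqm)"
proof -
  interpret pair_sigma_finite unif seqm by unfold_locales
  define h where "h = (\<lambda>(t :: real, v :: nat \<Rightarrow> real). v(j := t))"
  have dist: "distr (unif \<Otimes>\<^sub>M seqm) seqm h = seqm"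
    using distr_pair_PiM_eq_PiM[of UNIV "\<lambda>_ :: nat. unif" j] prob_space_unif
    by (simp add: seqm_def h_def)
  have h: "h \<in> measurable (unif \<Otimes>\<^sub>M seqm) seqm"
    unfolding h_def seqm_def case_prod_unfold
    by (rule measurable_fun_upd[where J = UNIV]) auto
  have "emeasure seqm X = emeasure (distr (unif \<Otimes>\<^sub>M seqm) seqm h) X" by (simp add: dist)
  also have "\<dots> = emeasure (unif \<Otimes>\<^sub>M seqm) (h -` X \<inter> space (unif \<Otimes>\<^sub>M seqm))"
    using h X by (rule emeasure_distr)
  also have "\<dots> = (\<integral>\<^sup>+v. emeasure unif ((\<lambda>t. (t, v)) -` (h -` X \<inter> space (unif \<Otimes>\<^sub>M seqm))) \<partial>seqm)"
    using h X by (intro emeasure_pair_measure_alt2 measurable_sets)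
  also have "\<dots> = (\<integral>\<^sup>+v. emeasure unif {t. v(j := t) \<in> X} \<partial>seqm)"
  proof -
    have "space (unif \<Otimes>\<^sub>M seqm) = UNIV"
      using sets_eq_imp_space_eq[OF sets_unif] sets_eq_imp_space_eq[OF sets_seqm]
      by (simp add: space_pair_measure)
    then show ?thesis by (simp add: h_def vimage_def)
  qed
  finally show ?thesis .
qed

context i_minimal_expansion
begin

lemma compact_null_or_interior:
  assumes Q: "dpred M (\<lambda>u. Q (u 0))" and K: "compact {t. Q t}" "emeasure lborel {t. Q t} \<noteq> 0"
  shows "interior {t. Q t} \<noteq> {}"
proof
  assume int: "interior {t. Q t} = {}"
  define K where "K = {t. Q t}"
  define D where "D t \<longleftrightarrow> (\<exists>a b. gap_end K a \<and> gap_end K b \<and> t = a - b)" for t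
  have Qd: "dpred M (\<lambda>u. f u \<in> K)" if "dterm M f" for f
    using dpred_subst[OF Q, of "\<lambda>u _. f u"] that by (simp add: K_def)
  have gd: "dpred M (\<lambda>u. gap_end K (f u))" if f: "dterm M f" for f
  proof -
    have "dpred M (\<lambda>u. gap_end K (u 0))" unfolding gap_end_def
      by (intro dpred_conj dpred_ex dpred_all dpred_disj dpred_imp dpred_not dpred_less Qd dterm_intros)
    from dpred_subst[OF this, of "\<lambda>u _. f u"] f show ?thesis by simp
  qed
  have "dpred M (\<lambda>u. D (u 0))" unfolding D_def
    by (intro dpred_ex dpred_conj gd dpred_eq dterm_intros)
  then have "definable M {t. D t}" using dpred_definable_real[of M "\<lambda>u. D (u 0)"] by simp
  moreover have "interior {t. D t} = {}"
  proof -
    have "{t. D t} \<subseteq> (\<lambda>(a, b). a - b) ` ({x. gap_end K x} \<times> {x. gap_end K x})"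
      by (auto simp: D_def)
    then have "countable {t. D t}"
      by (rule countable_subset) (intro countable_image countable_SIGMA countable_gap_end)
    then have "countable (interior {t. D t})" using interior_subset countable_subset by blast
    moreover have False if ne: "interior {t. D t} \<noteq> {}"
    proof -
      obtain q r where "q < r" "{q<..<r} \<subseteq> interior {t. D t}"
        using open_real_rat_interval[OF open_interior ne] by metis
      then show False using calculation uncountable_open_interval countable_subset by blast
    qed
    ultimately show ?thesis by blast
  qed
  \<comment> \<open>Countability excludes interior, so i-minimality makes these differences nowhere
    dense, against the density shown next.\<close>
  ultimately have nd: "interior (closure {t. D t}) = {}"
    using imin by (auto simp: i_minimal_def nowhere_dense_def)
  obtain d where d: "d > 0" "\<And>t. \<bar>t\<bar> < d \<Longrightarrow> \<exists>x\<in>K. \<exists>y\<in>K. t = x - y"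
    using Steinhaus_differences[OF K] K_def by metis
  have "{-d<..<d} \<subseteq> closure {t. D t}"
  proof
    fix t assume "t \<in> {-d<..<d}"
    then obtain x y where xy: "x \<in> K" "y \<in> K" "t = x - y" using d(2)[of t] by (auto simp: abs_less_iff)
    show "t \<in> closure {t. D t}" unfolding closure_approachable
    proof (intro allI impI)
      fix e :: real assume "e > 0"
      then have e: "e / 2 > 0" by simp
      obtain a where a: "gap_end K a" "\<bar>a - x\<bar> < e / 2"
        using gap_end_dense[OF K(1) int _ e, of x] xy(1) K_def by blast
      obtain b where b: "gap_end K b" "\<bar>b - y\<bar> < e / 2"
        using gap_end_dense[OF K(1) int _ e, of y] xy(2) K_def by blast
      have "D (a - b)" using a b D_def by blast
      moreover have "dist (a - b) t < e" using a(2) b(2) xy(3) unfolding dist_real_def by linarith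
      ultimately show "\<exists>z\<in>{t. D t}. dist z t < e" by blast
    qed
  qed
  then have "{-d<..<d} \<subseteq> interior (closure {t. D t})" by (rule interior_maximal) auto
  then show False using nd d(1) by auto
qed

text \<open>Fibres of positive length in direction \<open>j\<close> contain rational intervals by
  the one-dimensional case. Fubini then makes one of the countably many sets \<open>S q r\<close>
  non-null, and since \<open>S q r\<close> is closed, definable and free of coordinate
  \<open>j\<close>, the induction hypothesis gives it interior.\<close>

lemma closed_null_aux:
  assumes "finite I"
  shows "dpred M P \<Longrightarrow> depends_on I P \<Longrightarrow> closed {v. P v} \<Longrightarrow> emeasure seqm {v. P v} \<noteq> 0 \<Longrightarrow>
    interior {v. P v} \<noteq> {}"
  using assms
proof (induction I arbitrary: P rule: finite_induct)
  case empty
  then have "P v = P w" for v w by (auto simp: depends_on_def)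
  moreover have "\<exists>v. P v"
  proof (rule ccontr)
    assume "\<not> (\<exists>v. P v)"
    then have "{v. P v} = {}" by blast
    then show False using empty.prems(4) by (metis emeasure_empty)
  qed
  ultimately have "{v. P v} = UNIV" by blast
  then show ?case by simp
next
  case (insert j I)
  define S where "S q r = {v. \<forall>t. q < t \<and> t < r \<longrightarrow> P (v(j := t))}" for q r
  have Sdp: "dpred M (\<lambda>v. \<forall>t. q < t \<and> t < r \<longrightarrow> P (v(j := t)))" for q r
    by (intro dpred_all dpred_imp dpred_conj dpred_less dpred_subst[OF insert.prems(1)] dterm_intros)
  have Pj: "P (v(j := t)) = P (w(j := t))" if "\<forall>i\<in>I. v i = w i" for v w t
    by (rule depends_onD[OF insert.prems(2)]) (use that in auto)
  have Sdep: "depends_on I (\<lambda>v. \<forall>t. q < t \<and> t < r \<longrightarrow> P (v(j := t)))" for q r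
    unfolding depends_on_def
  proof (intro allI impI)
    fix v w :: "nat \<Rightarrow> real" assume "\<forall>i\<in>I. v i = w i"
    then have "P (v(j := t)) = P (w(j := t))" for t by (rule Pj)
    then show "(\<forall>t. q < t \<and> t < r \<longrightarrow> P (v(j := t))) = (\<forall>t. q < t \<and> t < r \<longrightarrow> P (w(j := t)))" by simp
  qed
  have Scl: "closed (S q r)" for q r
  proof -
    have "closed {v. P (v(j := t))}" for t
      using closed_vimage[OF insert.prems(3) continuous_on_seq_upd, of j t] by (simp add: vimage_def)
    then have "closed {v. q < t \<and> t < r \<longrightarrow> P (v(j := t))}" for t
      by (cases "q < t \<and> t < r") auto
    then show ?thesis unfolding S_def by (rule closed_Collect_all)
  qed
  have "\<exists>q\<in>\<rat>. \<exists>r\<in>\<rat>. q < r \<and> emeasure seqm (S q r) \<noteq> 0"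
  proof (rule ccontr)
    assume neg: "\<not> ?thesis"
    define R where "R = {(q, r). q \<in> \<rat> \<and> r \<in> \<rat> \<and> q < (r :: real)}"
    have "countable (\<rat> \<times> \<rat> :: (real \<times> real) set)" by (intro countable_SIGMA countable_rat)
    then have "countable R" by (rule countable_subset[rotated]) (auto simp: R_def)
    moreover have "S q r \<in> null_sets seqm" if "(q, r) \<in> R" for q r
      using that neg Scl[of q r] by (auto simp: R_def null_sets_def sets_seqm)
    ultimately have "(\<Union>(q, r)\<in>R. S q r) \<in> null_sets seqm"
      by (intro null_sets_UN') auto
    then have "AE v in seqm. v \<notin> (\<Union>(q, r)\<in>R. S q r)" by (rule AE_not_in)
    moreover have "emeasure unif {t. v(j := t) \<in> {v. P v}} = 0" if v: "v \<notin> (\<Union>(q, r)\<in>R. S q r)" for v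
    proof (rule ccontr)
      assume nz: "emeasure unif {t. v(j := t) \<in> {v. P v}} \<noteq> 0"
      have cl: "closed {t. P (v(j := t))}"
        using closed_vimage[OF insert.prems(3) continuous_on_seq_upd_value, of v j] by (simp add: vimage_def)
      have eq: "{0..1} \<inter> {t. P (v(j := t))} = {t. 0 \<le> t \<and> t \<le> 1 \<and> P (v(j := t))}" by auto
      have "emeasure unif {t. v(j := t) \<in> {v. P v}} = emeasure lborel {t. 0 \<le> t \<and> t \<le> 1 \<and> P (v(j := t))}"
        using cl by (simp add: emeasure_unif eq)
      moreover have "compact {t. 0 \<le> t \<and> t \<le> 1 \<and> P (v(j := t))}"
        unfolding eq[symmetric] using cl by (intro compact_Int_closed) auto
      moreover have "dpred M (\<lambda>u. 0 \<le> u 0 \<and> u 0 \<le> 1 \<and> P (v(j := u 0)))"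
        by (intro dpred_conj dpred_le dpred_subst[OF insert.prems(1)] dterm_intros)
      ultimately have "interior {t. 0 \<le> t \<and> t \<le> 1 \<and> P (v(j := t))} \<noteq> {}"
        using compact_null_or_interior[of "\<lambda>t. 0 \<le> t \<and> t \<le> 1 \<and> P (v(j := t))"] nz by simp
      then obtain q r where qr: "q \<in> \<rat>" "r \<in> \<rat>" "q < r"
        "{q<..<r} \<subseteq> interior {t. 0 \<le> t \<and> t \<le> 1 \<and> P (v(j := t))}"
        by (rule open_real_rat_interval[OF open_interior])
      then have "{q<..<r} \<subseteq> {t. 0 \<le> t \<and> t \<le> 1 \<and> P (v(j := t))}" using interior_subset by blast
      then have "v \<in> S q r" by (auto simp: S_def)
      then show False using v qr by (auto simp: R_def)
    qed
    ultimately have "AE v in seqm. emeasure unif {t. v(j := t) \<in> {v. P v}} = 0"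
      by (auto elim!: eventually_mono)
    then have "(\<integral>\<^sup>+v. emeasure unif {t. v(j := t) \<in> {v. P v}} \<partial>seqm) = (\<integral>\<^sup>+v. 0 \<partial>seqm)"
      by (rule nn_integral_cong_AE)
    then have "emeasure seqm {v. P v} = 0"
      using emeasure_seqm_fiber[of "{v. P v}" j] insert.prems(3) by (simp add: sets_seqm)
    then show False using insert.prems(4) by simp
  qed
  then obtain q r where qr: "q < r" "emeasure seqm (S q r) \<noteq> 0" by blast
  have "interior (S q r) \<noteq> {}"
    unfolding S_def
    by (rule insert.IH[OF Sdp Sdep Scl[of q r, unfolded S_def] qr(2)[unfolded S_def]])
  then obtain w where w: "w \<in> interior (S q r)" by blast
  define U where "U = {v. v j \<in> {q<..<r}} \<inter> {v. v(j := w j) \<in> interior (S q r)}"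
  have "open U" unfolding U_def by (intro open_Int open_seq_coord open_seq_upd) auto
  moreover have "w(j := (q + r) / 2) \<in> U" using w qr(1) by (auto simp: U_def)
  moreover have "U \<subseteq> {v. P v}"
  proof
    fix v assume "v \<in> U"
    then have "v(j := w j) \<in> S q r" "q < v j" "v j < r" using interior_subset by (auto simp: U_def)
    then have "P ((v(j := w j))(j := v j))" unfolding S_def by blast
    then show "v \<in> {v. P v}" by simp
  qed
  ultimately show ?case using interior_maximal[of U "{v. P v}"] by blast
qed

lemma closed_positive_measure_interior:
  "dpred M P \<Longrightarrow> closed {v. P v} \<Longrightarrow> emeasure seqm {v. P v} \<noteq> 0 \<Longrightarrow> interior {v. P v} \<noteq> {}"
  using closed_null_aux dpred_depends_on by blast

end

section \<open>A discretized projection theorem\<close>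

text \<open>Cauchy-Schwarz for the sizes of the fibres of \<open>f\<close>: few collisions force a
  large image.\<close>

lemma card_square_le_collisions:
  assumes "finite X"
  shows "(card X)\<^sup>2 \<le> card (f ` X) * card {(x, y) \<in> X \<times> X. f x = f y}"
proof -
  define h where "h c = card {x \<in> X. f x = c}" for c
  have "card {(x, y) \<in> X \<times> X. f x = f y} = card (\<Union>c\<in>f ` X. {x \<in> X. f x = c} \<times> {x \<in> X. f x = c})"
    by (rule arg_cong[of _ _ card]) auto
  also have "\<dots> = (\<Sum>c\<in>f ` X. card ({x \<in> X. f x = c} \<times> {x \<in> X. f x = c}))"
    using assms by (intro card_UN_disjoint) auto
  also have "\<dots> = (\<Sum>c\<in>f ` X. (h c)\<^sup>2)"
    by (simp add: h_def card_cartesian_product power2_eq_square)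
  finally have coll: "card {(x, y) \<in> X \<times> X. f x = f y} = (\<Sum>c\<in>f ` X. (h c)\<^sup>2)" .
  have "card X = (\<Sum>c\<in>f ` X. h c)"
    unfolding h_def using sum.image_gen[OF assms, of "\<lambda>_. 1 :: nat" f] by simp
  then have "(real (card X))\<^sup>2 = (\<Sum>c\<in>f ` X. 1 * real (h c))\<^sup>2" by simp
  also have "\<dots> \<le> (\<Sum>c\<in>f ` X. 1\<^sup>2) * (\<Sum>c\<in>f ` X. (real (h c))\<^sup>2)"
    by (rule Cauchy_Schwarz_ineq_sum)
  also have "\<dots> = real (card (f ` X) * card {(x, y) \<in> X \<times> X. f x = f y})"
    unfolding coll by simp
  finally have "real ((card X)\<^sup>2) \<le> real (card (f ` X) * card {(x, y) \<in> X \<times> X. f x = f y})" by simp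
  then show ?thesis by linarith
qed

lemma card_int_interval_bound:
  fixes T :: "int set"
  assumes "finite T" "\<And>s t. s \<in> T \<Longrightarrow> t \<in> T \<Longrightarrow> \<bar>s - t\<bar> * Z \<le> L" "Z \<ge> 0" "L \<ge> 0"
  shows "int (card T) * Z \<le> L + Z"
proof (cases "T = {}")
  case False
  define a b where "a = Min T" and "b = Max T"
  have ab: "a \<in> T" "b \<in> T" "a \<le> b" using assms(1) False by (auto simp: a_def b_def)
  have "T \<subseteq> {a..b}" using assms(1) by (auto simp: a_def b_def)
  then have "card T \<le> card {a..b}" by (intro card_mono) auto
  then have "int (card T) \<le> b - a + 1" using ab(3) by simp
  then have "int (card T) * Z \<le> (b - a + 1) * Z" using assms(3) by (rule mult_right_mono)
  also have "\<dots> \<le> L + Z" using assms(2)[OF ab(2,1)] ab(3) by (simp add: algebra_simps)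
  finally show ?thesis .
qed (use assms in auto)

text \<open>Once all entries of \<open>a\<close> except the one at \<open>p\<close> are fixed, that
  entry lies in an interval of length about \<open>2 * c * R / Z\<close>. The one extra integer from
  rounding is absorbed by \<open>Z \<le> R\<close>, which turns \<open>2 * c\<close> into
  \<open>2 * c + 1\<close>.\<close>

lemma card_small_combinations:
  fixes z :: "'i \<Rightarrow> int"
  assumes I: "finite I" "p \<in> I" and Z: "Z = \<bar>z p\<bar>" "Z \<le> int R" and c: "c \<ge> 0"
  shows "int (card {a \<in> PiE I (\<lambda>_. {0..<int R}). \<bar>\<Sum>i\<in>I. a i * z i\<bar> < c * int R}) * Z
    \<le> (2 * c + 1) * int R ^ card I"
proof -
  define J where "J = I - {p}"
  have J: "finite J" "I = insert p J" "p \<notin> J" using I by (auto simp: J_def)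
  define B where "B = {0..<int R}"

  define T where "T g = {t \<in> B. \<bar>t * z p + (\<Sum>i\<in>J. g i * z i)\<bar> < c * int R}" for g
  have "{a \<in> PiE I (\<lambda>_. B). \<bar>\<Sum>i\<in>I. a i * z i\<bar> < c * int R} \<subseteq>
      (\<Union>g\<in>PiE J (\<lambda>_. B). (\<lambda>t. g(p := t)) ` T g)"
  proof
    fix a assume a: "a \<in> {a \<in> PiE I (\<lambda>_. B). \<bar>\<Sum>i\<in>I. a i * z i\<bar> < c * int R}"
    then obtain t g where tg: "t \<in> B" "g \<in> PiE J (\<lambda>_. B)" "a = g(p := t)"
      unfolding J(2) PiE_insert_eq by auto
    have "(\<Sum>i\<in>I. a i * z i) = t * z p + (\<Sum>i\<in>J. a i * z i)" using J tg by simp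
    also have "(\<Sum>i\<in>J. a i * z i) = (\<Sum>i\<in>J. g i * z i)" using J(3) tg by (intro sum.cong) auto
    finally have "t \<in> T g" using a tg by (simp add: T_def)
    then show "a \<in> (\<Union>g\<in>PiE J (\<lambda>_. B). (\<lambda>t. g(p := t)) ` T g)" using tg by blast
  qed
  moreover have finT: "finite (T g)" for g
    by (rule finite_subset[of _ B]) (auto simp: T_def B_def)
  moreover have finP: "finite (PiE J (\<lambda>_. B))" using J by (intro finite_PiE) (auto simp: B_def)
  ultimately have "card {a \<in> PiE I (\<lambda>_. B). \<bar>\<Sum>i\<in>I. a i * z i\<bar> < c * int R} \<le>
      card (\<Union>g\<in>PiE J (\<lambda>_. B). (\<lambda>t. g(p := t)) ` T g)" by (intro card_mono) auto
  also have "\<dots> \<le> (\<Sum>g\<in>PiE J (\<lambda>_. B). card ((\<lambda>t. g(p := t)) ` T g))"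
    by (rule card_UN_le[OF finP])
  also have "\<dots> \<le> (\<Sum>g\<in>PiE J (\<lambda>_. B). card (T g))"
    by (intro sum_mono card_image_le finT)
  finally have le: "card {a \<in> PiE I (\<lambda>_. B). \<bar>\<Sum>i\<in>I. a i * z i\<bar> < c * int R} \<le>
      (\<Sum>g\<in>PiE J (\<lambda>_. B). card (T g))" .
  have T: "int (card (T g)) * Z \<le> (2 * c + 1) * int R" for g
  proof -
    have "int (card (T g)) * Z \<le> 2 * c * int R + Z"
    proof (rule card_int_interval_bound[OF finT])
      fix s t assume "s \<in> T g" "t \<in> T g"
      then have "\<bar>s * z p - t * z p\<bar> \<le> 2 * (c * int R)" unfolding T_def by auto
      then show "\<bar>s - t\<bar> * Z \<le> 2 * c * int R" unfolding Z
        by (simp add: abs_mult[symmetric] left_diff_distrib)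
    qed (use Z c in auto)
    then show ?thesis using Z(2) by (simp add: algebra_simps)
  qed
  have "int (card {a \<in> PiE I (\<lambda>_. B). \<bar>\<Sum>i\<in>I. a i * z i\<bar> < c * int R}) * Z \<le>
      int (\<Sum>g\<in>PiE J (\<lambda>_. B). card (T g)) * Z"
  proof (rule mult_right_mono)
    show "int (card {a \<in> PiE I (\<lambda>_. B). \<bar>\<Sum>i\<in>I. a i * z i\<bar> < c * int R}) \<le>
      int (\<Sum>g\<in>PiE J (\<lambda>_. B). card (T g))" using le by (simp only: of_nat_le_iff)
  qed (use Z(1) in simp)
  also have "\<dots> = (\<Sum>g\<in>PiE J (\<lambda>_. B). int (card (T g)) * Z)" by (simp add: sum_distrib_right)
  also have "\<dots> \<le> (\<Sum>g\<in>PiE J (\<lambda>_. B). (2 * c + 1) * int R)" by (intro sum_mono T)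
  also have "\<dots> = int R ^ card J * ((2 * c + 1) * int R)"
    using J(1) by (simp add: card_PiE B_def)
  also have "\<dots> = (2 * c + 1) * int R ^ card I"
    using J by simp
  finally show ?thesis by (simp add: B_def)
qed

text \<open>The \<open>x\<close> with \<open>Z x\<close> between \<open>2 ^ l\<close> and
  \<open>2 ^ (l + 1)\<close> contribute at most a constant times \<open>2 ^ l\<close>, because their
  number grows with exponent \<open>N + 1\<close> while the summand decays with exponent
  \<open>N\<close>. The geometric sum is comparable to its last term, which is of order
  \<open>R\<close>.\<close>

lemma dyadic_sum_bound:
  fixes Z :: "'x \<Rightarrow> nat" and C :: real
  assumes X: "finite X" and Z: "\<And>x. x \<in> X \<Longrightarrow> 1 \<le> Z x" "\<And>x. x \<in> X \<Longrightarrow> Z x < R"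
    and C: "\<And>\<rho>. 1 \<le> \<rho> \<Longrightarrow> real (card {x \<in> X. Z x < \<rho>}) \<le> C * real (2 * \<rho>) ^ (N + 1)"
  shows "(\<Sum>x\<in>X. 1 / real (Z x) ^ N) \<le> C * 4 ^ (N + 1) * (2 * real R)"
proof (cases "X = {}")
  case True
  have "0 \<le> C * real (2 * 1) ^ (N + 1)" using C[of 1] True by simp
  moreover have "\<not> (2 :: real) ^ N \<le> 0" by (simp add: not_le)
  ultimately have "0 \<le> C" by (simp add: zero_le_mult_iff)
  then show ?thesis using True by simp
next
  case False
  then have R: "R \<ge> 1" using Z by fastforce
  have "0 \<le> C * real (2 * 1) ^ (N + 1)" using C[of 1] by (meson le_refl of_nat_0_le_iff order_trans)
  moreover have "\<not> (2 :: real) ^ N \<le> 0" by (simp add: not_le)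
  ultimately have C0: "0 \<le> C" by (simp add: zero_le_mult_iff)
  define L where "L = (LEAST L. R \<le> 2 ^ L)"
  have ex: "R \<le> 2 ^ R" by (simp add: less_imp_le)
  have L1: "R \<le> 2 ^ L" unfolding L_def by (rule LeastI[of "\<lambda>L. R \<le> 2 ^ L", OF ex])
  have L2: "2 ^ L \<le> 2 * R"
  proof (cases L)
    case (Suc k)
    then have "\<not> R \<le> 2 ^ k" using not_less_Least[of k "\<lambda>L. R \<le> 2 ^ L"] L_def by auto
    then show ?thesis using Suc by simp
  qed (use R in simp)
  have "\<exists>l<L. 2 ^ l \<le> Z x \<and> Z x < 2 ^ Suc l" if x: "x \<in> X" for x
  proof -
    obtain l where l: "2 ^ l \<le> Z x" "Z x < 2 ^ Suc l"
      using ex_power_ivl1[of 2 "Z x"] Z(1)[OF x] by auto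
    have "2 ^ l < (2 :: nat) ^ L" using l Z(2)[OF x] L1 by linarith
    then have "l < L" by simp
    then show ?thesis using l by blast
  qed
  then obtain lev where lev: "\<And>x. x \<in> X \<Longrightarrow> lev x < L" "\<And>x. x \<in> X \<Longrightarrow> 2 ^ lev x \<le> Z x"
    "\<And>x. x \<in> X \<Longrightarrow> Z x < 2 ^ Suc (lev x)" by metis
  define S where "S l = {x \<in> X. lev x = l}" for l
  have "(\<Sum>x\<in>X. 1 / real (Z x) ^ N) = (\<Sum>l<L. \<Sum>x\<in>S l. 1 / real (Z x) ^ N)"
    unfolding S_def using X lev(1) by (intro sum.group[symmetric]) auto
  also have "\<dots> \<le> (\<Sum>l<L. C * 4 ^ (N + 1) * 2 ^ l)"
  proof (rule sum_mono)
    fix l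
    have "(\<Sum>x\<in>S l. 1 / real (Z x) ^ N) \<le> (\<Sum>x\<in>S l. 1 / (2 ^ l) ^ N)"
    proof (rule sum_mono)
      fix x assume "x \<in> S l"
      then have "2 ^ l \<le> Z x" using lev(2) by (auto simp: S_def)
      then have "real (2 ^ l) \<le> real (Z x)" by (simp only: of_nat_le_iff)
      then have "(2 ^ l :: real) ^ N \<le> real (Z x) ^ N" by (intro power_mono) auto
      then show "1 / real (Z x) ^ N \<le> 1 / (2 ^ l) ^ N" by (intro frac_le) auto
    qed
    also have "\<dots> = real (card (S l)) / (2 ^ l) ^ N" by simp
    also have "\<dots> \<le> (C * real (2 * 2 ^ Suc l) ^ (N + 1)) / (2 ^ l) ^ N"
    proof (rule divide_right_mono)
      have "card (S l) \<le> card {x \<in> X. Z x < 2 ^ Suc l}"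
        using X lev(3) by (intro card_mono) (auto simp: S_def)
      then show "real (card (S l)) \<le> C * real (2 * 2 ^ Suc l) ^ (N + 1)"
        using C[of "2 ^ Suc l"] by (simp add: order_trans[of "real (card (S l))"])
    qed simp
    also have "\<dots> = C * 4 ^ (N + 1) * 2 ^ l"
    proof -
      have "real (2 * 2 ^ Suc l) = 4 * 2 ^ l" by simp
      then have "real (2 * 2 ^ Suc l) ^ (N + 1) = 4 ^ (N + 1) * (2 ^ l * (2 ^ l) ^ N)"
        by (simp only: power_mult_distrib) simp
      then show ?thesis by simp
    qed
    finally show "(\<Sum>x\<in>S l. 1 / real (Z x) ^ N) \<le> C * 4 ^ (N + 1) * 2 ^ l" .
  qed
  also have "\<dots> = C * 4 ^ (N + 1) * (2 ^ L - 1)"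
  proof -
    have "(\<Sum>l<L. 2 ^ l :: real) = 2 ^ L - 1" by (induction L) auto
    then show ?thesis by (simp add: sum_distrib_left[symmetric])
  qed
  also have "\<dots> \<le> C * 4 ^ (N + 1) * (2 * real R)"
  proof (rule mult_left_mono)
    have "real (2 ^ L) \<le> real (2 * R)" using L2 by (simp only: of_nat_le_iff)
    then show "2 ^ L - 1 \<le> 2 * real R" by simp
  qed (use C0 in simp)
  finally show ?thesis .
qed

text \<open>One row \<open>a\<close> of a random matrix, applied to \<open>m\<close> points of a
  cube after its corner \<open>b\<close> has been moved to the origin.\<close>

definition lin_form ::
  "nat \<Rightarrow> nat \<Rightarrow> (nat \<Rightarrow> int) \<Rightarrow> (nat \<times> nat \<Rightarrow> int) \<Rightarrow> (nat \<Rightarrow> nat \<Rightarrow> int) \<Rightarrow> int" where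
  "lin_form m n b a x = (\<Sum>p\<in>{..<m} \<times> {..<n}. a p * (x (fst p) (snd p) - b (snd p)))"

text \<open>Second moment method: \<open>frost\<close> is a Frostman condition of exponent \<open>(N + 1) / m\<close>, which bounds
  the expected number of pairs in \<open>G\<^sup>m\<close> that a random matrix sends to the same cell.\<close>

lemma projection_cells:
  fixes G :: "(nat \<Rightarrow> int) set"
  assumes G: "finite G" and m: "m > 0" and n: "n > 0" and R: "R > 0"
    and box: "G \<subseteq> PiE {..<n} (\<lambda>i. {b i..<b i + int R})"
    and frost: "\<And>c \<rho>. \<rho> \<ge> 1 \<Longrightarrow>
      card {y \<in> G. \<forall>i<n. c i \<le> y i \<and> y i < c i + int \<rho>} ^ m * R ^ (N + 1) \<le> card G ^ m * \<rho> ^ (N + 1)"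
    and big: "R ^ (N + 1) \<le> card G ^ m"
  obtains A where "A \<in> PiE {..<N} (\<lambda>_. PiE ({..<m} \<times> {..<n}) (\<lambda>_. {0..<int R}))"
    "real R ^ N \<le> (2 * real (m * n) + 1) ^ N * (1 + 2 * 4 ^ (N + 1)) *
       real (card ((\<lambda>x. \<lambda>j\<in>{..<N}. lin_form m n b (A j) x div (int (m * n) * int R)) `
         PiE {..<m} (\<lambda>_. G)))"
proof -
  define Idx where "Idx = {..<m} \<times> {..<n}"
  define K where "K = m * n"
  define X where "X = PiE {..<m} (\<lambda>_. G)"
  define Rows where "Rows = PiE Idx (\<lambda>_. {0..<int R})"
  define Mat where "Mat = PiE {..<N} (\<lambda>_. Rows)"
  \<comment> \<open>A form is a sum of \<open>K\<close> terms below \<open>R * R\<close>; cells of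
    width \<open>K * R\<close> thus leave \<open>R\<close> values per row and \<open>R ^ N\<close>
    cells in all.\<close>
  define cell where "cell A x = (\<lambda>j\<in>{..<N}. lin_form m n b (A j) x div (int K * int R))" for A x
  define k where "k = (2 * real K + 1) ^ N"
  have fin: "finite Idx" "finite X" "finite Rows" "finite Mat"
    unfolding Idx_def X_def Rows_def Mat_def using G by (auto intro!: finite_PiE)
  have K: "K > 0" "card Idx = K" using m n by (auto simp: K_def Idx_def)
  have Idx: "Idx \<noteq> {}" using m n by (auto simp: Idx_def)
  have cX: "card X = card G ^ m" unfolding X_def by (simp add: card_PiE)
  have cM: "card Mat = (R ^ K) ^ N" unfolding Mat_def Rows_def using fin(1) K by (simp add: card_PiE)
  have Mpos: "card Mat > 0" using R by (simp add: cM)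
  have k1: "k \<ge> 1" unfolding k_def by (intro one_le_power) auto
  \<comment> \<open>The constant of the Frostman bound; \<open>big\<close> makes it at least 1,
    which later absorbs the diagonal pairs.\<close>
  define C where "C = real (card X) / real R ^ (N + 1)"
  have C1: "C \<ge> 1"
  proof -
    have "real (R ^ (N + 1)) \<le> real (card X)" using big unfolding cX by (simp only: of_nat_le_iff)
    then show ?thesis using R by (simp add: C_def)
  qed
  define cnt where "cnt x x' = card {A \<in> Mat. cell A x = cell A x'}" for x x'
  have row: "(\<Sum>x'\<in>X. real (cnt x x')) \<le> k * real (card Mat) * (C * real R) * (1 + 2 * 4 ^ (N + 1))"
    if x: "x \<in> X" for x
  proof -
    define z where "z x' p = x (fst p) (snd p) - x' (fst p) (snd p)" for x' :: "nat \<Rightarrow> nat \<Rightarrow> int" and p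
    \<comment> \<open>Distance of \<open>x\<close> and \<open>x'\<close> in the maximum norm; the
      matrix entry at a position attaining it is the one that a collision confines.\<close>
    define Z where "Z x' = nat (Max ((\<lambda>p. \<bar>z x' p\<bar>) ` Idx))" for x'
    have Zge: "\<bar>z x' p\<bar> \<le> int (Z x')" if "p \<in> Idx" for x' p
    proof -
      have le: "\<bar>z x' p\<bar> \<le> Max ((\<lambda>p. \<bar>z x' p\<bar>) ` Idx)" using that fin(1) by (intro Max_ge) auto
      then have "0 \<le> Max ((\<lambda>p. \<bar>z x' p\<bar>) ` Idx)" using abs_ge_zero order_trans by blast
      then show ?thesis using le by (simp add: Z_def)
    qed
    have Zat: "\<exists>p\<in>Idx. int (Z x') = \<bar>z x' p\<bar>" for x'
    proof -
      have "Max ((\<lambda>p. \<bar>z x' p\<bar>) ` Idx) \<in> (\<lambda>p. \<bar>z x' p\<bar>) ` Idx" using fin(1) Idx by (intro Max_in) auto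
      then obtain p where "p \<in> Idx" "Max ((\<lambda>p. \<bar>z x' p\<bar>) ` Idx) = \<bar>z x' p\<bar>" by blast
      then show ?thesis by (intro bexI[of _ p]) (auto simp: Z_def)
    qed
    have inbox: "b i \<le> w l i" "w l i < b i + int R" if "w \<in> X" "(l, i) \<in> Idx" for w l i
    proof -
      have "w l \<in> G" using that by (auto simp: X_def Idx_def)
      then have "w l \<in> PiE {..<n} (\<lambda>i. {b i..<b i + int R})" using box by blast
      then have "w l i \<in> {b i..<b i + int R}" using that(2) by (auto simp: Idx_def PiE_iff)
      then show "b i \<le> w l i" "w l i < b i + int R" by auto
    qed
    have ZR: "Z x' < R" if x': "x' \<in> X" for x'
    proof -
      obtain l i where p: "(l, i) \<in> Idx" "int (Z x') = \<bar>z x' (l, i)\<bar>" using Zat[of x'] by auto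
      then have "int (Z x') < int R" using inbox[OF x p(1)] inbox[OF x' p(1)] by (auto simp: z_def)
      then show ?thesis by simp
    qed
    have Z1: "1 \<le> Z x'" if x': "x' \<in> X" "x' \<noteq> x" for x'
    proof (rule ccontr)
      assume "\<not> 1 \<le> Z x'"
      then have eq: "x l i = x' l i" if "l < m" "i < n" for l i
        using Zge[of "(l, i)" x'] that by (auto simp: z_def Idx_def)
      have "x l = x' l" if "l < m" for l
      proof (rule PiE_ext)
        show "x l \<in> PiE {..<n} (\<lambda>i. {b i..<b i + int R})" "x' l \<in> PiE {..<n} (\<lambda>i. {b i..<b i + int R})"
          using x x' that box by (auto simp: X_def)
      qed (use eq that in auto)
      then have "x = x'" using x x'(1) unfolding X_def by (intro PiE_ext) auto
      then show False using x'(2) by simp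
    qed
    have cnt: "real (cnt x x') \<le> k * real (card Mat) * (1 / real (Z x') ^ N)"
      if x': "x' \<in> X - {x}" for x'
    proof -
      define Bad where "Bad = {a \<in> Rows. \<bar>\<Sum>p\<in>Idx. a p * z x' p\<bar> < int K * int R}"
      obtain p where p: "p \<in> Idx" "int (Z x') = \<bar>z x' p\<bar>" using Zat by blast
      have "int (card Bad) * int (Z x') \<le> (2 * int K + 1) * int R ^ card Idx"
        unfolding Bad_def Rows_def
        by (rule card_small_combinations[where z = "z x'", OF fin(1) p]) (use ZR[of x'] x' in auto)
      then have bad: "real (card Bad) * real (Z x') \<le> (2 * real K + 1) * real R ^ K"
      proof -
        assume "int (card Bad) * int (Z x') \<le> (2 * int K + 1) * int R ^ card Idx"
        then have "int (card Bad * Z x') \<le> int ((2 * K + 1) * R ^ K)" by (simp add: K(2) algebra_simps)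
        then have "card Bad * Z x' \<le> (2 * K + 1) * R ^ K" by (simp only: of_nat_le_iff)
        then have "real (card Bad * Z x') \<le> real ((2 * K + 1) * R ^ K)" by (simp only: of_nat_le_iff)
        then show ?thesis by (simp add: algebra_simps)
      qed
      \<comment> \<open>Forms in the same cell differ by less than \<open>K * R\<close>. The rows
        vary independently, so the bound for one row enters with the power \<open>N\<close>.\<close>
      have "{A \<in> Mat. cell A x = cell A x'} \<subseteq> PiE {..<N} (\<lambda>_. Bad)"
      proof
        fix A assume A: "A \<in> {A \<in> Mat. cell A x = cell A x'}"
        have "A j \<in> Bad" if j: "j < N" for j
        proof -
          have "A j \<in> Rows" using A j by (auto simp: Mat_def)
          have "cell A x j = cell A x' j" using A by simp
          then have "lin_form m n b (A j) x div (int K * int R) = lin_form m n b (A j) x' div (int K * int R)"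
            using j by (simp add: cell_def)
          moreover have "\<bar>u - v\<bar> < c" if "u div c = v div c" "c > 0" for u v c :: int
          proof -
            have "u = c * (v div c) + u mod c" "v = c * (v div c) + v mod c"
              using that(1) by (metis mult_div_mod_eq)+
            moreover have "0 \<le> u mod c" "u mod c < c" "0 \<le> v mod c" "v mod c < c" using that(2) by auto
            ultimately show ?thesis by linarith
          qed
          ultimately have "\<bar>lin_form m n b (A j) x - lin_form m n b (A j) x'\<bar> < int K * int R"
            using K R by simp
          moreover have "lin_form m n b (A j) x - lin_form m n b (A j) x' = (\<Sum>p\<in>Idx. A j p * z x' p)"
            unfolding lin_form_def Idx_def[symmetric] sum_subtractf[symmetric] z_def
            by (intro sum.cong) (auto simp: algebra_simps)
          ultimately show ?thesis using \<open>A j \<in> Rows\<close> by (simp add: Bad_def)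
        qed
        moreover have "A \<in> extensional {..<N}" using A by (auto simp: Mat_def PiE_def)
        ultimately show "A \<in> PiE {..<N} (\<lambda>_. Bad)" by (auto simp: PiE_def)
      qed
      moreover have "finite Bad" using fin(3) by (simp add: Bad_def)
      ultimately have "cnt x x' \<le> card (PiE {..<N} (\<lambda>_. Bad))"
        unfolding cnt_def by (intro card_mono finite_PiE) auto
      then have "cnt x x' \<le> card Bad ^ N" by (simp add: card_PiE)
      then have "real (cnt x x') \<le> real (card Bad ^ N)" by (simp only: of_nat_le_iff)
      then have "real (cnt x x') * real (Z x') ^ N \<le> (real (card Bad) * real (Z x')) ^ N"
        by (simp add: power_mult_distrib mult_right_mono)
      also have "\<dots> \<le> ((2 * real K + 1) * real R ^ K) ^ N" by (intro power_mono bad) auto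
      also have "\<dots> = k * real (card Mat)" by (simp add: k_def cM power_mult_distrib)
      finally show ?thesis using Z1[of x'] x' by (simp add: field_simps)
    qed
    have "(\<Sum>x'\<in>X - {x}. 1 / real (Z x') ^ N) \<le> C * 4 ^ (N + 1) * (2 * real R)"
    proof (rule dyadic_sum_bound)
      fix \<rho> :: nat assume \<rho>: "1 \<le> \<rho>"
      \<comment> \<open>The offset 1 places all integers at distance less than \<open>\<rho>\<close>
        into a half-open cube of side \<open>2 * \<rho>\<close>; this is the 2 in
        \<open>dyadic_sum_bound\<close>.\<close>
      define Y where "Y l = {y \<in> G. \<forall>i<n. x l i - int \<rho> + 1 \<le> y i \<and> y i < x l i - int \<rho> + 1 + int (2 * \<rho>)}" for l
      define B where "B = C * real (2 * \<rho>) ^ (N + 1)"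
      have finY: "finite (Y l)" for l using G by (simp add: Y_def)
      have "{x' \<in> X - {x}. Z x' < \<rho>} \<subseteq> PiE {..<m} Y"
      proof
        fix x' assume x': "x' \<in> {x' \<in> X - {x}. Z x' < \<rho>}"
        have "x' l \<in> Y l" if l: "l < m" for l
        proof -
          have "x' l \<in> G" using x' l by (auto simp: X_def)
          moreover have "\<bar>x l i - x' l i\<bar> < int \<rho>" if "i < n" for i
            using Zge[of "(l, i)" x'] l that x' by (auto simp: Idx_def z_def)
          ultimately show ?thesis unfolding Y_def by (fastforce simp: abs_less_iff)
        qed
        moreover have "x' \<in> extensional {..<m}" using x' by (auto simp: X_def PiE_def)
        ultimately show "x' \<in> PiE {..<m} Y" by (auto simp: PiE_def)
      qed
      then have "card {x' \<in> X - {x}. Z x' < \<rho>} \<le> card (PiE {..<m} Y)"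
        by (intro card_mono finite_PiE finY) auto
      also have "\<dots> = (\<Prod>l<m. card (Y l))" by (simp add: card_PiE)
      finally have "real (card {x' \<in> X - {x}. Z x' < \<rho>}) \<le> real (\<Prod>l<m. card (Y l))"
        by (simp only: of_nat_le_iff)
      then have le: "real (card {x' \<in> X - {x}. Z x' < \<rho>}) \<le> (\<Prod>l<m. real (card (Y l)))"
        by simp
      have Ym: "real (card (Y l)) ^ m \<le> B" for l
      proof -
        have "card (Y l) ^ m * R ^ (N + 1) \<le> card G ^ m * (2 * \<rho>) ^ (N + 1)"
          unfolding Y_def using frost[of "2 * \<rho>" "\<lambda>i. x l i - int \<rho> + 1"] \<rho> by simp
        then have "real (card (Y l) ^ m * R ^ (N + 1)) \<le> real (card X * (2 * \<rho>) ^ (N + 1))"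
          unfolding cX by (simp only: of_nat_le_iff)
        then have "real (card (Y l)) ^ m * real R ^ (N + 1) \<le> real (card X) * real (2 * \<rho>) ^ (N + 1)"
          by (simp only: of_nat_mult of_nat_power)
        then show ?thesis using R by (simp add: B_def C_def field_simps)
      qed
      have B0: "0 \<le> B" using C1 by (simp add: B_def)
      \<comment> \<open>\<open>frost\<close> bounds the m-th power of each count, so the product of
        the \<open>m\<close> counts is compared through its own m-th power.\<close>
      have "(\<Prod>l<m. real (card (Y l))) ^ m = (\<Prod>l<m. real (card (Y l)) ^ m)" by (simp add: prod_power_distrib)
      also have "\<dots> \<le> (\<Prod>l<m. B)" by (intro prod_mono) (use Ym in auto)
      also have "\<dots> = B ^ m" by simp
      finally have pm: "(\<Prod>l<m. real (card (Y l))) ^ m \<le> B ^ m" .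
      have "0 \<le> (\<Prod>l<m. real (card (Y l)))" by (rule prod_nonneg) simp
      then have "(\<Prod>l<m. real (card (Y l))) \<le> B"
        using power_mono_iff[of "\<Prod>l<m. real (card (Y l))" B m] B0 m pm by blast
      then show "real (card {x' \<in> X - {x}. Z x' < \<rho>}) \<le> C * real (2 * \<rho>) ^ (N + 1)"
        using le by (simp add: B_def)
    qed (use fin ZR Z1 in auto)
    then have "(\<Sum>x'\<in>X - {x}. real (cnt x x')) \<le> k * real (card Mat) * (C * 4 ^ (N + 1) * (2 * real R))"
    proof -
      assume s: "(\<Sum>x'\<in>X - {x}. 1 / real (Z x') ^ N) \<le> C * 4 ^ (N + 1) * (2 * real R)"
      have "(\<Sum>x'\<in>X - {x}. real (cnt x x')) \<le> (\<Sum>x'\<in>X - {x}. k * real (card Mat) * (1 / real (Z x') ^ N))"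
        by (intro sum_mono cnt)
      also have "\<dots> = k * real (card Mat) * (\<Sum>x'\<in>X - {x}. 1 / real (Z x') ^ N)"
        by (rule sum_distrib_left[symmetric])
      also have "\<dots> \<le> k * real (card Mat) * (C * 4 ^ (N + 1) * (2 * real R))"
        using k1 by (intro mult_left_mono s) auto
      finally show ?thesis .
    qed
    moreover have "real (cnt x x) \<le> k * real (card Mat) * (C * real R)"
    proof -
      have "real (cnt x x) = 1 * real (card Mat) * 1" by (simp add: cnt_def)
      also have "\<dots> \<le> k * real (card Mat) * (C * real R)"
        using k1 C1 R by (intro mult_mono mult_ge1_I) auto
      finally show ?thesis .
    qed
    moreover have "(\<Sum>x'\<in>X. real (cnt x x')) = real (cnt x x) + (\<Sum>x'\<in>X - {x}. real (cnt x x'))"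
      using fin(2) x by (simp add: sum.remove)
    ultimately show ?thesis by (simp add: algebra_simps)
  qed
  define W where "W = real (card X) * (k * (C * real R) * (1 + 2 * 4 ^ (N + 1)))"
  define coll where "coll A = card {(x, x') \<in> X \<times> X. cell A x = cell A x'}" for A
  have "(\<Sum>A\<in>Mat. real (coll A)) = (\<Sum>A\<in>Mat. \<Sum>q\<in>X \<times> X. if cell A (fst q) = cell A (snd q) then 1 else 0)"
  proof (rule sum.cong)
    fix A
    have "{(x, x') \<in> X \<times> X. cell A x = cell A x'} = {q \<in> X \<times> X. cell A (fst q) = cell A (snd q)}" by auto
    then show "real (coll A) = (\<Sum>q\<in>X \<times> X. if cell A (fst q) = cell A (snd q) then 1 else 0)"
      using fin(2) unfolding coll_def by (simp add: sum.If_cases Int_def)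
  qed simp
  also have "\<dots> = (\<Sum>q\<in>X \<times> X. \<Sum>A\<in>Mat. if cell A (fst q) = cell A (snd q) then 1 else 0)"
    by (rule sum.swap)
  also have "\<dots> = (\<Sum>q\<in>X \<times> X. real (cnt (fst q) (snd q)))"
    using fin(4) by (intro sum.cong) (auto simp: cnt_def sum.If_cases Int_def)
  also have "\<dots> = (\<Sum>x\<in>X. \<Sum>x'\<in>X. real (cnt x x'))"
    by (simp add: sum.cartesian_product case_prod_unfold)
  also have "\<dots> \<le> (\<Sum>x\<in>X. k * real (card Mat) * (C * real R) * (1 + 2 * 4 ^ (N + 1)))"
    by (intro sum_mono row)
  also have "\<dots> = real (card Mat) * W" by (simp add: W_def)
  finally have tot: "(\<Sum>A\<in>Mat. real (coll A)) \<le> real (card Mat) * W" .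
  \<comment> \<open>Some matrix has at most the average number of collisions.\<close>
  have "\<exists>A\<in>Mat. real (coll A) \<le> W"
  proof (rule ccontr)
    assume "\<not> ?thesis"
    then have "W < real (coll A)" if "A \<in> Mat" for A using that by (simp add: not_le)
    then have "(\<Sum>A\<in>Mat. W) < (\<Sum>A\<in>Mat. real (coll A))"
      using fin(4) Mpos by (intro sum_strict_mono) auto
    then show False using tot by simp
  qed
  then obtain A where A: "A \<in> Mat" "real (coll A) \<le> W" by blast
  have "(card X)\<^sup>2 \<le> card (cell A ` X) * coll A"
    unfolding coll_def by (rule card_square_le_collisions[OF fin(2)])
  then have "real ((card X)\<^sup>2) \<le> real (card (cell A ` X) * coll A)" by (simp only: of_nat_le_iff)
  then have "real (card X) ^ 2 \<le> real (card (cell A ` X)) * real (coll A)" by simp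
  also have "\<dots> \<le> real (card (cell A ` X)) * W" using A(2) by (intro mult_left_mono) auto
  also have "\<dots> = real (card X) ^ 2 * (real (card (cell A ` X)) * (k * (1 + 2 * 4 ^ (N + 1))) / real R ^ N)"
    using R by (simp add: W_def C_def field_simps power2_eq_square)
  finally have *: "real (card X) ^ 2 * 1 \<le> real (card X) ^ 2 * (real (card (cell A ` X)) * (k * (1 + 2 * 4 ^ (N + 1))) / real R ^ N)"
    by simp
  have "0 < R ^ (N + 1)" using R by simp
  then have "card X > 0" using big unfolding cX by (rule less_le_trans)
  then have "real (card X) ^ 2 > 0" by simp
  from mult_le_cancel_left_pos[THEN iffD1, OF this *]
  have "1 \<le> real (card (cell A ` X)) * (k * (1 + 2 * 4 ^ (N + 1))) / real R ^ N" .
  then have "real R ^ N \<le> k * (1 + 2 * 4 ^ (N + 1)) * real (card (cell A ` X))"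
    using R by (simp add: field_simps)
  then show ?thesis
    using that[of A] A(1) unfolding Mat_def Rows_def Idx_def cell_def X_def k_def K_def by simp
qed

section \<open>Linear images of zoomed products\<close>

lemma zoom:
  fixes F :: "(nat \<Rightarrow> int) set" and n m N L :: nat
  defines "cube \<equiv> \<lambda>c \<rho>. {y \<in> F. \<forall>i<n. c i \<le> y i \<and> y i < c i + int \<rho>}"
  assumes F: "finite F" and L: "L \<ge> 1" "cube b0 L = F"
  obtains b R where "R \<ge> 1"
    "\<forall>c \<rho>. \<rho> \<ge> 1 \<longrightarrow> card (cube c \<rho>) ^ m * R ^ (N + 1) \<le> card (cube b R) ^ m * \<rho> ^ (N + 1)"
proof -
  define V where "V = {(card (cube c \<rho>), \<rho>) |c \<rho>. 1 \<le> \<rho> \<and> \<rho> \<le> L}"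
  \<comment> \<open>A cube maximizing this density is Frostman relative to itself. Maximizing over
    sides up to \<open>L\<close> is enough, since a cube with longer side is no denser than
    \<open>F\<close> in its cube of side \<open>L\<close>.\<close>
  define h :: "nat \<times> nat \<Rightarrow> real" where "h p = real (fst p) ^ m / real (snd p) ^ (N + 1)" for p
  have le: "card (cube c \<rho>) \<le> card F" for c \<rho> using F unfolding cube_def by (intro card_mono) auto
  then have "V \<subseteq> {..card F} \<times> {..L}" by (auto simp: V_def)
  then have "finite V" by (rule finite_subset) auto
  moreover have VF: "(card F, L) \<in> V" unfolding V_def using L by (auto intro!: exI[of _ b0])
  ultimately obtain p where p: "p \<in> V" "\<And>q. q \<in> V \<Longrightarrow> h q \<le> h p"
    using Max_in[of "h ` V"] Max_ge[of "h ` V"] by (metis (no_types, lifting) empty_iff finite_imageI image_iff)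
  then obtain b R where R: "p = (card (cube b R), R)" "1 \<le> R" "R \<le> L" by (auto simp: V_def)
  have "card (cube c \<rho>) ^ m * R ^ (N + 1) \<le> card (cube b R) ^ m * \<rho> ^ (N + 1)" if \<rho>: "\<rho> \<ge> 1" for c \<rho>
  proof -
    have "h (card (cube c \<rho>), \<rho>) \<le> h p"
    proof (cases "\<rho> \<le> L")
      case True
      then show ?thesis using p(2) \<rho> by (auto simp: V_def)
    next
      case False
      have "h (card (cube c \<rho>), \<rho>) \<le> h (card F, L)" unfolding h_def fst_conv snd_conv
        using False L(1) le[of c \<rho>] by (intro frac_le power_mono) auto
      then show ?thesis using p(2)[OF VF] by simp
    qed
    then have "real (card (cube c \<rho>)) ^ m * real R ^ (N + 1) \<le> real (card (cube b R)) ^ m * real \<rho> ^ (N + 1)"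
      using \<rho> R by (simp add: h_def divide_le_eq le_divide_eq field_simps)
    then have "real (card (cube c \<rho>) ^ m * R ^ (N + 1)) \<le> real (card (cube b R) ^ m * \<rho> ^ (N + 1))"
      by simp
    then show ?thesis by (simp only: of_nat_le_iff)
  qed
  then show ?thesis using that R(2) by blast
qed

text \<open>Turns the number of cells hit into a measure: the half-open cubes of side
  \<open>1 / R\<close> are disjoint and lie in the unit cube.\<close>

lemma emeasure_cells:
  fixes Q :: "(nat \<Rightarrow> int) set"
  assumes R: "R > 0" and Q: "Q \<subseteq> PiE {..<N} (\<lambda>_. {0..<int R})"
  defines "H \<equiv> {v :: nat \<Rightarrow> real. \<exists>\<kappa>\<in>Q. \<forall>j<N. of_int (\<kappa> j) \<le> real R * v j \<and> real R * v j < of_int (\<kappa> j) + 1}"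
  shows "H \<in> sets seqm" "emeasure seqm H = ennreal (real (card Q) / real R ^ N)"
proof -
  define cell where "cell \<kappa> = {v :: nat \<Rightarrow> real. \<forall>j<N. v j \<in> {of_int (\<kappa> j) / real R..<(of_int (\<kappa> j) + 1) / real R}}"
    for \<kappa> :: "nat \<Rightarrow> int"
  have eq: "H = (\<Union>\<kappa>\<in>Q. cell \<kappa>)"
    using R by (auto simp: H_def cell_def divide_le_eq less_divide_eq mult.commute)
  have "finite (PiE {..<N} (\<lambda>_. {0..<int R}))" by (intro finite_PiE) auto
  then have finQ: "finite Q" using Q finite_subset by blast
  have emb: "cell \<kappa> = prod_emb UNIV (\<lambda>_. unif) {..<N}
      (PiE {..<N} (\<lambda>j. {of_int (\<kappa> j) / real R..<(of_int (\<kappa> j) + 1) / real R}))" for \<kappa>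
    using sets_eq_imp_space_eq[OF sets_unif]
    by (auto simp: cell_def prod_emb_def PiE_iff)
  have meas: "cell \<kappa> \<in> sets seqm" for \<kappa>
    unfolding emb seqm_def by (rule sets_PiM_I) (auto simp: sets_unif)
  then show "H \<in> sets seqm" unfolding eq using finQ by (intro sets.finite_UN) auto
  have cell: "emeasure seqm (cell \<kappa>) = ennreal ((1 / real R) ^ N)" if \<kappa>: "\<kappa> \<in> Q" for \<kappa>
  proof -
    have "emeasure seqm (cell \<kappa>) =
        (\<Prod>j<N. emeasure unif {of_int (\<kappa> j) / real R..<(of_int (\<kappa> j) + 1) / real R})"
      unfolding emb seqm_def by (rule seqm.emeasure_PiM_emb) (auto simp: sets_unif)
    also have "\<dots> = (\<Prod>j<N. ennreal (1 / real R))"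
    proof (rule prod.cong)
      fix j assume "j \<in> {..<N}"
      then have j: "\<kappa> j \<in> {0..<int R}" using \<kappa> Q by blast
      then have b: "0 \<le> of_int (\<kappa> j) / real R" "(of_int (\<kappa> j) + 1) / real R \<le> 1"
        using R by (auto simp: divide_le_eq)
      have "{0..1} \<inter> {of_int (\<kappa> j) / real R..<(of_int (\<kappa> j) + 1) / real R} =
          {of_int (\<kappa> j) / real R..<(of_int (\<kappa> j) + 1) / real R}" using b by auto
      then show "emeasure unif {of_int (\<kappa> j) / real R..<(of_int (\<kappa> j) + 1) / real R} = ennreal (1 / real R)"
        using R by (simp add: emeasure_unif divide_right_mono diff_divide_distrib[symmetric])
    qed simp
    also have "\<dots> = ennreal ((1 / real R) ^ N)" using R by (simp add: ennreal_power)
    finally show ?thesis .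
  qed
  have disj: "disjoint_family_on cell Q"
    unfolding disjoint_family_on_def
  proof (intro ballI impI)
    fix \<kappa> \<kappa>' assume k: "\<kappa> \<in> Q" "\<kappa>' \<in> Q" "\<kappa> \<noteq> \<kappa>'"
    have False if v: "v \<in> cell \<kappa>" "v \<in> cell \<kappa>'" for v
    proof -
      have fl: "\<mu> j = \<lfloor>real R * v j\<rfloor>" if "v \<in> cell \<mu>" "j < N" for \<mu> j
      proof -
        have "v j \<in> {of_int (\<mu> j) / real R..<(of_int (\<mu> j) + 1) / real R}" using that by (simp add: cell_def)
        then have "of_int (\<mu> j) \<le> real R * v j" "real R * v j < of_int (\<mu> j) + 1"
          using R by (auto simp: divide_le_eq less_divide_eq mult.commute)
        then show ?thesis by linarith
      qed
      have "\<kappa> = \<kappa>'"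
      proof (rule PiE_ext)
        show "\<kappa> \<in> PiE {..<N} (\<lambda>_. {0..<int R})" "\<kappa>' \<in> PiE {..<N} (\<lambda>_. {0..<int R})" using k Q by auto
        show "\<kappa> j = \<kappa>' j" if "j \<in> {..<N}" for j using fl[OF v(1)] fl[OF v(2)] that by simp
      qed
      then show False using k by simp
    qed
    then show "cell \<kappa> \<inter> cell \<kappa>' = {}" by blast
  qed
  have "emeasure seqm H = (\<Sum>\<kappa>\<in>Q. emeasure seqm (cell \<kappa>))"
    unfolding eq using meas finQ disj by (intro sum_emeasure[symmetric]) auto
  also have "\<dots> = of_nat (card Q) * ennreal ((1 / real R) ^ N)" by (simp add: cell)
  also have "\<dots> = ennreal (real (card Q) * (1 / real R) ^ N)"
    by (simp add: ennreal_of_nat_eq_real_of_nat ennreal_mult'')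
  also have "\<dots> = ennreal (real (card Q) / real R ^ N)" by (simp add: power_divide)
  finally show "emeasure seqm H = ennreal (real (card Q) / real R ^ N)" .
qed

section \<open>Closures of definable predicates\<close>

lemma closure_seq_iff:
  assumes "finite I" "depends_on I P"
  shows "v \<in> closure {v. P v} \<longleftrightarrow> (\<forall>e. e > 0 \<longrightarrow> (\<exists>w. P w \<and> (\<forall>i\<in>I. \<bar>w i - v i\<bar> < e)))"
proof
  assume v: "v \<in> closure {v. P v}"
  show "\<forall>e. e > 0 \<longrightarrow> (\<exists>w. P w \<and> (\<forall>i\<in>I. \<bar>w i - v i\<bar> < e))"
  proof (intro allI impI)
    fix e :: real assume "e > 0"
    have "open {w. \<forall>i\<in>I. \<bar>w i - v i\<bar> < e}" by (rule open_seq_box[OF assms(1)])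
    moreover have "v \<in> {w. \<forall>i\<in>I. \<bar>w i - v i\<bar> < e}" using \<open>e > 0\<close> by simp
    ultimately have "{w. \<forall>i\<in>I. \<bar>w i - v i\<bar> < e} \<inter> {v. P v} \<noteq> {}"
      using v open_Int_closure_eq_empty by blast
    then show "\<exists>w. P w \<and> (\<forall>i\<in>I. \<bar>w i - v i\<bar> < e)" by blast
  qed
next
  assume R: "\<forall>e. e > 0 \<longrightarrow> (\<exists>w. P w \<and> (\<forall>i\<in>I. \<bar>w i - v i\<bar> < e))"
  show "v \<in> closure {v. P v}"
  proof (rule ccontr)
    assume "v \<notin> closure {v. P v}"
    then have "v \<in> - closure {v. P v}" "open (- closure {v. P v})" by auto
    then obtain J e where J: "finite J" "e > 0"
      "\<And>w. (\<And>i. i \<in> J \<Longrightarrow> \<bar>w i - v i\<bar> < e) \<Longrightarrow> w \<in> - closure {v. P v}"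
      using open_seq_contains_box by metis
    obtain w where w: "P w" "\<forall>i\<in>I. \<bar>w i - v i\<bar> < e" using R J(2) by blast
    have "override_on v w I \<in> - closure {v. P v}"
      using w(2) J(2) by (intro J(3)) (auto simp: override_on_def)
    moreover have "P (override_on v w I)" using w(1) depends_onD[OF assms(2), of "override_on v w I" w] by simp
    ultimately show False using closure_subset[of "{v. P v}"] by auto
  qed
qed

text \<open>Approximation in the finitely many relevant coordinates characterizes the closure, and a
  formula can express it.\<close>

lemma dpred_closure:
  assumes "dpred M P"
  shows "dpred M (\<lambda>v. v \<in> closure {v. P v})"
proof -
  obtain I where I: "finite I" "depends_on I P" using dpred_depends_on[OF assms] by blast
  show ?thesis unfolding closure_seq_iff[OF I]
    by (intro dpred_all dpred_imp dpred_less dterm_intros dpred_exs dpred2_def[THEN iffD2] dpred_conj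
        dpred_subst[OF assms] dpred_fin_all I(1) dpred_abs_less dterm_evens_odds)
qed

text \<open>The data \<open>x\<^sub>0, \<dots>, x\<^sub>m\<^sub>-\<^sub>1, b, r\<close> are stored consecutively in the sequence \<open>y\<close>.\<close>

definition lin_rel ::
  "nat \<Rightarrow> nat \<Rightarrow> nat \<Rightarrow> (nat \<times> nat \<times> nat \<Rightarrow> real) \<Rightarrow> (nat \<Rightarrow> real) \<Rightarrow> (nat \<Rightarrow> real) \<Rightarrow> bool" where
  "lin_rel n m N \<theta> v y \<longleftrightarrow> (\<forall>j<N. v j * y (m * n + n) =
     (\<Sum>p\<in>{..<m} \<times> {..<n}. \<theta> (j, p) * (y (fst p * n + snd p) - y (m * n + snd p))))"

context i_minimal_expansion
begin

text \<open>Coordinates are counted. From an interior, \<open>section_dimension\<close> would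
  produce \<open>N\<close> coordinates of the data \<open>y\<close> whose projection has interior.
  At most \<open>n + 1\<close> of them belong to \<open>b\<close> and \<open>r\<close>, so more than
  \<open>m * d\<close> are spread over the \<open>m\<close> copies of \<open>C\<close>, and one copy
  receives more than \<open>d\<close>, against \<open>dim\<close>.\<close>

lemma linear_image_no_interior:
  fixes C :: "(nat \<Rightarrow> real) \<Rightarrow> bool" and d :: nat
  assumes C: "dpred M C" "depends_on {..<n} C" "closed {v. C v}"
    and B: "\<And>v i. C v \<Longrightarrow> i < n \<Longrightarrow> \<bar>v i\<bar> \<le> B"
    and dim: "\<And>A. A \<subseteq> {..<n} \<Longrightarrow> d < card A \<Longrightarrow> interior {u. \<exists>v. C v \<and> (\<forall>a\<in>A. v a = u a)} = {}"
    and N: "N = m * d + n + 2"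
  shows "interior {v. \<exists>y. (\<forall>l<m. C (\<lambda>i. y (l * n + i))) \<and> y (m * n + n) > 0 \<and> lin_rel n m N \<theta> v y} = {}"
    (is "interior {v. ?W v} = {}")
proof (rule ccontr)
  assume ne: "interior {v. ?W v} \<noteq> {}"
  \<comment> \<open>Truncation to bounded data. Keeping \<open>r\<close> between
    \<open>1 / t\<close> and \<open>t\<close> replaces the open condition \<open>r > 0\<close> by a
    closed one. By Baire a single \<open>t\<close> covers an open set of \<open>v\<close>.\<close>
  define P where "P t y \<longleftrightarrow> (\<forall>l<m. C (\<lambda>i. y (l * n + i))) \<and> (\<forall>i<n. \<bar>y (m * n + i)\<bar> \<le> real t) \<and>
      1 \<le> y (m * n + n) * real t \<and> y (m * n + n) \<le> real t" for t :: nat and y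
  define Y where "Y t v y \<longleftrightarrow> P t y \<and> lin_rel n m N \<theta> v y" for t v y
  have Ydp: "dpred2 M (Y t)" for t
    unfolding Y_def P_def lin_rel_def
    by (intro dpred2_def[THEN iffD2] dpred_conj dpred_all_less dpred_subst[OF C(1)] dpred_abs_le dpred_le dpred_eq
        dterm_evens_odds dterm_intros)
  have cover: "\<exists>t\<in>(UNIV :: nat set). \<exists>y. Y t v y" if "v \<in> interior {v. ?W v}" for v
  proof -
    have "?W v" using that interior_subset by blast
    then obtain y where y: "\<And>l. l < m \<Longrightarrow> C (\<lambda>i. y (l * n + i))" "y (m * n + n) > 0" "lin_rel n m N \<theta> v y"
      by blast
    define T where "T = (\<Sum>i<n. \<bar>y (m * n + i)\<bar>) + y (m * n + n) + 1 / y (m * n + n)"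
    obtain t :: nat where t: "T \<le> real t" using real_arch_simple by blast
    have s0: "0 \<le> (\<Sum>i<n. \<bar>y (m * n + i)\<bar>)" by (intro sum_nonneg) auto
    have r0: "0 < 1 / y (m * n + n)" using y(2) by simp
    have "\<bar>y (m * n + i)\<bar> \<le> real t" if "i < n" for i
    proof -
      have "\<bar>y (m * n + i)\<bar> \<le> (\<Sum>i<n. \<bar>y (m * n + i)\<bar>)"
        by (rule member_le_sum[of i _ "\<lambda>i. \<bar>y (m * n + i)\<bar>"]) (use that in auto)
      then show ?thesis using t r0 y(2) unfolding T_def by linarith
    qed
    moreover have "y (m * n + n) \<le> real t" using t s0 r0 unfolding T_def by linarith
    moreover have "1 \<le> y (m * n + n) * real t"
    proof -
      have "1 / y (m * n + n) \<le> real t" using t s0 y(2) unfolding T_def by linarith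
      then show ?thesis using y(2) by (simp add: divide_le_eq mult.commute)
    qed
    ultimately have "Y t v y" using y by (simp add: Y_def P_def)
    then show ?thesis by blast
  qed
  have "dpred M (\<lambda>v. \<exists>y. Y t v y)" for t by (rule dpred_exs[OF Ydp])
  with cover obtain t :: nat and V where "t \<in> UNIV" "V \<subseteq> interior {v. ?W v}" and V: "open V" "V \<noteq> {}" "\<forall>v\<in>V. \<exists>y. Y t v y"
    by (rule dpred_countable_union[OF countableI_type open_interior ne])
  define J where "J = {..<m * n + n + 1}"
  have idx: "l * n + i < m * n" if "l < m" "i < n" for l i
  proof -
    have "l * n + i < Suc l * n" using that(2) by simp
    also have "\<dots> \<le> m * n" using that(1) by (intro mult_le_mono1) simp
    finally show ?thesis .
  qed
  have "\<exists>A\<subseteq>J. card A = card {..<N} \<and> interior {u. \<exists>v y. Y t v y \<and> (\<forall>a\<in>A. y a = u a)} \<noteq> {}"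
  proof (rule section_dimension[where V = V and B = "max B (real t)"])
    show "dpred2 M (Y t)" by (rule Ydp)
    have co: "continuous_on UNIV (\<lambda>x :: (nat \<Rightarrow> real) \<times> (nat \<Rightarrow> real). snd x i)"
      "continuous_on UNIV (\<lambda>x :: (nat \<Rightarrow> real) \<times> (nat \<Rightarrow> real). fst x i)" for i
    proof -
      show "continuous_on UNIV (\<lambda>x :: (nat \<Rightarrow> real) \<times> (nat \<Rightarrow> real). snd x i)"
        by (rule continuous_on_product_then_coordinatewise[of UNIV snd])
          (intro continuous_on_snd continuous_on_id)
      show "continuous_on UNIV (\<lambda>x :: (nat \<Rightarrow> real) \<times> (nat \<Rightarrow> real). fst x i)"
        by (rule continuous_on_product_then_coordinatewise[of UNIV fst])
          (intro continuous_on_fst continuous_on_id)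
    qed
    have "closed {x :: (nat \<Rightarrow> real) \<times> (nat \<Rightarrow> real). C (\<lambda>i. snd x (l * n + i))}" for l
    proof -
      have "continuous_on UNIV (\<lambda>x :: (nat \<Rightarrow> real) \<times> (nat \<Rightarrow> real). (\<lambda>i. snd x (l * n + i)))"
        by (intro continuous_on_coordinatewise_then_product co)
      from closed_vimage[OF C(3) this] show ?thesis by (simp add: vimage_def)
    qed
    then have "closed {x :: (nat \<Rightarrow> real) \<times> (nat \<Rightarrow> real).
        (\<forall>l<m. C (\<lambda>i. snd x (l * n + i))) \<and> (\<forall>i<n. \<bar>snd x (m * n + i)\<bar> \<le> real t) \<and>
        1 \<le> snd x (m * n + n) * real t \<and> snd x (m * n + n) \<le> real t \<and>
        (\<forall>j<N. fst x j * snd x (m * n + n) =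
          (\<Sum>p\<in>{..<m} \<times> {..<n}. \<theta> (j, p) * (snd x (fst p * n + snd p) - snd x (m * n + snd p))))}"
      by (intro closed_Collect_conj closed_Collect_all closed_Collect_imp open_Collect_const
          closed_Collect_le closed_Collect_eq continuous_on_mult continuous_on_sum continuous_on_diff
          continuous_on_rabs continuous_on_const co)
    then show "closed {(v, y). Y t v y}"
      by (simp add: case_prod_unfold Y_def P_def lin_rel_def conj_assoc)
    show "Y t v' y'" if "\<forall>i\<in>{..<N}. v i = v' i" "\<forall>j\<in>J. y j = y' j" and Yvy: "Y t v y" for v v' y y'
    proof -
      have v: "\<And>j. j < N \<Longrightarrow> v' j = v j" and y: "\<And>j. j < m * n + n + 1 \<Longrightarrow> y' j = y j"
        using that by (auto simp: J_def)
      have yb: "y' (l * n + i) = y (l * n + i)" if "l < m" "i < n" for l i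
        using idx[OF that] by (intro y) simp
      have "C (\<lambda>i. y' (l * n + i)) = C (\<lambda>i. y (l * n + i))" if "l < m" for l
        by (rule depends_onD[OF C(2)]) (use yb that in auto)
      moreover have "lin_rel n m N \<theta> v' y' = lin_rel n m N \<theta> v y"
        unfolding lin_rel_def
      proof (intro all_cong1 imp_cong refl)
        fix j assume "j < N"
        then have "v' j * y' (m * n + n) = v j * y (m * n + n)" using v y by simp
        moreover have "(\<Sum>p\<in>{..<m} \<times> {..<n}. \<theta> (j, p) * (y' (fst p * n + snd p) - y' (m * n + snd p))) =
            (\<Sum>p\<in>{..<m} \<times> {..<n}. \<theta> (j, p) * (y (fst p * n + snd p) - y (m * n + snd p)))"
          by (intro sum.cong refl) (auto simp: yb y)
        ultimately show "(v' j * y' (m * n + n) = (\<Sum>p\<in>{..<m} \<times> {..<n}. \<theta> (j, p) * (y' (fst p * n + snd p) - y' (m * n + snd p)))) =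
            (v j * y (m * n + n) = (\<Sum>p\<in>{..<m} \<times> {..<n}. \<theta> (j, p) * (y (fst p * n + snd p) - y (m * n + snd p))))"
          by simp
      qed
      ultimately show ?thesis using Yvy y by (auto simp: Y_def P_def)
    qed
    show "\<bar>y j\<bar> \<le> max B (real t)" if Yvy: "Y t v y" and j: "j \<in> J" for v y j
    proof -
      have r: "0 \<le> y (m * n + n)"
      proof (rule ccontr)
        assume "\<not> ?thesis"
        then have "y (m * n + n) * real t \<le> 0" by (intro mult_nonpos_nonneg) auto
        then show False using Yvy by (simp add: Y_def P_def)
      qed
      consider "j < m * n" | i where "j = m * n + i" "i < n" | "j = m * n + n"
        using j by (cases "j < m * n"; cases "j < m * n + n") (auto simp: J_def, metis add_diff_inverse_nat nat_add_left_cancel_less)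
      then show ?thesis
      proof cases
        case 1
        then have n: "n > 0" by (cases n) auto
        define l where "l = j div n"
        have l: "l < m" "j = l * n + j mod n" using 1 n by (auto simp: l_def less_mult_imp_div_less)
        have "\<bar>(\<lambda>i. y (l * n + i)) (j mod n)\<bar> \<le> B"
          by (rule B) (use Yvy l n in \<open>auto simp: Y_def P_def\<close>)
        then show ?thesis using l(2) by simp
      next
        case 2
        then show ?thesis using Yvy by (auto simp: Y_def P_def)
      next
        case 3
        then show ?thesis using Yvy r by (auto simp: Y_def P_def)
      qed
    qed
    show "v i = v' i" if Yv: "Y t v y" "Y t v' y" and i: "i \<in> {..<N}" for v v' y i
    proof -
      have "y (m * n + n) \<noteq> 0" using Yv(1) by (auto simp: Y_def P_def)
      moreover have "v i * y (m * n + n) = v' i * y (m * n + n)"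
        using Yv i by (simp add: Y_def lin_rel_def)
      ultimately show ?thesis by simp
    qed
    show "\<exists>y. Y t v y" if "v \<in> V" for v using V(3) that by blast
  qed (use V in \<open>auto simp: J_def\<close>)
  then obtain A where A: "A \<subseteq> J" "card A = N" "interior {u. \<exists>v y. Y t v y \<and> (\<forall>a\<in>A. y a = u a)} \<noteq> {}"
    by auto
  define S where "S l = {i \<in> {..<n}. l * n + i \<in> A}" for l
  have "\<exists>l<m. d < card (S l)"
  proof (rule ccontr)
    assume "\<not> ?thesis"
    then have S: "card (S l) \<le> d" if "l < m" for l using that by (meson not_le)
    have "A \<subseteq> (\<Union>l<m. (\<lambda>i. l * n + i) ` S l) \<union> {m * n..<m * n + n + 1}"
    proof
      fix a assume a: "a \<in> A"
      show "a \<in> (\<Union>l<m. (\<lambda>i. l * n + i) ` S l) \<union> {m * n..<m * n + n + 1}"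
      proof (cases "a < m * n")
        case True
        then have n: "n > 0" by (cases n) auto
        have "a div n < m" "a = a div n * n + a mod n" "a mod n < n"
          using True n by (auto simp: less_mult_imp_div_less)
        then have "a mod n \<in> S (a div n)" using a by (simp add: S_def)
        then show ?thesis using \<open>a div n < m\<close> \<open>a = a div n * n + a mod n\<close> by blast
      qed (use a A(1) in \<open>auto simp: J_def\<close>)
    qed
    then have "card A \<le> card ((\<Union>l<m. (\<lambda>i. l * n + i) ` S l) \<union> {m * n..<m * n + n + 1})"
      by (intro card_mono) (auto simp: S_def)
    also have "\<dots> \<le> card (\<Union>l<m. (\<lambda>i. l * n + i) ` S l) + card {m * n..<m * n + n + 1}"
      by (rule card_Un_le)
    also have "card (\<Union>l<m. (\<lambda>i. l * n + i) ` S l) \<le> (\<Sum>l<m. card ((\<lambda>i. l * n + i) ` S l))"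
      by (rule card_UN_le) simp
    also have "(\<Sum>l<m. card ((\<lambda>i. l * n + i) ` S l)) \<le> (\<Sum>l<m. d)"
    proof (rule sum_mono)
      fix l assume "l \<in> {..<m}"
      have "card ((\<lambda>i. l * n + i) ` S l) \<le> card (S l)" by (rule card_image_le) (simp add: S_def)
      then show "card ((\<lambda>i. l * n + i) ` S l) \<le> d" using S[of l] \<open>l \<in> {..<m}\<close> by simp
    qed
    finally show False using A(2) N by simp
  qed
  then obtain l where l: "l < m" "d < card (S l)" by blast
  define O' where "O' = interior {u. \<exists>v y. Y t v y \<and> (\<forall>a\<in>A. y a = u a)}"
  have "open O'" by (simp add: O'_def)
  obtain u0 where "u0 \<in> O'" using A(3) by (auto simp: O'_def)
  with \<open>open O'\<close> obtain I1 e where I1: "finite I1" "e > 0"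
    "\<And>w. (\<And>i. i \<in> I1 \<Longrightarrow> \<bar>w i - u0 i\<bar> < e) \<Longrightarrow> w \<in> O'"
    using open_seq_contains_box by metis
  define D where "D = {w. \<forall>i\<in>S l. \<bar>w i - (\<lambda>i. u0 (l * n + i)) i\<bar> < e}"
  have "open D" unfolding D_def by (rule open_seq_box) (simp add: S_def)
  moreover have "(\<lambda>i. u0 (l * n + i)) \<in> D" using I1(2) by (simp add: D_def)
  moreover have "D \<subseteq> {u. \<exists>v. C v \<and> (\<forall>a\<in>S l. v a = u a)}"
  proof
    fix w assume w: "w \<in> D"
    define u where "u a = (if l * n \<le> a \<and> a - l * n \<in> S l then w (a - l * n) else u0 a)" for a
    have "u \<in> O'"
    proof (rule I1(3))
      fix a assume "a \<in> I1"
      show "\<bar>u a - u0 a\<bar> < e"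
      proof (cases "l * n \<le> a \<and> a - l * n \<in> S l")
        case True
        then have "\<bar>w (a - l * n) - u0 (l * n + (a - l * n))\<bar> < e" using w by (auto simp: D_def)
        then show ?thesis using True by (simp add: u_def)
      qed (use I1(2) in \<open>auto simp: u_def\<close>)
    qed
    then have "u \<in> {u. \<exists>v y. Y t v y \<and> (\<forall>a\<in>A. y a = u a)}" unfolding O'_def using interior_subset by blast
    then obtain v y where vy: "Y t v y" "\<And>a. a \<in> A \<Longrightarrow> y a = u a" by blast
    have "C (\<lambda>i. y (l * n + i))" using vy(1) l(1) by (simp add: Y_def P_def)
    moreover have "y (l * n + i) = w i" if "i \<in> S l" for i
      using vy(2)[of "l * n + i"] that by (auto simp: S_def u_def)
    ultimately show "w \<in> {u. \<exists>v. C v \<and> (\<forall>a\<in>S l. v a = u a)}" by blast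
  qed
  ultimately have "interior {u. \<exists>v. C v \<and> (\<forall>a\<in>S l. v a = u a)} \<noteq> {}"
    using interior_maximal[of D "{u. \<exists>v. C v \<and> (\<forall>a\<in>S l. v a = u a)}"] by blast
  then show False using dim[of "S l"] l(2) by (auto simp: S_def)
qed

end

section \<open>Box counting\<close>

definition lin_image ::
  "((nat \<Rightarrow> real) \<Rightarrow> bool) \<Rightarrow> nat \<Rightarrow> nat \<Rightarrow> nat \<Rightarrow> (nat \<times> nat \<times> nat \<Rightarrow> real) \<Rightarrow> (nat \<Rightarrow> real) \<Rightarrow> bool" where
  "lin_image C n m N \<theta> v \<longleftrightarrow>
     (\<exists>y. (\<forall>l<m. C (\<lambda>i. y (l * n + i))) \<and> y (m * n + n) > 0 \<and> lin_rel n m N \<theta> v y)"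

lemma lin_form_bounds:
  assumes "n > 0" "m > 0" "R > 0" "\<And>p. p \<in> {..<m} \<times> {..<n} \<Longrightarrow> a p \<in> {0..<int R}"
    "\<And>l i. l < m \<Longrightarrow> i < n \<Longrightarrow> x l i \<in> {b i..<b i + int R}"
  shows "lin_form m n b a x div (int (m * n) * int R) \<in> {0..<int R}"
proof -
  have tb: "0 \<le> a p * (x (fst p) (snd p) - b (snd p)) \<and> a p * (x (fst p) (snd p) - b (snd p)) \<le> int R * int R - 1"
    if p: "p \<in> {..<m} \<times> {..<n}" for p
  proof -
    have a: "0 \<le> a p" "a p \<le> int R - 1" using assms(4)[OF p] by auto
    have x: "0 \<le> x (fst p) (snd p) - b (snd p)" "x (fst p) (snd p) - b (snd p) \<le> int R - 1"
      using assms(5)[of "fst p" "snd p"] p by auto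
    have "a p * (x (fst p) (snd p) - b (snd p)) \<le> (int R - 1) * (int R - 1)"
      using a x by (intro mult_mono) auto
    also have "\<dots> \<le> int R * int R - 1" using assms(3) by (simp add: algebra_simps)
    finally show ?thesis using a x by simp
  qed
  have "0 \<le> lin_form m n b a x" unfolding lin_form_def using tb by (intro sum_nonneg) auto
  moreover have "lin_form m n b a x \<le> (\<Sum>p\<in>{..<m} \<times> {..<n}. int R * int R - 1)"
    unfolding lin_form_def using tb by (intro sum_mono) auto
  moreover have "(\<Sum>p\<in>{..<m} \<times> {..<n}. int R * int R - 1) < int R * (int (m * n) * int R)"
    using assms(1-3) by (simp add: algebra_simps)
  ultimately have lt: "lin_form m n b a x < (int (m * n) * int R) * int R" by (simp add: ac_simps)
  have pos: "int (m * n) * int R > 0" using assms(1-3) by simp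
  have "(int (m * n) * int R) * (lin_form m n b a x div (int (m * n) * int R)) \<le> lin_form m n b a x"
    using mult_div_mod_eq[of "int (m * n) * int R" "lin_form m n b a x"] pos_mod_sign[OF pos, of "lin_form m n b a x"]
    by linarith
  then have "(int (m * n) * int R) * (lin_form m n b a x div (int (m * n) * int R)) < (int (m * n) * int R) * int R"
    using lt by linarith
  then have "lin_form m n b a x div (int (m * n) * int R) < int R"
    using pos by (simp only: mult_less_cancel_left_pos)
  moreover have "0 \<le> lin_form m n b a x div (int (m * n) * int R)"
    using \<open>0 \<le> lin_form m n b a x\<close> pos by (simp only: pos_imp_zdiv_nonneg_iff)
  ultimately show ?thesis by simp
qed

text \<open>With base point \<open>b / 2 ^ k\<close> and scale \<open>K * R / 2 ^ k\<close>, a form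
  on lattice points becomes a point of the linear image. One \<open>1 / R\<close> in the error is
  the side of a cell, the other one comes from rounding points of \<open>C\<close> to the lattice,
  and the sum is the price of replacing \<open>A j p / R\<close> by
  \<open>\<theta> (j, p)\<close>.\<close>

lemma cell_near_lin_image:
  assumes n: "n > 0" and m: "m > 0" and R: "R > 0" and C: "depends_on {..<n} C"
    and x: "\<And>l. l < m \<Longrightarrow> \<exists>c. C c \<and> (\<forall>i<n. x l i = \<lfloor>2 ^ k * c i\<rfloor>)"
    and box: "\<And>l i. l < m \<Longrightarrow> i < n \<Longrightarrow> x l i \<in> {b i..<b i + int R}"
    and \<theta>: "\<And>q. \<bar>\<theta> q\<bar> \<le> 1"
    and \<kappa>: "\<And>j. j < N \<Longrightarrow> \<kappa> j = lin_form m n b (A j) x div (int (m * n) * int R)"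
    and v: "\<And>j. j < N \<Longrightarrow> of_int (\<kappa> j) \<le> real R * v j \<and> real R * v j < of_int (\<kappa> j) + 1"
  shows "\<exists>w. lin_image C n m N \<theta> w \<and> (\<forall>j\<ge>N. w j = v j) \<and>
    (\<forall>j<N. \<bar>w j - v j\<bar> \<le> 2 / real R + (\<Sum>p\<in>{..<m} \<times> {..<n}. \<bar>of_int (A j p) / real R - \<theta> (j, p)\<bar>))"
proof -
  define K where "K = real (m * n)"
  have "1 \<le> m * n" using n m by simp
  then have K: "K \<ge> 1" unfolding K_def by (simp only: real_of_nat_ge_one_iff)
  obtain c where c: "\<And>l. l < m \<Longrightarrow> C (c l)" "\<And>l i. l < m \<Longrightarrow> i < n \<Longrightarrow> x l i = \<lfloor>2 ^ k * c l i\<rfloor>"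
    using x by metis
  \<comment> \<open>Representatives in \<open>C\<close> of the lattice points, then corner and
    scale, in the layout that \<open>lin_rel\<close> expects.\<close>
  define y where "y a = (if a < m * n then c (a div n) (a mod n)
      else if a < m * n + n then of_int (b (a - m * n)) / 2 ^ k else K * real R / 2 ^ k)" for a
  have yb: "y (l * n + i) = c l i" if "l < m" "i < n" for l i
  proof -
    have "l * n + i < Suc l * n" using that(2) by simp
    also have "\<dots> \<le> m * n" using that(1) by (intro mult_le_mono1) simp
    finally show ?thesis using that by (simp add: y_def)
  qed
  have yr: "y (m * n + n) = K * real R / 2 ^ k" by (simp add: y_def)
  have yr0: "y (m * n + n) > 0" using K R by (simp add: yr)
  define S where "S j = (\<Sum>p\<in>{..<m} \<times> {..<n}. \<theta> (j, p) * (y (fst p * n + snd p) - y (m * n + snd p)))" for j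
  define w where "w j = (if j < N then S j / y (m * n + n) else v j)" for j
  have "lin_rel n m N \<theta> w y" unfolding lin_rel_def w_def S_def using yr0 by auto
  moreover have "C (\<lambda>i. y (l * n + i))" if "l < m" for l
  proof -
    have "C (\<lambda>i. y (l * n + i)) = C (c l)" by (rule depends_onD[OF C]) (use yb that in auto)
    then show ?thesis using c(1)[OF that] by simp
  qed
  ultimately have W: "lin_image C n m N \<theta> w" unfolding lin_image_def using yr0 by blast
  have near: "\<bar>w j - v j\<bar> \<le> 2 / real R + (\<Sum>p\<in>{..<m} \<times> {..<n}. \<bar>of_int (A j p) / real R - \<theta> (j, p)\<bar>)"
    if j: "j < N" for j
  proof -
    define D where "D = lin_form m n b (A j) x"
    define \<zeta> where "\<zeta> p = of_int (x (fst p) (snd p) - b (snd p)) / real R" for p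
    define g where "g p = 2 ^ k * c (fst p) (snd p) - of_int (x (fst p) (snd p))" for p
    have \<zeta>: "0 \<le> \<zeta> p" "\<zeta> p \<le> 1" and g: "0 \<le> g p" "g p \<le> 1" if p: "p \<in> {..<m} \<times> {..<n}" for p
    proof -
      have "x (fst p) (snd p) \<in> {b (snd p)..<b (snd p) + int R}" using box[of "fst p" "snd p"] p by auto
      then have "0 \<le> x (fst p) (snd p) - b (snd p)" "x (fst p) (snd p) - b (snd p) \<le> int R" by auto
      then have "0 \<le> real_of_int (x (fst p) (snd p) - b (snd p))" "real_of_int (x (fst p) (snd p) - b (snd p)) \<le> real R"
        by linarith+
      then show "0 \<le> \<zeta> p" "\<zeta> p \<le> 1" using R by (auto simp: \<zeta>_def simp del: of_int_diff)
      have "x (fst p) (snd p) = \<lfloor>2 ^ k * c (fst p) (snd p)\<rfloor>" using c(2)[of "fst p" "snd p"] p by auto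
      then show "0 \<le> g p" "g p \<le> 1" unfolding g_def by linarith+
    qed
    have Dv: "\<bar>of_int D / (K * real R) - real R * v j\<bar> \<le> 1"
    proof -
      have "\<kappa> j = \<lfloor>of_int D / of_int (int (m * n) * int R)\<rfloor>"
        unfolding \<kappa>[OF j] D_def by (rule floor_divide_of_int_eq[symmetric])
      then have "\<kappa> j = \<lfloor>of_int D / (K * real R)\<rfloor>" by (simp add: K_def)
      then show ?thesis using v[OF j] by linarith
    qed
    have D: "of_int D / (K * real R) = real R * ((\<Sum>p\<in>{..<m} \<times> {..<n}. of_int (A j p) / real R * \<zeta> p) / K)"
    proof -
      have "of_int D = (\<Sum>p\<in>{..<m} \<times> {..<n}. real_of_int (A j p) * (real R * \<zeta> p))"
        unfolding D_def lin_form_def \<zeta>_def using R by simp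
      also have "\<dots> = real R * real R * (\<Sum>p\<in>{..<m} \<times> {..<n}. of_int (A j p) / real R * \<zeta> p)"
        unfolding sum_distrib_left using R by (intro sum.cong) auto
      finally show ?thesis using R K by (simp add: field_simps)
    qed
    have "real R * \<bar>(\<Sum>p\<in>{..<m} \<times> {..<n}. of_int (A j p) / real R * \<zeta> p) / K - v j\<bar> \<le> 1"
      using Dv R unfolding D right_diff_distrib[symmetric] abs_mult by simp
    then have 1: "\<bar>(\<Sum>p\<in>{..<m} \<times> {..<n}. of_int (A j p) / real R * \<zeta> p) / K - v j\<bar> \<le> 1 / real R"
      using R by (simp add: field_simps)
    have S: "S j / y (m * n + n) = (\<Sum>p\<in>{..<m} \<times> {..<n}. \<theta> (j, p) * (\<zeta> p + g p / real R)) / K"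
    proof -
      have "S j = (\<Sum>p\<in>{..<m} \<times> {..<n}. \<theta> (j, p) * (\<zeta> p + g p / real R)) * (real R / 2 ^ k)"
        unfolding S_def sum_distrib_right
      proof (rule sum.cong)
        fix p assume p: "p \<in> {..<m} \<times> {..<n}"
        have "y (fst p * n + snd p) = c (fst p) (snd p)" using yb[of "fst p" "snd p"] p by auto
        moreover have "y (m * n + snd p) = of_int (b (snd p)) / 2 ^ k" using p by (auto simp: y_def)
        ultimately have "y (fst p * n + snd p) - y (m * n + snd p) = (\<zeta> p + g p / real R) * (real R / 2 ^ k)"
          using R by (simp add: \<zeta>_def g_def field_simps)
        then show "\<theta> (j, p) * (y (fst p * n + snd p) - y (m * n + snd p)) =
            \<theta> (j, p) * (\<zeta> p + g p / real R) * (real R / 2 ^ k)" by simp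
      qed simp
      then show ?thesis using R K by (simp add: yr)
    qed
    define T where "T = (\<Sum>p\<in>{..<m} \<times> {..<n}. \<bar>of_int (A j p) / real R - \<theta> (j, p)\<bar>)"
    have T0: "T \<ge> 0" unfolding T_def by (intro sum_nonneg) auto
    have "\<bar>(\<Sum>p\<in>{..<m} \<times> {..<n}. \<theta> (j, p) * (\<zeta> p + g p / real R)) -
        (\<Sum>p\<in>{..<m} \<times> {..<n}. of_int (A j p) / real R * \<zeta> p)\<bar> \<le>
        (\<Sum>p\<in>{..<m} \<times> {..<n}. \<bar>of_int (A j p) / real R - \<theta> (j, p)\<bar> + 1 / real R)"
      unfolding sum_subtractf[symmetric]
    proof (rule sum_abs[THEN order_trans], rule sum_mono)
      fix p assume p: "p \<in> {..<m} \<times> {..<n}"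
      have "\<theta> (j, p) * (\<zeta> p + g p / real R) - of_int (A j p) / real R * \<zeta> p =
          (\<theta> (j, p) - of_int (A j p) / real R) * \<zeta> p + \<theta> (j, p) * (g p / real R)"
        by (simp add: algebra_simps)
      also have "\<bar>\<dots>\<bar> \<le> \<bar>(\<theta> (j, p) - of_int (A j p) / real R) * \<zeta> p\<bar> + \<bar>\<theta> (j, p) * (g p / real R)\<bar>"
        by (rule abs_triangle_ineq)
      also have "\<dots> \<le> \<bar>of_int (A j p) / real R - \<theta> (j, p)\<bar> + 1 / real R"
      proof (rule add_mono)
        have "\<bar>\<theta> (j, p) - of_int (A j p) / real R\<bar> * \<bar>\<zeta> p\<bar> \<le> \<bar>\<theta> (j, p) - of_int (A j p) / real R\<bar> * 1"
          using \<zeta>[OF p] by (intro mult_left_mono) auto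
        then show "\<bar>(\<theta> (j, p) - of_int (A j p) / real R) * \<zeta> p\<bar> \<le> \<bar>of_int (A j p) / real R - \<theta> (j, p)\<bar>"
          by (simp add: abs_mult abs_minus_commute)
        have "\<bar>\<theta> (j, p)\<bar> * \<bar>g p / real R\<bar> \<le> 1 * (1 / real R)"
          using \<theta>[of "(j, p)"] g[OF p] R by (intro mult_mono) (auto simp: divide_right_mono)
        then show "\<bar>\<theta> (j, p) * (g p / real R)\<bar> \<le> 1 / real R" by (simp add: abs_mult)
      qed
      finally show "\<bar>\<theta> (j, p) * (\<zeta> p + g p / real R) - of_int (A j p) / real R * \<zeta> p\<bar> \<le>
          \<bar>of_int (A j p) / real R - \<theta> (j, p)\<bar> + 1 / real R" .
    qed
    also have "\<dots> = T + K / real R" by (simp add: sum.distrib T_def K_def)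
    finally have "\<bar>(\<Sum>p\<in>{..<m} \<times> {..<n}. \<theta> (j, p) * (\<zeta> p + g p / real R)) -
        (\<Sum>p\<in>{..<m} \<times> {..<n}. of_int (A j p) / real R * \<zeta> p)\<bar> / K \<le> (T + K / real R) / K"
      using K by (intro divide_right_mono) auto
    \<comment> \<open>The \<open>K\<close> rounding errors of size at most \<open>1 / R\<close> are
      divided by \<open>K\<close> again through the choice of the scale.\<close>
    also have "(T + K / real R) / K \<le> T + 1 / real R"
    proof -
      have "T / K \<le> T / 1" using K T0 by (intro divide_left_mono) auto
      then show ?thesis using K by (simp add: add_divide_distrib)
    qed
    finally have 2: "\<bar>(\<Sum>p\<in>{..<m} \<times> {..<n}. \<theta> (j, p) * (\<zeta> p + g p / real R)) / K -
        (\<Sum>p\<in>{..<m} \<times> {..<n}. of_int (A j p) / real R * \<zeta> p) / K\<bar> \<le> T + 1 / real R"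
      using K by (simp add: diff_divide_distrib[symmetric] abs_divide)
    have "w j = (\<Sum>p\<in>{..<m} \<times> {..<n}. \<theta> (j, p) * (\<zeta> p + g p / real R)) / K" using j S by (simp add: w_def)
    then have "\<bar>w j - v j\<bar> \<le> T + 1 / real R + 1 / real R" using 1 2 by linarith
    then show ?thesis by (simp add: T_def)
  qed
  show ?thesis using W near by (intro exI[of _ w]) (auto simp: w_def)
qed

section \<open>Counting dyadic boxes\<close>

definition grid :: "nat \<Rightarrow> ((nat \<Rightarrow> real) \<Rightarrow> bool) \<Rightarrow> nat \<Rightarrow> (nat \<Rightarrow> int) set" where
  "grid n C k = {restrict (\<lambda>i. \<lfloor>2 ^ k * v i\<rfloor>) {..<n} |v. C v}"

lemma grid_subset:
  assumes B: "\<And>v i. C v \<Longrightarrow> i < n \<Longrightarrow> \<bar>v i\<bar> \<le> real B"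
  shows "grid n C k \<subseteq> PiE {..<n} (\<lambda>_. {- (int B * 2 ^ k)..int B * 2 ^ k})"
proof
  fix x assume "x \<in> grid n C k"
  then obtain v where v: "C v" "x = restrict (\<lambda>i. \<lfloor>2 ^ k * v i\<rfloor>) {..<n}" by (auto simp: grid_def)
  have "\<lfloor>2 ^ k * v i\<rfloor> \<in> {- (int B * 2 ^ k)..int B * 2 ^ k}" if "i < n" for i
  proof -
    have "2 ^ k * \<bar>v i\<bar> \<le> 2 ^ k * real B" using B[OF v(1) that] by (intro mult_left_mono) auto
    then have "\<bar>2 ^ k * v i\<bar> \<le> real_of_int (int B * 2 ^ k)" by (simp add: abs_mult mult.commute)
    then have "real_of_int (- (int B * 2 ^ k)) \<le> 2 ^ k * v i" "2 ^ k * v i \<le> real_of_int (int B * 2 ^ k)"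
      unfolding abs_le_iff of_int_minus by linarith+
    then have "- (int B * 2 ^ k) \<le> \<lfloor>2 ^ k * v i\<rfloor>" "\<lfloor>2 ^ k * v i\<rfloor> \<le> int B * 2 ^ k"
      by linarith+
    then show ?thesis by simp
  qed
  then show "x \<in> PiE {..<n} (\<lambda>_. {- (int B * 2 ^ k)..int B * 2 ^ k})" using v(2) by (auto simp: PiE_iff)
qed

lemma finite_grid:
  assumes "\<And>v i. C v \<Longrightarrow> i < n \<Longrightarrow> \<bar>v i\<bar> \<le> real B"
  shows "finite (grid n C k)"
proof (rule finite_subset)
  show "grid n C k \<subseteq> PiE {..<n} (\<lambda>_. {- (int B * 2 ^ k)..int B * 2 ^ k})"
    using assms by (rule grid_subset)
qed (auto intro!: finite_PiE)

text \<open>The densest cube cannot be small: side \<open>R\<close> allows at most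
  \<open>R ^ n\<close> lattice points, while the assumed growth pushes the density beyond any
  constant. Large \<open>R\<close> matters because the errors in \<open>cell_near_lin_image\<close>
  are of order \<open>1 / R\<close>.\<close>

lemma grid_zoom:
  fixes s :: real
  assumes n: "n > 0" and m: "m > 0" and B: "\<And>v i. C v \<Longrightarrow> i < n \<Longrightarrow> \<bar>v i\<bar> \<le> real B"
    and s: "real (N + 1) \<le> s * real m"
    and unbdd: "\<And>c. \<exists>k. real (card (grid n C k)) > c * (2 ^ k) powr s"
  obtains k b R where "R \<ge> Q" "R > 0"
    "\<forall>c \<rho>. \<rho> \<ge> 1 \<longrightarrow>
      card {y \<in> {y \<in> grid n C k. \<forall>i<n. b i \<le> y i \<and> y i < b i + int R}.
        \<forall>i<n. c i \<le> y i \<and> y i < c i + int \<rho>} ^ m * R ^ (N + 1) \<le>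
      card {y \<in> grid n C k. \<forall>i<n. b i \<le> y i \<and> y i < b i + int R} ^ m * \<rho> ^ (N + 1)"
    "R ^ (N + 1) \<le> card {y \<in> grid n C k. \<forall>i<n. b i \<le> y i \<and> y i < b i + int R} ^ m"
proof -
  define Q' where "Q' = max Q 1"
  \<comment> \<open>\<open>E\<close> pays for the factor \<open>2 * (B + 1)\<close> in the side of a
    cube containing the whole grid; the factor \<open>Q' ^ (n * m)\<close> in \<open>a\<close>
    forces \<open>R \<ge> Q'\<close> at the end.\<close>
  define E where "E = (2 * (B + 1)) ^ (N + 1)"
  define a where "a = Q' ^ (n * m) * E"
  \<comment> \<open>\<open>a + 1\<close> is at least 1, so its m-th power still dominates
    \<open>a\<close>.\<close>
  obtain k where k: "real (card (grid n C k)) > real (a + 1) * (2 ^ k) powr s" using unbdd by blast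
  define F where "F = grid n C k"
  have F: "finite F" unfolding F_def using B by (rule finite_grid)
  have Fm: "a * (2 ^ k) ^ (N + 1) \<le> card F ^ m"
  proof -
    have p1: "(1 :: real) \<le> 2 ^ k" by simp
    have pw: "(2 ^ k :: real) powr real (N + 1) = (2 ^ k) ^ (N + 1)" by (rule powr_realpow) simp
    have pm: "((2 ^ k :: real) powr s) ^ m = (2 ^ k) powr (s * real m)"
      by (subst powr_realpow[symmetric]) (auto simp: powr_powr)
    have "real (a * (2 ^ k) ^ (N + 1)) = real a * (2 ^ k) powr (real (N + 1))"
      unfolding pw by (simp only: of_nat_mult of_nat_power of_nat_numeral)
    also have "\<dots> \<le> real a * (2 ^ k) powr (s * real m)"
      using s p1 by (intro mult_left_mono powr_mono) auto
    also have "\<dots> \<le> real (a + 1) ^ m * (2 ^ k) powr (s * real m)"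
    proof (rule mult_right_mono)
      have "real a \<le> real (a + 1) ^ 1" by simp
      also have "\<dots> \<le> real (a + 1) ^ m" using m by (intro power_increasing) auto
      finally show "real a \<le> real (a + 1) ^ m" .
    qed simp
    also have "\<dots> = (real (a + 1) * (2 ^ k) powr s) ^ m"
      unfolding power_mult_distrib pm ..
    also have "\<dots> \<le> real (card F) ^ m" using k by (intro power_mono) (auto simp: F_def)
    finally have "real (a * (2 ^ k) ^ (N + 1)) \<le> real (card F ^ m)" by simp
    then show ?thesis by (simp only: of_nat_le_iff)
  qed
  \<comment> \<open>\<open>B + 1\<close> instead of \<open>B\<close> turns the closed bounds of
    \<open>grid_subset\<close> into half-open ones.\<close>
  define L where "L = 2 * (B + 1) * 2 ^ k"
  define b0 where "b0 = (\<lambda>_ :: nat. - (int (B + 1) * 2 ^ k))"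
  have L1: "L \<ge> 1" by (simp add: L_def Suc_le_eq)
  have L: "{y \<in> F. \<forall>i<n. b0 i \<le> y i \<and> y i < b0 i + int L} = F"
  proof -
    have "b0 i \<le> y i \<and> y i < b0 i + int L" if "y \<in> F" "i < n" for y i
    proof -
      have "F \<subseteq> PiE {..<n} (\<lambda>_. {- (int B * 2 ^ k)..int B * 2 ^ k})"
        unfolding F_def using B by (rule grid_subset)
      then have "y i \<in> {- (int B * 2 ^ k)..int B * 2 ^ k}" using that by blast
      then have "- (int B * 2 ^ k) \<le> y i" "y i \<le> int B * 2 ^ k" by auto
      moreover have "b0 i = - (int B * 2 ^ k) - 2 ^ k" "int L = 2 * (int B * 2 ^ k) + 2 * 2 ^ k"
        by (auto simp: b0_def L_def algebra_simps)
      moreover have "(0 :: int) < 2 ^ k" by simp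
      ultimately show ?thesis by linarith
    qed
    then show ?thesis by blast
  qed
  obtain b R where R: "R \<ge> 1"
    and fr: "\<forall>c \<rho>. \<rho> \<ge> 1 \<longrightarrow> card {y \<in> F. \<forall>i<n. c i \<le> y i \<and> y i < c i + int \<rho>} ^ m * R ^ (N + 1) \<le>
        card {y \<in> F. \<forall>i<n. b i \<le> y i \<and> y i < b i + int R} ^ m * \<rho> ^ (N + 1)"
    by (rule zoom[where n = n, OF F L1 L])
  define G where "G = {y \<in> F. \<forall>i<n. b i \<le> y i \<and> y i < b i + int R}"
  have main: "Q' ^ (n * m) * R ^ (N + 1) \<le> card G ^ m"
  proof -
    have "a * (2 ^ k) ^ (N + 1) * R ^ (N + 1) \<le> card F ^ m * R ^ (N + 1)"
      using Fm by (rule mult_right_mono) simp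
    also have "\<dots> \<le> card G ^ m * L ^ (N + 1)" using fr[rule_format, OF L1, of b0] unfolding L G_def .
    also have "\<dots> = card G ^ m * (E * (2 ^ k) ^ (N + 1))" unfolding L_def E_def by (simp only: power_mult_distrib)
    finally have "(E * (2 ^ k) ^ (N + 1)) * (Q' ^ (n * m) * R ^ (N + 1)) \<le> (E * (2 ^ k) ^ (N + 1)) * card G ^ m"
      unfolding a_def by (simp only: ac_simps)
    moreover have "E * (2 ^ k) ^ (N + 1) > 0" by (simp add: E_def)
    ultimately show ?thesis by (simp only: nat_mult_le_cancel1)
  qed
  have Q1: "1 \<le> Q' ^ (n * m)" unfolding Q'_def by (intro one_le_power) simp
  have big: "R ^ (N + 1) \<le> card G ^ m"
    using order_trans[OF mult_right_mono[OF Q1, of "R ^ (N + 1)"] main] by simp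
  have "card G \<le> R ^ n"
  proof -
    have "G \<subseteq> PiE {..<n} (\<lambda>i. {b i..<b i + int R})"
    proof
      fix y assume y: "y \<in> G"
      then have "y \<in> extensional {..<n}" by (auto simp: G_def F_def grid_def)
      then show "y \<in> PiE {..<n} (\<lambda>i. {b i..<b i + int R})" using y by (auto simp: G_def PiE_iff)
    qed
    then have "card G \<le> card (PiE {..<n} (\<lambda>i. {b i..<b i + int R}))" by (intro card_mono finite_PiE) auto
    then show ?thesis by (simp add: card_PiE)
  qed
  then have "card G ^ m \<le> R ^ (n * m)" unfolding power_mult by (rule power_mono) simp
  moreover have "Q' ^ (n * m) * 1 \<le> Q' ^ (n * m) * R ^ (N + 1)" using R by (intro mult_left_mono one_le_power) auto
  ultimately have "Q' ^ (n * m) \<le> R ^ (n * m)" using main by linarith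
  then have "Q' \<le> R" using n m by (metis nat_0_less_mult_iff power_mono_iff zero_le)
  then have "Q \<le> R" by (simp add: Q'_def)
  moreover have "card {y \<in> G. \<forall>i<n. c i \<le> y i \<and> y i < c i + int \<rho>} ^ m * R ^ (N + 1) \<le> card G ^ m * \<rho> ^ (N + 1)"
    if \<rho>: "\<rho> \<ge> 1" for c \<rho>
  proof -
    have "card {y \<in> G. \<forall>i<n. c i \<le> y i \<and> y i < c i + int \<rho>} \<le> card {y \<in> F. \<forall>i<n. c i \<le> y i \<and> y i < c i + int \<rho>}"
      using F by (intro card_mono) (auto simp: G_def)
    then have "card {y \<in> G. \<forall>i<n. c i \<le> y i \<and> y i < c i + int \<rho>} ^ m * R ^ (N + 1) \<le>
        card {y \<in> F. \<forall>i<n. c i \<le> y i \<and> y i < c i + int \<rho>} ^ m * R ^ (N + 1)"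
      by (intro mult_right_mono power_mono) auto
    also have "\<dots> \<le> card G ^ m * \<rho> ^ (N + 1)" unfolding G_def by (rule fr[rule_format, OF \<rho>])
    finally show ?thesis .
  qed
  ultimately show ?thesis using that[of R k b] R big unfolding G_def F_def by simp
qed

context i_minimal_expansion
begin

lemma box_count_bound:
  fixes C :: "(nat \<Rightarrow> real) \<Rightarrow> bool" and d :: nat and s :: real
  assumes C: "dpred M C" "depends_on {..<n} C" "closed {v. C v}"
    and B: "\<And>v i. C v \<Longrightarrow> i < n \<Longrightarrow> \<bar>v i\<bar> \<le> real B" and n: "n > 0"
    and dim: "\<And>A. A \<subseteq> {..<n} \<Longrightarrow> d < card A \<Longrightarrow> interior {u. \<exists>v. C v \<and> (\<forall>a\<in>A. v a = u a)} = {}"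
    and s: "real d < s"
  shows "\<exists>c. \<forall>k. real (card (grid n C k)) \<le> c * (2 ^ k) powr s"
proof (rule ccontr)
  assume "\<not> ?thesis"
  then have unbdd: "\<exists>k. real (card (grid n C k)) > c * (2 ^ k) powr s" for c
    by (simp add: not_le)
  \<comment> \<open>This amounts to \<open>s * m \<ge> m * d + n + 3\<close>, which is
    \<open>N + 1\<close> below.\<close>
  obtain m :: nat where m0: "real (n + 3) / (s - real d) \<le> real m" using real_arch_simple by blast
  have "0 < real (n + 3) / (s - real d)" using s by simp
  then have m: "m > 0" using m0 by (cases m) auto
  define N where "N = m * d + n + 2"
  have sN: "real (N + 1) \<le> s * real m"
    using m0 s by (simp add: N_def divide_le_eq algebra_simps)
  define c3 where "c3 = (2 * real (m * n) + 1) ^ N * (1 + 2 * 4 ^ (N + 1))"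
  have "0 < 2 * real (m * n) + 1" by (simp add: add_nonneg_pos)
  then have c3: "c3 > 0" unfolding c3_def by (intro mult_pos_pos zero_less_power) (auto simp: add_pos_pos)
  define Idx where "Idx = {..<m} \<times> {..<n}"
  \<comment> \<open>The estimate ranges over all \<open>\<theta>'\<close>, because the limit matrix
    is known only after a subsequence of the \<open>\<theta>\<close> has been chosen.\<close>
  define good where "good Q \<theta> H \<longleftrightarrow> (\<forall>q. \<bar>\<theta> q\<bar> \<le> 1) \<and> H \<in> sets seqm \<and> ennreal (1 / c3) \<le> emeasure seqm H \<and>
    (\<forall>v\<in>H. \<forall>\<theta>'. (\<forall>q. \<bar>\<theta>' q\<bar> \<le> 1) \<longrightarrow> (\<exists>w. lin_image C n m N \<theta>' w \<and> (\<forall>j\<ge>N. w j = v j) \<and>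
      (\<forall>j<N. \<bar>w j - v j\<bar> \<le> 2 / real (Suc Q) + (\<Sum>p\<in>Idx. \<bar>\<theta> (j, p) - \<theta>' (j, p)\<bar>))))"
    for Q and \<theta> :: "nat \<times> nat \<times> nat \<Rightarrow> real" and H
  have "\<exists>\<theta> H. good Q \<theta> H" for Q
  proof -
    from B sN unbdd obtain k b R where R: "R \<ge> Suc Q" "R > 0"
      and fr: "\<forall>c \<rho>. \<rho> \<ge> 1 \<longrightarrow>
      card {y \<in> {y \<in> grid n C k. \<forall>i<n. b i \<le> y i \<and> y i < b i + int R}.
        \<forall>i<n. c i \<le> y i \<and> y i < c i + int \<rho>} ^ m * R ^ (N + 1) \<le>
      card {y \<in> grid n C k. \<forall>i<n. b i \<le> y i \<and> y i < b i + int R} ^ m * \<rho> ^ (N + 1)"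
      and big: "R ^ (N + 1) \<le> card {y \<in> grid n C k. \<forall>i<n. b i \<le> y i \<and> y i < b i + int R} ^ m"
      by (rule grid_zoom[OF n m])
    define G where "G = {y \<in> grid n C k. \<forall>i<n. b i \<le> y i \<and> y i < b i + int R}"
    have "finite (grid n C k)" using B by (rule finite_grid)
    then have finG: "finite G" by (simp add: G_def)
    have boxG: "G \<subseteq> PiE {..<n} (\<lambda>i. {b i..<b i + int R})"
    proof
      fix y assume y: "y \<in> G"
      then have "y \<in> extensional {..<n}" by (auto simp: G_def grid_def)
      then show "y \<in> PiE {..<n} (\<lambda>i. {b i..<b i + int R})" using y by (auto simp: G_def PiE_iff)
    qed
    obtain A where A: "A \<in> PiE {..<N} (\<lambda>_. PiE ({..<m} \<times> {..<n}) (\<lambda>_. {0..<int R}))"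
      "real R ^ N \<le> c3 * real (card ((\<lambda>x. \<lambda>j\<in>{..<N}. lin_form m n b (A j) x div (int (m * n) * int R)) `
         PiE {..<m} (\<lambda>_. G)))"
      unfolding c3_def by (rule projection_cells[OF finG m n R(2) boxG fr[folded G_def, rule_format] big[folded G_def]])
    define cell where "cell x = (\<lambda>j\<in>{..<N}. lin_form m n b (A j) x div (int (m * n) * int R))" for x
    define K where "K = cell ` PiE {..<m} (\<lambda>_. G)"
    have Ab: "A j p \<in> {0..<int R}" if "j < N" "p \<in> Idx" for j p
    proof -
      have "A j \<in> PiE ({..<m} \<times> {..<n}) (\<lambda>_. {0..<int R})" using A(1) that by blast
      then show ?thesis using that unfolding Idx_def by blast
    qed
    have xb: "x l i \<in> {b i..<b i + int R}" if "x \<in> PiE {..<m} (\<lambda>_. G)" "l < m" "i < n" for x l i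
    proof -
      have "x l \<in> G" using that by blast
      then show ?thesis using that(3) by (simp add: G_def)
    qed
    have KQ: "K \<subseteq> PiE {..<N} (\<lambda>_. {0..<int R})"
    proof
      fix \<kappa> assume "\<kappa> \<in> K"
      then obtain x where x: "x \<in> PiE {..<m} (\<lambda>_. G)" "\<kappa> = cell x" by (auto simp: K_def)
      have "lin_form m n b (A j) x div (int (m * n) * int R) \<in> {0..<int R}" if "j < N" for j
        by (rule lin_form_bounds[OF n m R(2) Ab[OF that, unfolded Idx_def] xb[OF x(1)]])
      then show "\<kappa> \<in> PiE {..<N} (\<lambda>_. {0..<int R})" unfolding x(2) cell_def by (auto simp: PiE_iff)
    qed
    define H where "H = {v :: nat \<Rightarrow> real. \<exists>\<kappa>\<in>K. \<forall>j<N. of_int (\<kappa> j) \<le> real R * v j \<and> real R * v j < of_int (\<kappa> j) + 1}"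
    \<comment> \<open>The default 0 keeps all entries, including the irrelevant ones, in a compact
      box.\<close>
    define \<theta> :: "nat \<times> nat \<times> nat \<Rightarrow> real" where
      "\<theta> = (\<lambda>(j, p). if j < N \<and> p \<in> Idx then of_int (A j p) / real R else 0)"
    have "\<bar>\<theta> q\<bar> \<le> 1" for q
    proof -
      obtain j p where Pair: "q = (j, p)" by (rule prod.exhaust)
      show ?thesis
      proof (cases "j < N \<and> p \<in> Idx")
        case True
        then have "A j p \<in> {0..<int R}" using Ab by blast
        then have "0 \<le> real_of_int (A j p)" "real_of_int (A j p) \<le> real R" by auto
        then show ?thesis using R(2) True by (simp add: \<theta>_def Pair)
      qed (auto simp: \<theta>_def Pair)
    qed
    moreover have "H \<in> sets seqm" unfolding H_def by (rule emeasure_cells(1)[OF R(2) KQ])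
    moreover have "ennreal (1 / c3) \<le> emeasure seqm H"
    proof -
      have "emeasure seqm H = ennreal (real (card K) / real R ^ N)"
        unfolding H_def by (rule emeasure_cells(2)[OF R(2) KQ])
      moreover have "1 / c3 \<le> real (card K) / real R ^ N"
        using A(2) c3 R(2) unfolding K_def cell_def by (simp add: field_simps)
      ultimately show ?thesis by (simp add: ennreal_leI)
    qed
    moreover have "\<exists>w. lin_image C n m N \<theta>' w \<and> (\<forall>j\<ge>N. w j = v j) \<and>
        (\<forall>j<N. \<bar>w j - v j\<bar> \<le> 2 / real (Suc Q) + (\<Sum>p\<in>Idx. \<bar>\<theta> (j, p) - \<theta>' (j, p)\<bar>))"
      if v: "v \<in> H" and \<theta>': "\<forall>q. \<bar>\<theta>' q\<bar> \<le> 1" for v \<theta>'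
    proof -
      obtain \<kappa> where \<kappa>: "\<kappa> \<in> K" "\<And>j. j < N \<Longrightarrow> of_int (\<kappa> j) \<le> real R * v j \<and> real R * v j < of_int (\<kappa> j) + 1"
        using v by (auto simp: H_def)
      then obtain x where x: "x \<in> PiE {..<m} (\<lambda>_. G)" "\<kappa> = cell x" by (auto simp: K_def)
      have "\<exists>w. lin_image C n m N \<theta>' w \<and> (\<forall>j\<ge>N. w j = v j) \<and>
        (\<forall>j<N. \<bar>w j - v j\<bar> \<le> 2 / real R + (\<Sum>p\<in>{..<m} \<times> {..<n}. \<bar>of_int (A j p) / real R - \<theta>' (j, p)\<bar>))"
      proof (rule cell_near_lin_image[OF n m R(2) C(2) _ xb[OF x(1)]])
        fix l assume "l < m"
        then have "x l \<in> grid n C k" using x(1) by (auto simp: G_def)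
        then show "\<exists>c. C c \<and> (\<forall>i<n. x l i = \<lfloor>2 ^ k * c i\<rfloor>)" by (auto simp: grid_def)
      qed (use \<theta>' \<kappa> x(2) in \<open>auto simp: cell_def\<close>)
      then obtain w where w: "lin_image C n m N \<theta>' w" "\<forall>j\<ge>N. w j = v j"
        "\<And>j. j < N \<Longrightarrow> \<bar>w j - v j\<bar> \<le> 2 / real R + (\<Sum>p\<in>{..<m} \<times> {..<n}. \<bar>of_int (A j p) / real R - \<theta>' (j, p)\<bar>)"
        by blast
      have "\<bar>w j - v j\<bar> \<le> 2 / real (Suc Q) + (\<Sum>p\<in>Idx. \<bar>\<theta> (j, p) - \<theta>' (j, p)\<bar>)" if j: "j < N" for j
      proof -
        have "(\<Sum>p\<in>{..<m} \<times> {..<n}. \<bar>of_int (A j p) / real R - \<theta>' (j, p)\<bar>) = (\<Sum>p\<in>Idx. \<bar>\<theta> (j, p) - \<theta>' (j, p)\<bar>)"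
          unfolding Idx_def[symmetric] using j by (intro sum.cong) (auto simp: \<theta>_def)
        moreover have "2 / real R \<le> 2 / real (Suc Q)" using R by (intro divide_left_mono) auto
        ultimately show ?thesis using w(3)[OF j] by linarith
      qed
      then show ?thesis using w(1,2) by blast
    qed
    ultimately have "good Q \<theta> H" unfolding good_def by blast
    then show ?thesis by blast
  qed
  then obtain \<theta> H where good: "\<And>Q. good Q (\<theta> Q) (H Q)" by metis
  have \<theta>: "\<And>Q q. \<bar>\<theta> Q q\<bar> \<le> 1" and H: "\<And>Q. H Q \<in> sets seqm"
    "\<And>Q. ennreal (1 / c3) \<le> emeasure seqm (H Q)"
    and near: "\<And>Q v \<theta>'. v \<in> H Q \<Longrightarrow> (\<forall>q. \<bar>\<theta>' q\<bar> \<le> 1) \<Longrightarrow> \<exists>w. lin_image C n m N \<theta>' w \<and> (\<forall>j\<ge>N. w j = v j) \<and>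
      (\<forall>j<N. \<bar>w j - v j\<bar> \<le> 2 / real (Suc Q) + (\<Sum>p\<in>Idx. \<bar>\<theta> Q (j, p) - \<theta>' (j, p)\<bar>))"
    using good unfolding good_def by blast+
  have "\<forall>Q. \<theta> Q \<in> {y :: nat \<times> nat \<times> nat \<Rightarrow> real. \<forall>q. \<bar>y q\<bar> \<le> 1}" using \<theta> by simp
  then obtain \<theta>' r where \<theta>': "\<theta>' \<in> {y :: nat \<times> nat \<times> nat \<Rightarrow> real. \<forall>q. \<bar>y q\<bar> \<le> 1}"
    and r: "strict_mono r" "(\<theta> \<circ> r) \<longlonglongrightarrow> \<theta>'"
    using compact_seq_box[of 1, where 'i = "nat \<times> nat \<times> nat"] unfolding compact_def by blast
  define \<epsilon> where "\<epsilon> t = 2 / real (Suc (r t)) + (\<Sum>j<N. \<Sum>p\<in>Idx. \<bar>\<theta> (r t) (j, p) - \<theta>' (j, p)\<bar>)" for t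
  have "(\<lambda>t. \<theta> (r t) q) \<longlonglongrightarrow> \<theta>' q" for q
    using continuous_on_tendsto_compose[OF continuous_on_product_coordinates[of q] r(2)] by simp
  then have "(\<lambda>t. \<bar>\<theta> (r t) q - \<theta>' q\<bar>) \<longlonglongrightarrow> 0" for q
    by (intro tendsto_rabs_zero LIM_zero)
  moreover have "(\<lambda>t. 2 / real (Suc (r t))) \<longlonglongrightarrow> 0"
  proof -
    have "(\<lambda>t. 2 / real (Suc t)) \<longlonglongrightarrow> 0" by real_asymp
    from LIMSEQ_subseq_LIMSEQ[OF this r(1)] show ?thesis by (simp add: o_def)
  qed
  ultimately have \<epsilon>0: "\<epsilon> \<longlonglongrightarrow> 0"
    unfolding \<epsilon>_def by (intro tendsto_add_zero tendsto_null_sum)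
  define W where "W = lin_image C n m N \<theta>'"
  have Wdp: "dpred M W" unfolding W_def lin_image_def lin_rel_def
    by (intro dpred_exs dpred2_def[THEN iffD2] dpred_conj dpred_all_less dpred_subst[OF C(1)] dpred_less dpred_eq
        dterm_evens_odds dterm_intros)
  \<comment> \<open>The upper limit of the sets \<open>H (r t)\<close> keeps measure at least
    \<open>1 / c3\<close>, whereas their intersection might be null. Each of its points lies in
    \<open>H (r t)\<close> for arbitrarily large \<open>t\<close>, hence within
    \<open>\<epsilon> t\<close> of \<open>W\<close> for such \<open>t\<close>.\<close>
  define E where "E q = (\<Union>t\<in>{q..}. H (r t))" for q
  have Es: "range E \<subseteq> sets seqm" unfolding E_def using H(1) by (auto intro!: sets.countable_UN')
  have "(INF q. emeasure seqm (E q)) = emeasure seqm (\<Inter>q. E q)"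
  proof (rule INF_emeasure_decseq[OF Es])
    show "decseq E" unfolding decseq_def E_def by (intro allI impI UN_mono) auto
  qed (simp add: seqm'.emeasure_eq_measure)
  moreover have "ennreal (1 / c3) \<le> (INF q. emeasure seqm (E q))"
  proof (rule INF_greatest)
    fix q
    have "emeasure seqm (H (r q)) \<le> emeasure seqm (E q)"
      using Es by (intro emeasure_mono) (auto simp: E_def)
    then show "ennreal (1 / c3) \<le> emeasure seqm (E q)" using H(2)[of "r q"] by (rule order_trans[rotated])
  qed
  ultimately have mE: "ennreal (1 / c3) \<le> emeasure seqm (\<Inter>q. E q)" by simp
  have sub: "(\<Inter>q. E q) \<subseteq> closure {v. W v}"
  proof (rule ccontr)
    assume "\<not> (\<Inter>q. E q) \<subseteq> closure {v. W v}"
    then obtain v where v: "v \<in> (\<Inter>q. E q)" "v \<in> - closure {v. W v}" by blast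
    have "open (- closure {v. W v})" by auto
    then obtain J e where J: "finite J" "e > 0"
      "\<And>w. (\<And>i. i \<in> J \<Longrightarrow> \<bar>w i - v i\<bar> < e) \<Longrightarrow> w \<in> - closure {v. W v}"
      using open_seq_contains_box v(2) by metis
    obtain q where q: "\<And>t. t \<ge> q \<Longrightarrow> \<epsilon> t < e"
      using order_tendstoD(2)[OF \<epsilon>0 J(2)] by (auto simp: eventually_sequentially)
    have "v \<in> E q" using v(1) by blast
    then obtain t where t: "t \<ge> q" "v \<in> H (r t)" by (auto simp: E_def)
    obtain w where w: "W w" "\<forall>j\<ge>N. w j = v j"
      "\<forall>j<N. \<bar>w j - v j\<bar> \<le> 2 / real (Suc (r t)) + (\<Sum>p\<in>Idx. \<bar>\<theta> (r t) (j, p) - \<theta>' (j, p)\<bar>)"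
      using near[OF t(2), of \<theta>'] \<theta>' unfolding W_def by blast
    have "\<bar>w j - v j\<bar> < e" for j
    proof (cases "j < N")
      case True
      have "(\<Sum>p\<in>Idx. \<bar>\<theta> (r t) (j, p) - \<theta>' (j, p)\<bar>) \<le> (\<Sum>j<N. \<Sum>p\<in>Idx. \<bar>\<theta> (r t) (j, p) - \<theta>' (j, p)\<bar>)"
        by (rule member_le_sum[of j "{..<N}" "\<lambda>j. \<Sum>p\<in>Idx. \<bar>\<theta> (r t) (j, p) - \<theta>' (j, p)\<bar>"])
          (use True in \<open>auto intro!: sum_nonneg\<close>)
      moreover have "\<bar>w j - v j\<bar> \<le> 2 / real (Suc (r t)) + (\<Sum>p\<in>Idx. \<bar>\<theta> (r t) (j, p) - \<theta>' (j, p)\<bar>)"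
        using w(3) True by blast
      ultimately have "\<bar>w j - v j\<bar> \<le> \<epsilon> t" unfolding \<epsilon>_def by linarith
      then show ?thesis using q[OF t(1)] by simp
    next
      case False
      then show ?thesis using w(2) J(2) by simp
    qed
    then have "w \<in> - closure {v. W v}" using J(3) by blast
    moreover have "w \<in> closure {v. W v}" using w(1) closure_subset[of "{v. W v}"] by blast
    ultimately show False by blast
  qed
  have "emeasure seqm (\<Inter>q. E q) \<le> emeasure seqm (closure {v. W v})"
    by (rule emeasure_mono[OF sub]) (simp add: sets_seqm)
  then have "ennreal (1 / c3) \<le> emeasure seqm (closure {v. W v})" using mE by (rule order_trans[rotated])
  moreover have "ennreal (1 / c3) > 0" using c3 by simp
  ultimately have "emeasure seqm {v. v \<in> closure {v. W v}} \<noteq> 0" by auto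
  \<comment> \<open>Positive measure gives interior to the closed definable closure, and genericity
    hands it back to \<open>W\<close> itself.\<close>
  then have "interior {v. v \<in> closure {v. W v}} \<noteq> {}"
    by (intro closed_positive_measure_interior dpred_closure Wdp) auto
  then have "interior {v. W v} \<noteq> {}" using dpred_interior_closure[OF Wdp] by simp
  moreover have "interior {v. W v} = {}" unfolding W_def lin_image_def
    using B dim N_def by (rule linear_image_no_interior[OF C])
  ultimately show False by simp
qed

end

section \<open>Null sets of Hausdorff measures\<close>

lemma hausdorff_measure_eq_0_iff:
  "hausdorff_measure s X = 0 \<longleftrightarrow>
    (\<forall>\<delta>>0. \<forall>\<epsilon>>0. \<exists>U :: nat \<Rightarrow> 'a::metric_space set. X \<subseteq> (\<Union>i. U i) \<and>
      (\<forall>i. bounded (U i) \<and> diameter (U i) \<le> \<delta>) \<and> (\<Sum>i. ennreal (diam_pow s (U i))) < ennreal \<epsilon>)"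
proof -
  have "hausdorff_measure s X = 0 \<longleftrightarrow> (\<forall>\<delta>>0. hausdorff_content s \<delta> X = 0)"
    unfolding hausdorff_measure_def by (auto simp: bot_ennreal[symmetric] SUP_bot_conv)
  also have "\<dots> \<longleftrightarrow> (\<forall>\<delta>>0. \<forall>\<epsilon>>0. hausdorff_content s \<delta> X < ennreal \<epsilon>)"
  proof -
    have "a = 0 \<longleftrightarrow> (\<forall>\<epsilon>>0. a < ennreal \<epsilon>)" for a :: ennreal
    proof
      assume a: "\<forall>\<epsilon>>0. a < ennreal \<epsilon>"
      show "a = 0"
      proof (rule ccontr)
        assume "a \<noteq> 0"
        have "a < ennreal 1" using a[rule_format, of 1] by simp
        then obtain r where r: "r \<ge> 0" "a = ennreal r" by (cases a) auto
        then have "r > 0" using \<open>a \<noteq> 0\<close> by (cases "r = 0") auto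
        then have "a < ennreal r" using a by blast
        then show False using r by simp
      qed
    qed auto
    then show ?thesis by simp
  qed
  also have "\<dots> \<longleftrightarrow> (\<forall>\<delta>>0. \<forall>\<epsilon>>0. \<exists>U :: nat \<Rightarrow> 'a set. X \<subseteq> (\<Union>i. U i) \<and>
      (\<forall>i. bounded (U i) \<and> diameter (U i) \<le> \<delta>) \<and> (\<Sum>i. ennreal (diam_pow s (U i))) < ennreal \<epsilon>)"
    unfolding hausdorff_content_def INF_less_iff by (simp add: Bex_def conj_assoc)
  finally show ?thesis .
qed

lemma hausdorff_measure_0_UN:
  assumes "\<And>k :: nat. hausdorff_measure s (X k) = 0"
  shows "hausdorff_measure s (\<Union>k. X k) = 0"
  unfolding hausdorff_measure_eq_0_iff
proof (intro allI impI)
  fix \<delta> \<epsilon> :: real assume \<delta>: "\<delta> > 0" and \<epsilon>: "\<epsilon> > 0"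
  \<comment> \<open>Geometric weights with sum \<open>\<epsilon> / 2\<close> keep the final
    inequality strict.\<close>
  define P where "P k U \<longleftrightarrow> X k \<subseteq> (\<Union>i. U i) \<and> (\<forall>i. bounded (U i) \<and> diameter (U i) \<le> \<delta>) \<and>
      (\<Sum>i. ennreal (diam_pow s (U i))) < ennreal (\<epsilon> / 2 * (1 / 2) ^ Suc k)" for k :: nat and U :: "nat \<Rightarrow> 'a set"
  have "\<exists>U. P k U" for k
    using assms[of k] \<delta> \<epsilon> unfolding hausdorff_measure_eq_0_iff P_def by simp
  then obtain U where U: "\<And>k. P k (U k)" by metis
  define V where "V i = (case prod_decode i of (k, l) \<Rightarrow> U k l)" for i
  have "(\<Union>k. X k) \<subseteq> (\<Union>i. V i)"
  proof
    fix x assume "x \<in> (\<Union>k. X k)"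
    then obtain k where "x \<in> X k" by blast
    then obtain l where "x \<in> U k l" using U[of k] unfolding P_def by blast
    then have "x \<in> V (prod_encode (k, l))" by (simp add: V_def)
    then show "x \<in> (\<Union>i. V i)" by blast
  qed
  moreover have "bounded (V i) \<and> diameter (V i) \<le> \<delta>" for i
    using U unfolding P_def V_def by (auto split: prod.split)
  moreover have "(\<Sum>i. ennreal (diam_pow s (V i))) < ennreal \<epsilon>"
  proof -
    have "(\<Sum>i. ennreal (diam_pow s (V i))) = (\<Sum>i. (case prod_decode i of (k, l) \<Rightarrow> ennreal (diam_pow s (U k l))))"
      by (intro suminf_cong) (auto simp: V_def split: prod.split)
    also have "\<dots> = (\<Sum>k. \<Sum>l. ennreal (diam_pow s (U k l)))"
      using suminf_ennreal_2dimen[of "\<lambda>k. \<Sum>l. ennreal (diam_pow s (U k l))" "\<lambda>(k, l). ennreal (diam_pow s (U k l))"]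
      by (simp add: comp_def)
    also have "\<dots> \<le> (\<Sum>k. ennreal (\<epsilon> / 2 * (1 / 2) ^ Suc k))"
      using U unfolding P_def by (intro suminf_le) (auto intro: less_imp_le)
    also have "\<dots> = ennreal (\<epsilon> / 2)"
    proof -
      have "(\<lambda>k. \<epsilon> / 2 * (1 / 2) ^ Suc k) sums (\<epsilon> / 2 * 1)" by (intro sums_mult power_half_series)
      then show ?thesis using \<epsilon> by (intro suminf_ennreal_eq) auto
    qed
    also have "\<dots> < ennreal \<epsilon>" using \<epsilon> by (simp add: ennreal_less_iff)
    finally show ?thesis .
  qed
  ultimately show "\<exists>U. (\<Union>k. X k) \<subseteq> (\<Union>i. U i) \<and> (\<forall>i. bounded (U i) \<and> diameter (U i) \<le> \<delta>) \<and>
      (\<Sum>i. ennreal (diam_pow s (U i))) < ennreal \<epsilon>" by blast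
qed

text \<open>The sets of a fine cover of \<open>C\<close> are fattened to boxes with sides comparable
  to their diameters in the directions \<open>B\<close> and to \<open>r\<close> in the others. As
  diameters are at most 1 and \<open>s < card B\<close>, the total volume is dominated by the
  covering sum for exponent \<open>s\<close>.\<close>

lemma hausdorff_null_imp_negligible_cylinder:
  fixes C :: "'a::euclidean_space set"
  assumes B: "B \<subseteq> Basis" and s: "0 \<le> s" "s < real (card B)" and C: "hausdorff_measure s C = 0" and r: "r > 0"
  shows "negligible {x \<in> ball y0 r. \<exists>c\<in>C. \<forall>b\<in>B. x \<bullet> b = c \<bullet> b}" (is "negligible ?S")
  unfolding negligible_outer_le
proof (intro allI impI)
  fix e :: real assume e: "e > 0"
  define m where "m = card B"
  \<comment> \<open>Each side is twice a half-width: this gives \<open>2 ^ m\<close> in the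
    directions \<open>B\<close> and \<open>2 * r\<close> in each of the others.\<close>
  define k where "k = 2 ^ m * (2 * r) ^ (DIM('a) - m)"
  have k: "k > 0" using r by (simp add: k_def)
  have finB: "finite B" by (rule finite_subset[OF B finite_Basis])
  have m: "m \<le> DIM('a)" unfolding m_def using B by (intro card_mono) auto
  obtain U :: "nat \<Rightarrow> 'a set" where U: "C \<subseteq> (\<Union>i. U i)" "\<And>i. bounded (U i)" "\<And>i. diameter (U i) \<le> 1"
    "(\<Sum>i. ennreal (diam_pow s (U i))) < ennreal (e / k)"
    using C[unfolded hausdorff_measure_eq_0_iff, rule_format, of 1 "e / k"] e k by auto
  define c where "c i = (SOME x. x \<in> U i)" for i
  define w where "w i = (\<Sum>b\<in>Basis. (if b \<in> B then diameter (U i) else r) *\<^sub>R b)" for i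
  define p where "p i = (\<Sum>b\<in>Basis. (if b \<in> B then c i \<bullet> b else y0 \<bullet> b) *\<^sub>R b)" for i
  define T where "T i = (if U i = {} then {} else cbox (p i - w i) (p i + w i))" for i
  have wb: "w i \<bullet> b = (if b \<in> B then diameter (U i) else r)"
    "p i \<bullet> b = (if b \<in> B then c i \<bullet> b else y0 \<bullet> b)" if "b \<in> Basis" for i b
    using that by (auto simp: w_def p_def inner_sum_left_Basis)
  have d0: "0 \<le> diameter (U i)" for i using U(2) by (simp add: diameter_ge_0)
  have Tm: "emeasure lebesgue (T i) \<le> ennreal k * ennreal (diam_pow s (U i))" for i
  proof (cases "U i = {}")
    case False
    have "emeasure lebesgue (T i) = emeasure lborel (cbox (p i - w i) (p i + w i))" using False by (simp add: T_def)
    also have "\<dots> = ennreal (\<Prod>b\<in>Basis. (p i + w i - (p i - w i)) \<bullet> b)"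
      using d0 r by (intro emeasure_lborel_cbox) (auto simp: inner_diff_left inner_add_left wb)
    also have "(\<Prod>b\<in>Basis. (p i + w i - (p i - w i)) \<bullet> b) = (\<Prod>b\<in>Basis. if b \<in> B then 2 * diameter (U i) else 2 * r)"
      by (intro prod.cong) (auto simp: inner_diff_left inner_add_left wb)
    also have "\<dots> = (2 * diameter (U i)) ^ card (Basis \<inter> B) * (2 * r) ^ card (Basis \<inter> - B)"
      by (simp add: prod.If_cases)
    also have "\<dots> = k * diameter (U i) ^ m"
    proof -
      have "Basis \<inter> B = B" using B by blast
      moreover have "card (Basis \<inter> - B) = DIM('a) - m"
        unfolding m_def Diff_eq[symmetric] by (rule card_Diff_subset[OF finB B])
      ultimately show ?thesis by (simp add: k_def m_def power_mult_distrib)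
    qed
    finally have eq: "emeasure lebesgue (T i) = ennreal (k * diameter (U i) ^ m)" .
    have "diameter (U i) ^ m \<le> diam_pow s (U i)"
    proof (cases "s = 0")
      case True
      then show ?thesis using False d0 U(3) by (simp add: diam_pow_def power_le_one)
    next
      case s0: False
      show ?thesis
      proof (cases "diameter (U i) = 0")
        case True
        \<comment> \<open>\<open>diam_pow\<close> vanishes in this case, so \<open>0 ^ m\<close> has
          to vanish as well.\<close>
        have "m \<noteq> 0" using s by (auto simp: m_def)
        then show ?thesis using True False s0 by (simp add: diam_pow_def power_0_left)
      next
        case dpos: False
        then have "diameter (U i) ^ m = diameter (U i) powr real m" using d0[of i] by (simp add: powr_realpow)
        also have "\<dots> \<le> diameter (U i) powr s"
          using s U(3)[of i] d0[of i] dpos by (intro powr_mono') (auto simp: m_def)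
        finally show ?thesis using False s0 by (simp add: diam_pow_def)
      qed
    qed
    then have "ennreal (k * diameter (U i) ^ m) \<le> ennreal (k * diam_pow s (U i))"
      using k by (intro ennreal_leI mult_left_mono) auto
    then show ?thesis unfolding eq using k by (simp add: ennreal_mult')
  qed (simp add: T_def)
  have meas: "T i \<in> sets lebesgue" for i by (simp add: T_def)
  have "?S \<subseteq> (\<Union>i. T i)"
  proof
    fix x assume "x \<in> ?S"
    then obtain z where z: "x \<in> ball y0 r" "z \<in> C" "\<And>b. b \<in> B \<Longrightarrow> x \<bullet> b = z \<bullet> b" by blast
    obtain i where i: "z \<in> U i" using U(1) z(2) by blast
    then have ci: "c i \<in> U i" unfolding c_def by (rule someI)
    have "\<bar>x \<bullet> b - p i \<bullet> b\<bar> \<le> w i \<bullet> b" if b: "b \<in> Basis" for b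
    proof (cases "b \<in> B")
      case True
      have "\<bar>x \<bullet> b - c i \<bullet> b\<bar> = \<bar>(z - c i) \<bullet> b\<bar>" using z(3)[OF True] by (simp add: inner_diff_left)
      also have "\<dots> \<le> norm (z - c i)" using b by (rule Basis_le_norm)
      also have "\<dots> = dist z (c i)" by (simp add: dist_norm)
      also have "\<dots> \<le> diameter (U i)" using U(2) i ci by (rule diameter_bounded_bound)
      finally show ?thesis using True b by (simp add: wb)
    next
      case False
      have "\<bar>x \<bullet> b - y0 \<bullet> b\<bar> = \<bar>(x - y0) \<bullet> b\<bar>" by (simp add: inner_diff_left)
      also have "\<dots> \<le> norm (x - y0)" using b by (rule Basis_le_norm)
      also have "\<dots> \<le> r" using z(1) by (simp add: dist_norm norm_minus_commute)
      finally show ?thesis using False b by (simp add: wb)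
    qed
    then have "x \<in> cbox (p i - w i) (p i + w i)"
      unfolding mem_box by (auto simp: inner_diff_left inner_add_left abs_le_iff algebra_simps)
    then show "x \<in> (\<Union>i. T i)" using i by (auto simp: T_def)
  qed
  moreover have em: "emeasure lebesgue (\<Union>i. T i) \<le> ennreal e"
  proof -
    have "emeasure lebesgue (\<Union>i. T i) \<le> (\<Sum>i. emeasure lebesgue (T i))"
      using meas by (intro emeasure_subadditive_countably) auto
    also have "\<dots> \<le> (\<Sum>i. ennreal k * ennreal (diam_pow s (U i)))" by (intro suminf_le Tm) auto
    also have "\<dots> = ennreal k * (\<Sum>i. ennreal (diam_pow s (U i)))" by simp
    also have "\<dots> \<le> ennreal k * ennreal (e / k)" using U(4) by (intro mult_left_mono) auto
    also have "\<dots> = ennreal e" using k e by (simp add: ennreal_mult'[symmetric])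
    finally show ?thesis .
  qed
  moreover have "(\<Union>i. T i) \<in> lmeasurable"
  proof (rule fmeasurableI)
    show "(\<Union>i. T i) \<in> sets lebesgue" using meas by blast
    show "emeasure lebesgue (\<Union>i. T i) < \<infinity>" using em by (auto intro: le_less_trans)
  qed
  moreover have "measure lebesgue (\<Union>i. T i) \<le> e"
    using em e by (simp add: measure_def enn2real_leI)
  ultimately show "\<exists>T. ?S \<subseteq> T \<and> T \<in> lmeasurable \<and> measure lebesgue T \<le> e" by blast
qed

section \<open>Coordinates\<close>

lemma depends_on_interior:
  assumes "depends_on A P"
  shows "depends_on A (\<lambda>v. v \<in> interior {v. P v})"
proof -
  have "w \<in> interior {v. P v}" if v: "v \<in> interior {v. P v}" and vw: "\<forall>i\<in>A. v i = w i" for v w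
  proof -
    obtain J e where J: "finite J" "e > 0" "\<And>u. (\<And>i. i \<in> J \<Longrightarrow> \<bar>u i - v i\<bar> < e) \<Longrightarrow> u \<in> interior {v. P v}"
      using open_seq_contains_box[OF open_interior v] by metis
    have "{u. \<forall>i\<in>J. \<bar>u i - w i\<bar> < e} \<subseteq> {v. P v}"
    proof
      fix u assume u: "u \<in> {u. \<forall>i\<in>J. \<bar>u i - w i\<bar> < e}"
      have "override_on v u A \<in> interior {v. P v}"
        using u vw J(2) by (intro J(3)) (auto simp: override_on_def)
      then have "override_on v u A \<in> {v. P v}" using interior_subset by blast
      moreover have "P (override_on v u A) = P u" by (rule depends_onD[OF assms]) auto
      ultimately show "u \<in> {v. P v}" by simp
    qed
    from interior_maximal[OF this open_seq_box[OF J(1)]] show ?thesis using J(2) by auto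
  qed
  then show ?thesis unfolding depends_on_def by metis
qed

lemma depends_on_closure:
  assumes "depends_on A P"
  shows "depends_on A (\<lambda>v. v \<in> closure {v. P v})"
proof -
  have "depends_on A (\<lambda>v. \<not> P v)" using assms unfolding depends_on_def by metis
  from depends_on_interior[OF this] show ?thesis
    by (simp add: depends_on_def Collect_neg_eq interior_complement)
qed

lemma dpred_interior: "dpred M P \<Longrightarrow> dpred M (\<lambda>v. v \<in> interior {v. P v})"
  using dpred_not[OF dpred_closure[OF dpred_not[of M P]]]
  by (simp add: Collect_neg_eq closure_complement)

lemma coord_proj_span:
  fixes B :: "'a::euclidean_space set"
  assumes sub: "B \<subseteq> Basis" and y: "y \<in> span B"
  shows "coord_proj B y = y"
proof -
  have "y = (\<Sum>b\<in>Basis. (y \<bullet> b) *\<^sub>R b)" by (simp add: euclidean_representation)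
  also have "\<dots> = (\<Sum>b\<in>B. (y \<bullet> b) *\<^sub>R b)"
  proof (rule sum.mono_neutral_right)
    show "\<forall>b\<in>Basis - B. (y \<bullet> b) *\<^sub>R b = 0"
    proof
      fix b assume b: "b \<in> Basis - B"
      have "y \<bullet> b = 0"
        using y
      proof (induction rule: span_induct_alt)
        case (step c x y)
        have "x \<in> Basis" "x \<noteq> b" using step b sub by auto
        then have "x \<bullet> b = 0" using b by (simp add: inner_Basis)
        then show ?case using step by (simp add: inner_add_left)
      qed simp
      then show "(y \<bullet> b) *\<^sub>R b = 0" by simp
    qed
  qed (use sub in auto)
  finally show ?thesis by (simp add: coord_proj_def)
qed

text \<open>Vanishing beyond the dimension gives every point a definite coordinate sequence with
  zero tail, to which predicates on sequences apply.\<close>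

locale coordinates =
  fixes e :: "nat \<Rightarrow> 'a::euclidean_space"
  assumes bij: "bij_betw e {..<DIM('a)} (Basis :: 'a set)" and zero: "\<And>i. i \<ge> DIM('a) \<Longrightarrow> e i = 0"
begin

definition co :: "'a \<Rightarrow> nat \<Rightarrow> real" where "co x = (\<lambda>i. x \<bullet> e i)"

definition pt :: "(nat \<Rightarrow> real) \<Rightarrow> 'a" where "pt v = (\<Sum>i<DIM('a). v i *\<^sub>R e i)"

lemma e_Basis: "i < DIM('a) \<Longrightarrow> e i \<in> Basis" using bij by (auto simp: bij_betw_def)

lemma e_inner: "i < DIM('a) \<Longrightarrow> j < DIM('a) \<Longrightarrow> e i \<bullet> e j = (if i = j then 1 else 0)"
proof -
  assume ij: "i < DIM('a)" "j < DIM('a)"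
  have "e i = e j \<longleftrightarrow> i = j" using ij inj_on_eq_iff[OF bij_betw_imp_inj_on[OF bij], of i j] by simp
  then show ?thesis using ij by (simp add: inner_Basis e_Basis)
qed

lemma co_pt: "i < DIM('a) \<Longrightarrow> co (pt v) i = v i"
proof -
  assume i: "i < DIM('a)"
  have "co (pt v) i = (\<Sum>k<DIM('a). v k * (e k \<bullet> e i))" by (simp add: co_def pt_def inner_sum_left)
  also have "\<dots> = (\<Sum>k<DIM('a). if k = i then v k else 0)"
    using i by (intro sum.cong refl) (auto simp: e_inner)
  also have "\<dots> = v i" using i by simp
  finally show ?thesis .
qed

lemma pt_co: "pt (co x) = x"
proof -
  have "pt (co x) = (\<Sum>b\<in>Basis. (x \<bullet> b) *\<^sub>R b)"
    unfolding pt_def co_def using sum.reindex_bij_betw[OF bij, of "\<lambda>b. (x \<bullet> b) *\<^sub>R b"] by simp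
  then show ?thesis by (simp add: euclidean_representation)
qed

lemma continuous_on_co: "continuous_on S co"
  unfolding co_def
  by (rule continuous_on_coordinatewise_then_product)
    (intro continuous_on_inner continuous_on_id continuous_on_const)

lemma continuous_on_pt: "continuous_on S pt"
  unfolding pt_def
  by (intro continuous_on_sum continuous_on_scaleR continuous_on_const
      continuous_on_subset[OF continuous_on_product_coordinates]) auto

lemma definable_coords:
  assumes "dpred M Q"
  shows "definable M {x. Q (co x)}"
proof -
  define tr where "tr v i = (if i < DIM('a) then v i else 0 :: real)" for v i
  have "dterm M (\<lambda>v. tr v i)" for i by (cases "i < DIM('a)") (auto simp: tr_def intro: dterm_intros)
  then have "dpred M (\<lambda>v. Q (tr v))" by (rule dpred_subst[OF assms])
  moreover have "depends_on {..<DIM('a)} (\<lambda>v. Q (tr v))"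
    unfolding depends_on_def by (intro allI impI arg_cong[of _ _ Q]) (auto simp: tr_def)
  ultimately have "definable M {x. Q (tr (\<lambda>i. x \<bullet> e i))}" using bij by (rule dpred_definable)
  moreover have "tr (\<lambda>i. x \<bullet> e i) = co x" for x by (auto simp: tr_def co_def zero)
  ultimately show ?thesis by simp
qed

context
  fixes P :: "(nat \<Rightarrow> real) \<Rightarrow> bool"
  assumes dep: "depends_on {..<DIM('a)} P"
begin

lemma pred_pt: "P (co (pt v)) = P v"
  by (rule depends_onD[OF dep]) (simp add: co_pt)

lemma interior_coords: "x \<in> interior {x. P (co x)} \<longleftrightarrow> co x \<in> interior {v. P v}"
proof
  assume x: "x \<in> interior {x. P (co x)}"
  have "open (pt -` interior {x. P (co x)})" by (intro open_vimage continuous_on_pt open_interior)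
  moreover have "pt -` interior {x. P (co x)} \<subseteq> {v. P v}"
    using interior_subset[of "{x. P (co x)}"] pred_pt by auto
  ultimately have "pt -` interior {x. P (co x)} \<subseteq> interior {v. P v}" by (intro interior_maximal)
  then show "co x \<in> interior {v. P v}" using x by (auto simp: pt_co)
next
  assume x: "co x \<in> interior {v. P v}"
  have "open (co -` interior {v. P v})" by (intro open_vimage continuous_on_co open_interior)
  moreover have "co -` interior {v. P v} \<subseteq> {x. P (co x)}"
    using interior_subset[of "{v. P v}"] by auto
  ultimately have "co -` interior {v. P v} \<subseteq> interior {x. P (co x)}" by (intro interior_maximal)
  then show "x \<in> interior {x. P (co x)}" using x by auto
qed

end

lemma closure_coords:
  assumes "depends_on {..<DIM('a)} P"
  shows "x \<in> closure {x. P (co x)} \<longleftrightarrow> co x \<in> closure {v. P v}"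
proof -
  have "depends_on {..<DIM('a)} (\<lambda>v. \<not> P v)" using assms unfolding depends_on_def by metis
  from interior_coords[OF this, of x] show ?thesis by (simp add: Collect_neg_eq interior_complement)
qed

text \<open>Carries interior of a projection from sequences over to the relative topology of a
  coordinate subspace, as \<open>coord_dim\<close> asks for. Membership in the interior depends on
  the coordinates in \<open>A\<close> only, so it can be read off from points of the span.\<close>

lemma interior_of_coord_proj:
  assumes dep: "depends_on {..<DIM('a)} P" and A: "A \<subseteq> {..<DIM('a)}"
    and int: "interior {u. \<exists>v. P v \<and> (\<forall>a\<in>A. v a = u a)} \<noteq> {}"
  shows "(top_of_set (span (e ` A))) interior_of (coord_proj (e ` A) ` {x. P (co x)}) \<noteq> {}"
proof -
  define S where "S = {u. \<exists>v. P v \<and> (\<forall>a\<in>A. v a = u a)}"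
  have injA: "inj_on e A" using bij A by (auto simp: bij_betw_def inj_on_def)
  have "depends_on A (\<lambda>u. \<exists>v. P v \<and> (\<forall>a\<in>A. v a = u a))"
    unfolding depends_on_def by (intro allI impI ex_cong1 conj_cong ball_cong refl) simp
  from depends_on_interior[OF this] have depS: "depends_on A (\<lambda>u. u \<in> interior S)" by (simp add: S_def)
  define W where "W = co -` interior S"
  have W: "open W" unfolding W_def by (intro open_vimage continuous_on_co open_interior)
  have cp: "coord_proj (e ` A) x = (\<Sum>a\<in>A. co x a *\<^sub>R e a)" for x
    unfolding coord_proj_def co_def by (simp add: sum.reindex[OF injA])
  have "e ` A \<subseteq> Basis" using A e_Basis by auto
  then have cospan: "coord_proj (e ` A) y = y" if "y \<in> span (e ` A)" for y
    using that by (rule coord_proj_span)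
  have "span (e ` A) \<inter> W \<subseteq> coord_proj (e ` A) ` {x. P (co x)}"
  proof
    fix y assume y: "y \<in> span (e ` A) \<inter> W"
    then have "co y \<in> S" using interior_subset unfolding W_def by auto
    then obtain v where v: "P v" "\<And>a. a \<in> A \<Longrightarrow> v a = co y a" unfolding S_def by blast
    have "coord_proj (e ` A) (pt v) = coord_proj (e ` A) y"
      unfolding cp using v(2) A by (intro sum.cong) (auto simp: co_pt)
    then have "y = coord_proj (e ` A) (pt v)" using cospan y by auto
    moreover have "P (co (pt v))" using v(1) pred_pt[OF dep] by simp
    ultimately show "y \<in> coord_proj (e ` A) ` {x. P (co x)}" by blast
  qed
  moreover have "openin (top_of_set (span (e ` A))) (span (e ` A) \<inter> W)" using W by (rule openin_open_Int)
  ultimately have "span (e ` A) \<inter> W \<subseteq> (top_of_set (span (e ` A))) interior_of (coord_proj (e ` A) ` {x. P (co x)})"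
    by (rule interior_of_maximal)
  moreover obtain u where u: "u \<in> interior S" using int by (auto simp: S_def)
  define y where "y = (\<Sum>a\<in>A. u a *\<^sub>R e a)"
  have "y \<in> span (e ` A)" unfolding y_def by (intro span_sum span_scale span_base) auto
  moreover have "co y \<in> interior S"
  proof -
    have "co y a = u a" if a: "a \<in> A" for a
    proof -
      have "finite A" using A finite_subset by blast
      have "co y a = (\<Sum>b\<in>A. u b * (e b \<bullet> e a))" by (simp add: co_def y_def inner_sum_left)
      also have "\<dots> = (\<Sum>b\<in>A. if b = a then u b else 0)"
        using A a by (intro sum.cong refl) (auto simp: e_inner subset_eq)
      also have "\<dots> = u a" using a \<open>finite A\<close> by simp
      finally show ?thesis .
    qed
    then show ?thesis using u depends_onD[OF depS, of "co y" u] by auto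
  qed
  ultimately show ?thesis unfolding W_def by blast
qed

end

section \<open>The Hausdorff dimension of definable sets\<close>

text \<open>Cells of side \<open>2 ^ (- k)\<close> have diameter at most
  \<open>n * 2 ^ (- k)\<close>, and \<open>c * 2 ^ (k * s')\<close> of them suffice; the covering
  sum for exponent \<open>s\<close> then decays like \<open>2 ^ (k * (s' - s))\<close>.\<close>

lemma hausdorff_measure_0_of_grid:
  fixes e :: "nat \<Rightarrow> 'a::euclidean_space"
  assumes "coordinates e" and B: "\<And>v i. C v \<Longrightarrow> i < DIM('a) \<Longrightarrow> \<bar>v i\<bar> \<le> real B"
    and s: "0 \<le> s'" "s' < s" and c: "\<And>k. real (card (grid (DIM('a)) C k)) \<le> c * (2 ^ k) powr s'"
  shows "hausdorff_measure s {x. C (coordinates.co e x)} = 0"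
  unfolding hausdorff_measure_eq_0_iff
proof (intro allI impI)
  fix \<delta> \<epsilon> :: real assume \<delta>: "\<delta> > 0" and \<epsilon>: "\<epsilon> > 0"
  interpret coordinates e by fact
  define n where "n = DIM('a)"
  have lim1: "(\<lambda>k. real n * (1 / 2) ^ k) \<longlonglongrightarrow> 0"
    by (intro tendsto_mult_right_zero LIMSEQ_realpow_zero) auto
  have lim2: "(\<lambda>k. c * real n powr s * (2 powr (s' - s)) ^ k) \<longlonglongrightarrow> 0"
  proof (intro tendsto_mult_right_zero LIMSEQ_realpow_zero)
    show "2 powr (s' - s) < (1 :: real)" using s by (simp add: powr_less_one)
  qed auto
  have "\<forall>\<^sub>F k in sequentially. real n * (1 / 2) ^ k < \<delta> \<and> c * real n powr s * (2 powr (s' - s)) ^ k < \<epsilon>"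
    using order_tendstoD(2)[OF lim1 \<delta>] order_tendstoD(2)[OF lim2 \<epsilon>] by (rule eventually_conj)
  then obtain k where k: "real n * (1 / 2) ^ k < \<delta>" "c * real n powr s * (2 powr (s' - s)) ^ k < \<epsilon>"
    by (auto simp: eventually_sequentially)
  define G where "G = grid n C k"
  have finG: "finite G" unfolding G_def n_def using B by (rule finite_grid)
  obtain h where h: "bij_betw h {..<card G} G" using ex_bij_betw_nat_finite[OF finG] by (auto simp: atLeast0LessThan)
  define cell where "cell x = {z :: 'a. \<forall>i<n. \<lfloor>2 ^ k * co z i\<rfloor> = x i}" for x
  define U where "U i = (if i < card G then cell (h i) else {})" for i
  have dist: "dist y z \<le> real n * (1 / 2) ^ k" if yz: "y \<in> cell x" "z \<in> cell x" for x y z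
  proof -
    have "dist y z \<le> (\<Sum>b\<in>Basis. \<bar>(y - z) \<bullet> b\<bar>)" unfolding dist_norm by (rule norm_le_l1)
    also have "\<dots> \<le> (\<Sum>b\<in>(Basis :: 'a set). (1 / 2) ^ k)"
    proof (rule sum_mono)
      fix b :: 'a assume "b \<in> Basis"
      then obtain i where i: "i < n" "b = e i" using bij by (auto simp: bij_betw_def n_def)
      have "\<lfloor>2 ^ k * co y i\<rfloor> = \<lfloor>2 ^ k * co z i\<rfloor>" using yz i(1) by (auto simp: cell_def)
      then have "\<bar>2 ^ k * co y i - 2 ^ k * co z i\<bar> \<le> 1" by linarith
      then have "2 ^ k * \<bar>co y i - co z i\<bar> \<le> 1" by (simp add: right_diff_distrib[symmetric] abs_mult)
      then show "\<bar>(y - z) \<bullet> b\<bar> \<le> (1 / 2) ^ k"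
        by (simp add: co_def i(2) inner_diff_left power_one_over field_simps)
    qed
    also have "\<dots> = real n * (1 / 2) ^ k" by (simp add: n_def)
    finally show ?thesis .
  qed
  have bdd: "bounded (cell x)" for x
  proof (cases "cell x = {}")
    case False
    then obtain y where "y \<in> cell x" by blast
    then show ?thesis using dist[of y x] unfolding bounded_def by blast
  qed simp
  have diam: "diameter (cell x) \<le> real n * (1 / 2) ^ k" for x
    by (rule diameter_le) (use dist in \<open>auto simp: dist_norm\<close>)
  have "{x. C (co x)} \<subseteq> (\<Union>i. U i)"
  proof
    fix x assume "x \<in> {x. C (co x)}"
    then have "restrict (\<lambda>i. \<lfloor>2 ^ k * co x i\<rfloor>) {..<n} \<in> G" by (auto simp: G_def grid_def)
    then have "restrict (\<lambda>i. \<lfloor>2 ^ k * co x i\<rfloor>) {..<n} \<in> h ` {..<card G}"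
      using bij_betw_imp_surj_on[OF h] by simp
    then obtain i where i: "i < card G" "h i = restrict (\<lambda>i. \<lfloor>2 ^ k * co x i\<rfloor>) {..<n}"
      by auto
    then have "x \<in> U i" by (simp add: U_def cell_def)
    then show "x \<in> (\<Union>i. U i)" by blast
  qed
  moreover have "bounded (U i) \<and> diameter (U i) \<le> \<delta>" for i
    using bdd diam[of "h i"] k(1) \<delta> by (auto simp: U_def)
  moreover have "(\<Sum>i. ennreal (diam_pow s (U i))) < ennreal \<epsilon>"
  proof -
    have s0: "s > 0" using s by simp
    define D where "D = (real n * (1 / 2) ^ k) powr s"
    have D0: "D \<ge> 0" by (simp add: D_def)
    have dp: "diam_pow s (U i) \<le> D" for i
      using s0 diam[of "h i"] diameter_ge_0[OF bdd, of "h i"]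
      by (auto simp: diam_pow_def D_def U_def intro!: powr_mono2)
    have "(\<Sum>i. ennreal (diam_pow s (U i))) = (\<Sum>i<card G. ennreal (diam_pow s (U i)))"
      by (rule suminf_finite) (auto simp: U_def diam_pow_def)
    also have "\<dots> \<le> (\<Sum>i<card G. ennreal D)" by (intro sum_mono ennreal_leI dp)
    also have "\<dots> = ennreal (real (card G) * D)" using D0 by (simp add: ennreal_of_nat_eq_real_of_nat ennreal_mult')
    also have "\<dots> < ennreal \<epsilon>"
    proof (rule ennreal_lessI[OF \<epsilon>])
      have "real (card G) * D \<le> (c * (2 ^ k) powr s') * D"
        using c[of k] D0 by (intro mult_right_mono) (auto simp: G_def n_def)
      also have "\<dots> = c * real n powr s * (2 powr (s' - s)) ^ k"
      proof -
        have p: "(2 ^ k :: real) = 2 powr real k" by (simp add: powr_realpow)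
        have q: "((1 / 2) ^ k :: real) = 2 powr (- real k)" by (simp add: powr_minus powr_realpow power_one_over inverse_eq_divide)
        have "D = real n powr s * 2 powr (- (real k * s))"
          unfolding D_def q by (simp add: powr_mult powr_powr)
        moreover have "(2 ^ k :: real) powr s' = 2 powr (real k * s')" unfolding p by (simp add: powr_powr)
        moreover have "(2 powr (s' - s) :: real) ^ k = 2 powr (real k * s' + - (real k * s))"
          by (simp add: powr_realpow[symmetric] powr_powr algebra_simps)
        ultimately show ?thesis by (simp add: powr_add[symmetric])
      qed
      finally show "real (card G) * D < \<epsilon>" using k(2) by simp
    qed
    finally show ?thesis .
  qed
  ultimately show "\<exists>U. {x. C (co x)} \<subseteq> (\<Union>i. U i) \<and> (\<forall>i. bounded (U i) \<and> diameter (U i) \<le> \<delta>) \<and>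
      (\<Sum>i. ennreal (diam_pow s (U i))) < ennreal \<epsilon>" by blast
qed

lemma hausdorff_measure_mono:
  assumes "X \<subseteq> Y" "hausdorff_measure s Y = 0"
  shows "hausdorff_measure s X = 0"
  unfolding hausdorff_measure_eq_0_iff
proof (intro allI impI)
  fix \<delta> \<epsilon> :: real assume "\<delta> > 0" "\<epsilon> > 0"
  with assms(2)[unfolded hausdorff_measure_eq_0_iff]
  obtain U where "Y \<subseteq> (\<Union>i. U i)" "\<forall>i. bounded (U i) \<and> diameter (U i) \<le> \<delta>"
    "(\<Sum>i. ennreal (diam_pow s (U i))) < ennreal \<epsilon>" by blast
  then show "\<exists>U. X \<subseteq> (\<Union>i. U i) \<and> (\<forall>i. bounded (U i) \<and> diameter (U i) \<le> \<delta>) \<and>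
      (\<Sum>i. ennreal (diam_pow s (U i))) < ennreal \<epsilon>" using assms(1) by blast
qed

context i_minimal_expansion
begin

text \<open>Box counting applies to closed bounded sets, so \<open>P\<close> is exhausted by bounded
  pieces and each piece is replaced by its closure. Closing up does not raise the dimension, since a
  definable projection that is dense in an open set already has interior.\<close>

lemma hausdorff_measure_eq_0:
  fixes e :: "nat \<Rightarrow> 'a::euclidean_space" and d :: nat
  assumes e: "coordinates e" and P: "dpred M P" "depends_on {..<DIM('a)} P" and s: "real d < s"
    and dim: "\<And>A. A \<subseteq> {..<DIM('a)} \<Longrightarrow> d < card A \<Longrightarrow> interior {u. \<exists>v. P v \<and> (\<forall>a\<in>A. v a = u a)} = {}"
  shows "hausdorff_measure s {x. P (coordinates.co e x)} = 0"
proof -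
  interpret coordinates e by fact
  define n where "n = DIM('a)"
  define PB where "PB B v \<longleftrightarrow> P v \<and> (\<forall>i<n. \<bar>v i\<bar> \<le> real B)" for B :: nat and v
  define QB where "QB B v \<longleftrightarrow> v \<in> closure {v. PB B v}" for B v
  have PBdp: "dpred M (PB B)" for B unfolding PB_def
    by (intro dpred_conj P(1) dpred_all_less dpred_abs_le dterm_intros)
  have PBdep: "depends_on {..<n} (PB B)" for B
    using P(2) unfolding depends_on_def PB_def n_def by (metis lessThan_iff)
  have QBdp: "dpred M (QB B)" for B unfolding QB_def by (rule dpred_closure[OF PBdp])
  have QBdep: "depends_on {..<n} (QB B)" for B unfolding QB_def by (rule depends_on_closure[OF PBdep])
  have null: "hausdorff_measure s {x. QB B (co x)} = 0" for B
  proof -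
    have bnd: "\<bar>v i\<bar> \<le> real B" if v: "QB B v" and i: "i < n" for v i
    proof -
      have "closed {v :: nat \<Rightarrow> real. \<bar>v i\<bar> \<le> real B}"
        by (intro closed_Collect_le continuous_on_rabs continuous_on_product_coordinates continuous_on_const)
      moreover have "{v. PB B v} \<subseteq> {v. \<bar>v i\<bar> \<le> real B}" using i by (auto simp: PB_def)
      ultimately have "closure {v. PB B v} \<subseteq> {v. \<bar>v i\<bar> \<le> real B}" by (rule closure_minimal[rotated])
      then show ?thesis using v by (auto simp: QB_def)
    qed
    have dimQ: "interior {u. \<exists>v. QB B v \<and> (\<forall>a\<in>A. v a = u a)} = {}" if A: "A \<subseteq> {..<n}" "d < card A" for A
    proof (rule ccontr)
      assume ne: "interior {u. \<exists>v. QB B v \<and> (\<forall>a\<in>A. v a = u a)} \<noteq> {}"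
      have finA: "finite A" using A(1) finite_subset by blast
      define T where "T u \<longleftrightarrow> (\<exists>v. PB B v \<and> (\<forall>a\<in>A. v a = u a))" for u
      have Tdp: "dpred M T" unfolding T_def
        by (intro dpred_exs dpred2_def[THEN iffD2] dpred_conj dpred_subst[OF PBdp] dpred_fin_all finA dpred_eq dterm_evens_odds)
      have Tdep: "depends_on A T"
        unfolding depends_on_def T_def by (intro allI impI ex_cong1 conj_cong ball_cong refl) simp
      have "{u. \<exists>v. QB B v \<and> (\<forall>a\<in>A. v a = u a)} \<subseteq> closure {u. T u}"
      proof
        fix u assume "u \<in> {u. \<exists>v. QB B v \<and> (\<forall>a\<in>A. v a = u a)}"
        then obtain v where v: "v \<in> closure {v. PB B v}" "\<And>a. a \<in> A \<Longrightarrow> v a = u a" by (auto simp: QB_def)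
        show "u \<in> closure {u. T u}" unfolding closure_seq_iff[OF finA Tdep]
        proof (intro allI impI)
          fix r :: real assume "r > 0"
          then obtain w where w: "PB B w" "\<forall>i\<in>{..<n}. \<bar>w i - v i\<bar> < r"
            using v(1) unfolding closure_seq_iff[OF finite_lessThan PBdep] by blast
          have "T w" using w(1) by (auto simp: T_def)
          moreover have "\<forall>i\<in>A. \<bar>w i - u i\<bar> < r" using w(2) v(2) A(1) by force
          ultimately show "\<exists>w. T w \<and> (\<forall>i\<in>A. \<bar>w i - u i\<bar> < r)" by blast
        qed
      qed
      then have "interior (closure {u. T u}) \<noteq> {}" using ne interior_mono by blast
      then have "interior {u. T u} \<noteq> {}" by (rule dpred_interior_closure[OF Tdp])
      moreover have "{u. T u} \<subseteq> {u. \<exists>v. P v \<and> (\<forall>a\<in>A. v a = u a)}" by (auto simp: T_def PB_def)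
      ultimately show False using dim[of A] A interior_mono[of "{u. T u}"] unfolding n_def by blast
    qed
    \<comment> \<open>Room on both sides: box counting requires \<open>s' > d\<close>, and the
      covering sums tend to 0 because \<open>s' < s\<close>.\<close>
    define s' where "s' = (real d + s) / 2"
    have s': "0 \<le> s'" "real d < s'" "s' < s" using s by (auto simp: s'_def)
    have cl: "closed {v. QB B v}" unfolding QB_def by simp
    have "0 < n" by (simp add: n_def)
    from bnd this dimQ s'(2)
    have "\<exists>c. \<forall>k. real (card (grid n (QB B) k)) \<le> c * (2 ^ k) powr s'"
      by (rule box_count_bound[OF QBdp QBdep cl])
    then obtain c where c: "\<And>k. real (card (grid n (QB B) k)) \<le> c * (2 ^ k) powr s'" by blast
    show ?thesis
      by (rule hausdorff_measure_0_of_grid[OF e, of "QB B" B s' s c]) (use bnd s' c in \<open>auto simp: n_def\<close>)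
  qed
  have "{x. P (co x)} \<subseteq> (\<Union>B. {x. QB B (co x)})"
  proof
    fix x assume x: "x \<in> {x. P (co x)}"
    obtain B :: nat where B: "norm x \<le> real B" using real_arch_simple by blast
    have "\<bar>co x i\<bar> \<le> real B" if "i < n" for i
      using Basis_le_norm[of "e i" x] e_Basis[of i] that B unfolding co_def n_def by linarith
    then have "PB B (co x)" using x by (simp add: PB_def)
    then have "QB B (co x)" unfolding QB_def using closure_subset[of "{v. PB B v}"] by blast
    then show "x \<in> (\<Union>B. {x. QB B (co x)})" by blast
  qed
  then show ?thesis using hausdorff_measure_0_UN[OF null] by (rule hausdorff_measure_mono)
qed

end

section \<open>Comparison with the coordinate dimension and Lebesgue measure\<close>

lemma coord_dim_facts:
  fixes X :: "'a::euclidean_space set"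
  assumes "X \<noteq> {}"
  shows coord_dim_ge: "\<And>B. B \<subseteq> Basis \<Longrightarrow>
      (top_of_set (span B)) interior_of (coord_proj B ` X) \<noteq> {} \<Longrightarrow> card B \<le> coord_dim X"
    and coord_dim_attained: "\<exists>B\<subseteq>Basis. card B = coord_dim X \<and>
      (top_of_set (span B)) interior_of (coord_proj B ` X) \<noteq> {}"
proof -
  define S where "S = {dim (span B) |B. B \<subseteq> Basis \<and> (top_of_set (span B)) interior_of (coord_proj B ` X) \<noteq> {}}"
  have cardB: "dim (span B) = card B" if "B \<subseteq> Basis" for B :: "'a set"
    using independent_mono[OF independent_Basis that] by (simp add: dim_span dim_eq_card_independent)
  have "S \<subseteq> (\<lambda>B. dim (span B)) ` Pow (Basis :: 'a set)" unfolding S_def by blast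
  then have fin: "finite S" by (rule finite_subset) auto
  have "coord_proj {} ` X = {0}" using assms by (auto simp: coord_proj_def)
  then have "(top_of_set (span {})) interior_of (coord_proj {} ` X) = {0 :: 'a}"
    using interior_of_topspace[of "top_of_set {0 :: 'a}"] by simp
  then have "dim (span ({} :: 'a set)) \<in> S" unfolding S_def by fastforce
  then have "S \<noteq> {}" by blast
  have cd: "coord_dim X = Max S" by (simp add: coord_dim_def S_def)
  show "card B \<le> coord_dim X"
    if "B \<subseteq> Basis" "(top_of_set (span B)) interior_of (coord_proj B ` X) \<noteq> {}" for B
  proof -
    have "dim (span B) \<in> S" using that unfolding S_def by blast
    then show ?thesis unfolding cd using Max_ge[OF fin] cardB[OF that(1)] by metis
  qed
  have "coord_dim X \<in> S" unfolding cd by (rule Max_in[OF fin \<open>S \<noteq> {}\<close>])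
  then obtain B where B: "B \<subseteq> Basis" "(top_of_set (span B)) interior_of (coord_proj B ` X) \<noteq> {}"
    "coord_dim X = dim (span B)" unfolding S_def by blast
  then show "\<exists>B\<subseteq>Basis. card B = coord_dim X \<and> (top_of_set (span B)) interior_of (coord_proj B ` X) \<noteq> {}"
    using cardB by metis
qed

text \<open>If \<open>s\<close> were smaller, the cylinder over a projection of \<open>C\<close>
  with interior would be negligible and yet contain a ball.\<close>

lemma coord_dim_le_hausdorff:
  fixes C :: "'a::euclidean_space set"
  assumes "C \<noteq> {}" and s: "0 \<le> s" "hausdorff_measure s C = 0"
  shows "real (coord_dim C) \<le> s"
proof (rule ccontr)
  assume neg: "\<not> ?thesis"
  obtain B where B: "B \<subseteq> Basis" "card B = coord_dim C"
    "(top_of_set (span B)) interior_of (coord_proj B ` C) \<noteq> {}"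
    using coord_dim_attained[OF assms(1)] by blast
  define I where "I = (top_of_set (span B)) interior_of (coord_proj B ` C)"
  have "openin (top_of_set (span B)) I" unfolding I_def by (rule openin_interior_of)
  then obtain W where W: "open W" "I = span B \<inter> W" by (auto simp: openin_open)
  obtain y0 where y0: "y0 \<in> span B" "y0 \<in> W" using B(3) W(2) by (auto simp: I_def)
  have "continuous_on UNIV (coord_proj B)"
    unfolding coord_proj_def by (intro continuous_intros)
  then have "open (coord_proj B -` W)" using W(1) by (rule open_vimage[rotated])
  moreover have "y0 \<in> coord_proj B -` W" using coord_proj_span[OF B(1) y0(1)] y0(2) by simp
  ultimately obtain r where r: "r > 0" "ball y0 r \<subseteq> coord_proj B -` W" using open_contains_ball by blast
  have inn: "coord_proj B x \<bullet> b = x \<bullet> b" if b: "b \<in> B" for x b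
  proof -
    have finB: "finite B" by (rule finite_subset[OF B(1) finite_Basis])
    have "coord_proj B x \<bullet> b = (\<Sum>b'\<in>B. (x \<bullet> b') * (b' \<bullet> b))" by (simp add: coord_proj_def inner_sum_left)
    also have "\<dots> = (\<Sum>b'\<in>B. if b' = b then x \<bullet> b' else 0)"
      using B(1) b by (intro sum.cong refl) (auto simp: inner_Basis subset_eq)
    also have "\<dots> = x \<bullet> b" using b finB by simp
    finally show ?thesis .
  qed
  have "ball y0 r \<subseteq> {x \<in> ball y0 r. \<exists>c\<in>C. \<forall>b\<in>B. x \<bullet> b = c \<bullet> b}"
  proof
    fix x assume x: "x \<in> ball y0 r"
    have "coord_proj B x \<in> span B" unfolding coord_proj_def by (intro span_sum span_scale span_base)
    then have "coord_proj B x \<in> I" using x r(2) W(2) by blast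
    then have "coord_proj B x \<in> coord_proj B ` C" unfolding I_def using interior_of_subset by fastforce
    then obtain c where c: "c \<in> C" "coord_proj B x = coord_proj B c" by blast
    have "\<forall>b\<in>B. x \<bullet> b = c \<bullet> b" using inn[of _ x] inn[of _ c] c(2) by simp
    then show "x \<in> {x \<in> ball y0 r. \<exists>c\<in>C. \<forall>b\<in>B. x \<bullet> b = c \<bullet> b}" using x c(1) by blast
  qed
  moreover have "negligible {x \<in> ball y0 r. \<exists>c\<in>C. \<forall>b\<in>B. x \<bullet> b = c \<bullet> b}"
    using neg by (intro hausdorff_null_imp_negligible_cylinder[OF B(1) s(1) _ s(2) r(1)]) (simp add: B(2))
  ultimately have "negligible (ball y0 r)" by (rule negligible_subset[rotated])
  moreover have "ball y0 r \<noteq> {}" using r(1) by simp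
  ultimately show False using open_not_negligible[OF open_ball] by blast
qed

text \<open>With all of \<open>Basis\<close> as directions, the cylinders are just the parts of
  \<open>C\<close> in balls.\<close>

lemma hausdorff_null_imp_negligible:
  fixes C :: "'a::euclidean_space set"
  assumes "0 \<le> s" "s < real (DIM('a))" "hausdorff_measure s C = 0"
  shows "negligible C"
proof -
  have "negligible {x \<in> ball 0 (real (Suc k)). \<exists>c\<in>C. \<forall>b\<in>Basis. x \<bullet> b = c \<bullet> b}" for k :: nat
    by (rule hausdorff_null_imp_negligible_cylinder[OF subset_refl assms]) simp
  then have "negligible (\<Union>k. {x \<in> ball 0 (real (Suc k)). \<exists>c\<in>C. \<forall>b\<in>Basis. x \<bullet> b = c \<bullet> b})"
    by (intro negligible_countable_Union) auto
  moreover have "C \<subseteq> (\<Union>k. {x \<in> ball 0 (real (Suc k)). \<exists>c\<in>C. \<forall>b\<in>Basis. x \<bullet> b = c \<bullet> b})"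
  proof
    fix x assume "x \<in> C"
    obtain k :: nat where "norm x < real k" using reals_Archimedean2 by blast
    then have "x \<in> ball 0 (real (Suc k))" by simp
    then show "x \<in> (\<Union>k. {x \<in> ball 0 (real (Suc k)). \<exists>c\<in>C. \<forall>b\<in>Basis. x \<bullet> b = c \<bullet> b})"
      using \<open>x \<in> C\<close> by blast
  qed
  ultimately show ?thesis by (rule negligible_subset)
qed

section \<open>Definable sets and families in coordinates\<close>

lemma definable_coordsE:
  fixes C :: "'a::euclidean_space set"
  assumes "definable M C"
  obtains e P where "coordinates e" "dpred M P" "depends_on {..<DIM('a)} P" "C = {x. P (coordinates.co e x)}"
proof -
  obtain e p where ep: "bij_betw e {..<DIM('a)} (Basis :: 'a set)" "wf_fm M p"
    "free_vars p \<subseteq> {..<DIM('a)}" "C = {x. sat M (\<lambda>i. x \<bullet> e i) p}"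
    using assms unfolding definable_def by blast
  define e' where "e' i = (if i < DIM('a) then e i else 0)" for i
  have "bij_betw e' {..<DIM('a)} (Basis :: 'a set)"
    using ep(1) by (rule bij_betw_cong[THEN iffD1, rotated]) (simp add: e'_def)
  then have e': "coordinates e'" unfolding coordinates_def by (simp add: e'_def)
  interpret coordinates e' by fact
  have "sat M (\<lambda>i. x \<bullet> e i) p = sat M (co x) p" for x
    by (rule sat_cong) (use ep(3) in \<open>auto simp: co_def e'_def\<close>)
  then have "C = {x. sat M (co x) p}" using ep(4) by simp
  moreover have "dpred M (\<lambda>v. sat M v p)" using ep(2) by (auto simp: dpred_def)
  moreover have "depends_on {..<DIM('a)} (\<lambda>v. sat M v p)"
    unfolding depends_on_def using ep(3) by (intro allI impI sat_cong) auto
  ultimately show ?thesis using that[OF e'] by blast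
qed

text \<open>The parameter of a family comes first, as in \<open>definable_family\<close>, so the
  coordinates of the point are shifted by one.\<close>

lemma coordinates_Pair:
  fixes e :: "nat \<Rightarrow> 'a::euclidean_space"
  assumes "coordinates e"
  shows "coordinates (\<lambda>i. case i of 0 \<Rightarrow> (1 :: real, 0) | Suc i \<Rightarrow> (0, e i))"
proof -
  interpret coordinates e by fact
  define f where "f = (\<lambda>i. case i of 0 \<Rightarrow> (1 :: real, 0) | Suc i \<Rightarrow> (0, e i))"
  have dom: "{..<DIM(real \<times> 'a)} = insert 0 (Suc ` {..<DIM('a)})"
    by (simp add: lessThan_Suc_eq_insert_0)
  have "f ` {..<DIM(real \<times> 'a)} = insert (1, 0) ((\<lambda>b. (0, b)) ` e ` {..<DIM('a)})"
    unfolding dom by (auto simp: f_def image_iff)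
  also have "\<dots> = Basis" using bij by (simp add: Basis_prod_def bij_betw_def)
  finally have img: "f ` {..<DIM(real \<times> 'a)} = Basis" .
  then have "inj_on f {..<DIM(real \<times> 'a)}" by (intro eq_card_imp_inj_on) auto
  then have "bij_betw f {..<DIM(real \<times> 'a)} Basis" using img by (simp add: bij_betw_def)
  moreover have "f i = 0" if "i \<ge> DIM(real \<times> 'a)" for i
    using that zero by (cases i) (auto simp: f_def zero_prod_def)
  ultimately show ?thesis unfolding coordinates_def f_def by blast
qed

lemma definable_constant_family:
  fixes e :: "nat \<Rightarrow> 'a::euclidean_space"
  assumes "coordinates e" "dpred M Q"
  shows "definable_family M (\<lambda>_. {x. Q (coordinates.co e x)})"
proof -
  define f where "f = (\<lambda>i. case i of 0 \<Rightarrow> (1 :: real, 0) | Suc i \<Rightarrow> (0, e i))"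
  have f: "coordinates f" unfolding f_def by (rule coordinates_Pair[OF assms(1)])
  have "dpred M (\<lambda>v. Q (\<lambda>i. v (Suc i)))" by (rule dpred_subst[OF assms(2)]) (rule dterm_var)
  from coordinates.definable_coords[OF f this]
  have "definable M {z. Q (\<lambda>i. coordinates.co f z (Suc i))}" .
  moreover have "coordinates.co f z (Suc i) = coordinates.co e (snd z) i" for z i
    unfolding coordinates.co_def[OF f] coordinates.co_def[OF assms(1)] by (simp add: f_def inner_prod_def)
  ultimately show ?thesis by (simp add: definable_family_def case_prod_unfold)
qed

context i_minimal_expansion
begin

theorem definable_set_dimension:
  fixes C :: "'a::euclidean_space set"
  assumes "definable M C" "C \<noteq> {}"
  shows "C \<in> sets lebesgue \<and> definably_almost_open M C \<and> hausdorff_dim C = of_nat (coord_dim C)"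
proof -
  obtain e P where e: "coordinates e" and P: "dpred M P" "depends_on {..<DIM('a)} P"
    and C: "C = {x. P (coordinates.co e x)}"
    using definable_coordsE[OF assms(1)] by metis
  interpret coordinates e by fact
  \<comment> \<open>The part of \<open>C\<close> outside its interior is definable without interior,
    hence nowhere dense; it is the exceptional set for both almost openness and
    measurability.\<close>
  define R where "R v \<longleftrightarrow> P v \<and> v \<notin> interior {v. P v}" for v
  have R: "dpred M R" unfolding R_def by (intro dpred_conj dpred_not P(1) dpred_interior)
  have Rdep: "depends_on {..<DIM('a)} R"
    using P(2) depends_on_interior[OF P(2)] unfolding depends_on_def R_def by blast
  have Rint: "interior {v. R v} = {}"
  proof -
    have "interior {v. R v} \<subseteq> interior {v. P v}" by (rule interior_mono) (auto simp: R_def)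
    moreover have "interior {v. R v} \<subseteq> - interior {v. P v}" using interior_subset[of "{v. R v}"] by (auto simp: R_def)
    ultimately show ?thesis by blast
  qed
  define F where "F = {x. R (co x)}"
  have iC: "interior C = {x. co x \<in> interior {v. P v}}" using interior_coords[OF P(2)] by (auto simp: C)
  have FC: "F = C - interior C" unfolding iC unfolding F_def R_def C by blast
  have cF: "closure F = {x. co x \<in> closure {v. R v}}" using closure_coords[OF Rdep] by (auto simp: F_def)
  have clR: "dpred M (\<lambda>v. v \<in> closure {v. R v})" by (rule dpred_closure[OF R])
  have nd: "interior (closure F) = {}"
  proof -
    have "interior {v. v \<in> closure {v. R v}} = {}" using dpred_interior_closure[OF R] Rint by auto
    then show ?thesis unfolding cF using interior_coords[OF depends_on_closure[OF Rdep]] by auto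
  qed
  \<comment> \<open>The closure of \<open>F\<close> is itself nowhere dense, so a constant family is
    a witness.\<close>
  have "definably_meager M F" unfolding definably_meager_def
  proof (intro conjI exI[of _ "\<lambda>_. closure F"] allI)
    show "definable M F" unfolding F_def by (rule definable_coords[OF R])
    show "definable_family M (\<lambda>_. closure F)" unfolding cF by (rule definable_constant_family[OF e clR])
    show "mono (\<lambda>_ :: real. closure F)" by (simp add: mono_def)
    show "F \<subseteq> (\<Union>t :: real. closure F)" using closure_subset by blast
  qed (use nd in \<open>auto simp: nowhere_dense_def\<close>)
  moreover have "definable M (interior C)" unfolding iC by (rule definable_coords[OF dpred_interior[OF P(1)]])
  moreover have "C = sym_diff (interior C) F" using interior_subset[of C] by (auto simp: FC)
  ultimately have almost: "definably_almost_open M C"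
    unfolding definably_almost_open_def using assms(1) open_interior by blast
  have meas: "C \<in> sets lebesgue"
  proof -
    \<comment> \<open>Only the full set of coordinates has more than \<open>d\<close> elements, and
      for it the projection is \<open>R\<close> itself. The exponent used next lies strictly between
      \<open>d\<close> and the dimension, so that nullity for it implies negligibility.\<close>
    define d where "d = DIM('a) - 1"
    have d: "real d < real (DIM('a)) - 1 / 2" by (simp add: d_def of_nat_diff)
    have "hausdorff_measure (real (DIM('a)) - 1 / 2) F = 0" unfolding F_def
    proof (rule hausdorff_measure_eq_0[OF e R Rdep d])
      fix A assume A: "A \<subseteq> {..<DIM('a)}" "d < card A"
      have "card A \<le> DIM('a)" using card_mono[OF _ A(1)] by simp
      then have "A = {..<DIM('a)}" using A by (intro card_subset_eq) (auto simp: d_def)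
      then have "{u. \<exists>v. R v \<and> (\<forall>a\<in>A. v a = u a)} = {v. R v}"
        using Rdep unfolding depends_on_def by blast
      then show "interior {u. \<exists>v. R v \<and> (\<forall>a\<in>A. v a = u a)} = {}" using Rint by simp
    qed
    moreover have "0 \<le> real (DIM('a)) - 1 / 2" using d of_nat_0_le_iff[of d, where 'a = real] by linarith
    moreover have "real (DIM('a)) - 1 / 2 < real (DIM('a))" by simp
    ultimately have "negligible F" by (intro hausdorff_null_imp_negligible)
    then have "F \<in> sets lebesgue" by (rule negligible_imp_sets)
    moreover have "interior C \<in> sets lebesgue" by (simp add: borel_open)
    moreover have "C = interior C \<union> F" using interior_subset[of C] by (auto simp: FC)
    ultimately show ?thesis by (metis sets.Un)
  qed
  define d where "d = coord_dim C"
  have null: "hausdorff_measure s C = 0" if s: "real d < s" for s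
    unfolding C
  proof (rule hausdorff_measure_eq_0[OF e P s])
    fix A assume A: "A \<subseteq> {..<DIM('a)}" "d < card A"
    show "interior {u. \<exists>v. P v \<and> (\<forall>a\<in>A. v a = u a)} = {}"
    proof (rule ccontr)
      assume "interior {u. \<exists>v. P v \<and> (\<forall>a\<in>A. v a = u a)} \<noteq> {}"
      from interior_of_coord_proj[OF P(2) A(1) this]
      have "(top_of_set (span (e ` A))) interior_of (coord_proj (e ` A) ` C) \<noteq> {}" by (simp add: C)
      moreover have "e ` A \<subseteq> Basis" using A(1) e_Basis by auto
      ultimately have "card (e ` A) \<le> d" unfolding d_def using coord_dim_ge[OF assms(2)] by blast
      moreover have "card (e ` A) = card A"
        by (rule card_image) (rule inj_on_subset[OF bij_betw_imp_inj_on[OF bij] A(1)])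
      ultimately show False using A(2) by simp
    qed
  qed
  have "hausdorff_dim C = ennreal (real d)"
  proof (rule antisym)
    show "ennreal (real d) \<le> hausdorff_dim C" unfolding hausdorff_dim_def
      using coord_dim_le_hausdorff[OF assms(2)] by (intro INF_greatest ennreal_leI) (auto simp: d_def)
    show "hausdorff_dim C \<le> ennreal (real d)"
    proof (rule ennreal_le_epsilon)
      fix \<epsilon> :: real assume \<epsilon>: "0 < \<epsilon>"
      have "hausdorff_dim C \<le> ennreal (real d + \<epsilon>)" unfolding hausdorff_dim_def
        using null[of "real d + \<epsilon>"] \<epsilon> by (intro INF_lower) auto
      then show "hausdorff_dim C \<le> ennreal (real d) + ennreal \<epsilon>" using \<epsilon> by simp
    qed
  qed
  then show ?thesis using almost meas by (simp add: d_def ennreal_of_nat_eq_real_of_nat)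
qed

end

theorem theorem1p3:
  fixes M :: "('f, 'r) field_expansion" and C :: "(real ^ 'n) set"
  assumes "i_minimal M"
    and "definable M C"
    and "C \<noteq> {}"
  shows "C \<in> sets lebesgue \<and> definably_almost_open M C \<and>
    hausdorff_dim C = of_nat (coord_dim C)"
proof -
  interpret i_minimal_expansion M by unfold_locales (rule assms(1))
  show ?thesis by (rule definable_set_dimension[OF assms(2,3)])
qed

end
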